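(* Let $T:[0,1)\to[0,1)$ be the Gauss map, and for each infinite probability vector $\underline p\in\mathcal P$ let $\mu_{\underline p}$ be the $T$-invariant Borel probability measure on $[0,1)$ obtained as the image, under the continued fraction map $\pi:\mathbb N^{\mathbb N}\to[0,1)$, of the Bernoulli measure on $\mathbb N^{\mathbb N}$ with weights $\underline p$. Let $d(\mu_{\underline p})$ denote the (Hausdorff) dimension of the measure $\mu_{\underline p}$, and let $$D:=\sup\{d(\mu_{\underline p}) : \underline p\in\mathcal P\}.$$ Then there exists $\underline p^\dagger=(p_k^\dagger)_{k=1}^\infty\in\mathcal P$ such that all of the following hold: 1. $d(\mu_{\underline p^\dagger})=D$, i.e. $\underline p^\dagger$ realises the supremum defining $D$; 2. there exists $c>1$ such that $\dfrac{1}{c\,k^{2D}}\le p_k^\dagger\le \dfrac{c}{k^{2D}}$ for all integers $k\ge 1$; 3. $\mu_{\underline p^\dagger}$ is ergodic (with respect to $T$).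
   Context: Here $\mathbb N=\{1,2,3,\dots\}$. The Gauss map $T:[0,1)\to[0,1)$ is defined by $T(x)=\frac1x \pmod 1$ (the fractional part of $1/x$) for $0<x<1$, and $T(0)=0$. The set of infinite probability vectors is $$\mathcal P=\Big\{\underline p=(p_k)_{k=1}^\infty\in[0,1]^{\mathbb N} : \sum_{k=1}^\infty p_k=1\Big\}.$$ For $\underline p\in\mathcal P$, $\nu_{\underline p}$ is the Bernoulli measure on $\mathbb N^{\mathbb N}$, i.e. the product measure under which the coordinates are independent and each takes the value $k$ with probability $p_k$. The map $\pi:\mathbb N^{\mathbb N}\to[0,1)$ is the continued fraction map $$\pi((x_n)_{n\ge1})=[x_1,x_2,x_3,\dots]=\cfrac{1}{x_1+\cfrac{1}{x_2+\cfrac{1}{x_3+\cdots}}}.$$ The measure $\mu_{\underline p}:=\nu_{\underline p}\pi^{-1}$ is the push-forward of $\nu_{\underline p}$ under $\pi$; it is a $T$-invariant Borel probability measure on $[0,1)$. The dimension of $\mu_{\underline p}$ is $$d(\mu_{\underline p}):=\inf\{\dim_H(B) : B \text{ is a Borel set with } \mu_{\underline p}(B)=1\},$$ where $\dim_H(B)$ is the Hausdorff dimension of $B$. *)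

theory Defs
  imports "HOL-Probability.Probability"
begin

text \<open>The positive integers are rendered as \<open>{1..} :: nat set\<close>, and \<open>A\<^sup>\<nat>\<close> as the
  extensional function space \<open>{1..} \<rightarrow>\<^sub>E A\<close>, so that index \<open>0\<close> carries no information.\<close>

definition prob_vectors :: "(nat \<Rightarrow> real) set" where
  "prob_vectors = {p \<in> {1..} \<rightarrow>\<^sub>E {0..1}. (p has_sum 1) {1..}}"

definition weight_measure :: "(nat \<Rightarrow> real) \<Rightarrow> nat measure" where
  "weight_measure p = density (count_space {1..}) (\<lambda>k. ennreal (p k))"

definition bernoulli_measure :: "(nat \<Rightarrow> real) \<Rightarrow> (nat \<Rightarrow> nat) measure" where
  "bernoulli_measure p = PiM {1..} (\<lambda>_. weight_measure p)"

text \<open>\<open>cf_convergent x m n\<close> is the finite continued fraction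
  \<open>[x\<^sub>m, x\<^sub>m\<^sub>+\<^sub>1, \<dots>, x\<^sub>m\<^sub>+\<^sub>n\<^sub>-\<^sub>1]\<close>.\<close>

fun cf_convergent :: "(nat \<Rightarrow> nat) \<Rightarrow> nat \<Rightarrow> nat \<Rightarrow> real" where
  "cf_convergent x m 0 = 0"
| "cf_convergent x m (Suc n) = 1 / (real (x m) + cf_convergent x (Suc m) n)"

definition cf_map :: "(nat \<Rightarrow> nat) \<Rightarrow> real" where
  "cf_map x = lim (\<lambda>n. cf_convergent x 1 n)"

definition gauss_map :: "real \<Rightarrow> real" where
  "gauss_map x = (if x = 0 then 0 else frac (1 / x))"

definition cf_measure :: "(nat \<Rightarrow> real) \<Rightarrow> real measure" where
  "cf_measure p = distr (bernoulli_measure p) (restrict_space borel {0..<1}) cf_map"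

text \<open>The gauge \<open>(diam U)\<^sup>s\<close> with the conventions \<open>(diam {})\<^sup>s = 0\<close> and \<open>(diam U)\<^sup>0 = 1\<close> for
  nonempty \<open>U\<close>; the latter needs a separate case because \<open>0 powr 0 = 0\<close>.\<close>

definition hausdorff_gauge :: "real \<Rightarrow> 'a::metric_space set \<Rightarrow> real" where
  "hausdorff_gauge s U = (if U = {} then 0 else if s = 0 then 1 else diameter U powr s)"

text \<open>Boundedness of the covering sets is required explicitly since \<^const>\<open>diameter\<close> is
  unspecified on unbounded sets.\<close>

definition hausdorff_premeasure :: "real \<Rightarrow> real \<Rightarrow> 'a::metric_space set \<Rightarrow> ennreal" where
  "hausdorff_premeasure \<delta> s A =
     (INF U \<in> {U :: nat \<Rightarrow> 'a set. A \<subseteq> (\<Union>i. U i) \<and> (\<forall>i. bounded (U i) \<and> diameter (U i) \<le> \<delta>)}.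
        \<Sum>i. ennreal (hausdorff_gauge s (U i)))"

definition hausdorff_measure :: "real \<Rightarrow> 'a::metric_space set \<Rightarrow> ennreal" where
  "hausdorff_measure s A = (SUP \<delta> \<in> {0<..}. hausdorff_premeasure \<delta> s A)"

text \<open>For subsets of the real line the set below contains every \<open>s > 1\<close>, so the infimum may be
  taken in \<^typ>\<open>real\<close>, and the dimension lies in \<open>[0, 1]\<close>.\<close>

definition hausdorff_dim :: "real set \<Rightarrow> real" where
  "hausdorff_dim A = Inf {s. 0 \<le> s \<and> hausdorff_measure s A = 0}"

definition measure_dim :: "real measure \<Rightarrow> real" where
  "measure_dim M = (INF B \<in> {B \<in> sets M. emeasure M B = 1}. hausdorff_dim B)"

definition ergodic :: "'a measure \<Rightarrow> ('a \<Rightarrow> 'a) \<Rightarrow> bool" where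
  "ergodic M T \<longleftrightarrow>
     prob_space M \<and> T \<in> measurable M M \<and> distr M M T = M \<and>
     (\<forall>A \<in> sets M. T -` A \<inter> space M = A \<longrightarrow> emeasure M A = 0 \<or> emeasure M A = 1)"

end

theory Submission
  imports Defs
begin

text \<open>The maximiser is found by maximising entropy over Lyapunov exponent among the weights with
  finite mean log-digit; write \<open>opt_dim\<close> for the supremum \<open>s\<close> of these ratios. Splitting the Lyapunov
  exponent into \<open>2 \<Sum> p\<^sub>k ln k\<close> and a bounded part, which is Lipschitz in total variation because
  changing one digit changes the logarithm of a continuant by its own logarithm up to \<open>2 ln 2\<close>,
  makes maximising sequences tight (since \<open>s > 1/2\<close>) and the objective upper semicontinuous. The
  first-order condition for moving mass between two digits then forces \<open>p\<^sub>k\<close> to be comparable with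
  \<open>k\<^sup>-\<^sup>2\<^sup>s\<close>.

  It remains to compare \<open>opt_dim\<close> with Hausdorff dimensions. Ratios between (powers of) the length and
  the measure of a cylinder are submultiplicative up to constants, so Chernoff's bound on blocks
  replaces the ergodic theorem. For \<open>s > opt_dim\<close> and arbitrary weights it yields covers by cylinders
  with \<open>|I|\<^sup>s \<le> \<theta>\<^sup>n \<mu>(I)\<close>, hence dimension at most \<open>s\<close>; for \<open>s < opt_dim\<close> and the maximiser it yields
  \<open>\<mu>(I) \<le> const |I|\<^sup>s\<close> almost surely, hence dimension at least \<open>s\<close> by mass distribution.\<close>

text \<open>The difficulty is the infinite alphabet: logarithms of digits are unbounded, so neither
  entropy nor Lyapunov exponent is continuous under pointwise convergence of the weights. Gibbs'
  inequality against the weights k^(-2s), summable exactly for s > 1/2, cures this: entropy minus 2s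
  times the mean log-digit is a constant minus the integral of a nonnegative function
  (\<open>entropy_gap\<close>), to which Fatou's lemma applies. Denominators of convergents are
  multiplicative only up to a factor 2. Over a block of m digits this is a bounded error, whereas
  the difference between entropy and s times the exponent grows linearly in m. So m is fixed large
  once, and independent blocks play the role of letters; the strict inequality between s and
  \<open>opt_dim\<close> provides the drift. In the lower bound the covers consist of arbitrary
  sets, and neighbouring cylinders may almost touch. The power-law weights make the digits grow
  subexponentially almost surely, which leaves gaps wide enough to compare any covering set with a
  single cylinder.\<close>

section \<open>Branches of the continued fraction expansion\<close>

text \<open>\<open>cf_branch x m n\<close> is the inverse branch of the \<open>n\<close>-th iterate of the Gauss map with digits
  \<open>x\<^sub>m, \<dots>, x\<^sub>m\<^sub>+\<^sub>n\<^sub>-\<^sub>1\<close>; it is the Moebius map \<open>t \<mapsto> (P + P' t) / (Q + Q' t)\<close> for consecutive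
  convergents \<open>P'/Q'\<close> and \<open>P/Q\<close>, and \<open>cf_den x m n t = Q + Q' t\<close>.\<close>

fun cf_branch :: "(nat \<Rightarrow> nat) \<Rightarrow> nat \<Rightarrow> nat \<Rightarrow> real \<Rightarrow> real" where
  "cf_branch x m 0 t = t"
| "cf_branch x m (Suc n) t = 1 / (real (x m) + cf_branch x (Suc m) n t)"

fun cf_den :: "(nat \<Rightarrow> nat) \<Rightarrow> nat \<Rightarrow> nat \<Rightarrow> real \<Rightarrow> real" where
  "cf_den x m 0 t = 1"
| "cf_den x m (Suc n) t = (real (x m) + cf_branch x (Suc m) n t) * cf_den x (Suc m) n t"

lemma cf_convergent_eq_branch: "cf_convergent x m n = cf_branch x m n 0"
  by (induction n arbitrary: m) auto

lemma cf_branch_add: "cf_branch x m (n + k) t = cf_branch x m n (cf_branch x (m + n) k t)"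
  by (induction n arbitrary: m) auto

lemma cf_den_add:
  "cf_den x m (n + k) t = cf_den x m n (cf_branch x (m + n) k t) * cf_den x (m + n) k t"
  by (induction n arbitrary: m) (auto simp: cf_branch_add)

lemma cf_branch_cong:
  assumes "\<And>i. i \<in> {m..<m + n} \<Longrightarrow> x i = y i"
  shows "cf_branch x m n t = cf_branch y m n t"
  using assms by (induction n arbitrary: m) auto

lemma cf_den_cong:
  assumes "\<And>i. i \<in> {m..<m + n} \<Longrightarrow> x i = y i"
  shows "cf_den x m n t = cf_den y m n t"
  using assms
proof (induction n arbitrary: m)
  case (Suc n)
  have "cf_branch x (Suc m) n t = cf_branch y (Suc m) n t"
    using Suc.prems by (intro cf_branch_cong) auto
  moreover have "cf_den x (Suc m) n t = cf_den y (Suc m) n t"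
    using Suc.prems by (intro Suc.IH) auto
  moreover have "x m = y m"
    using Suc.prems by auto
  ultimately show ?case by simp
qed simp

lemma cf_branch_shift: "cf_branch (\<lambda>i. x (i + d)) m n t = cf_branch x (m + d) n t"
  by (induction n arbitrary: m) auto

lemma cf_den_shift: "cf_den (\<lambda>i. x (i + d)) m n t = cf_den x (m + d) n t"
  by (induction n arbitrary: m) (auto simp: cf_branch_shift)

definition pos_digits :: "(nat \<Rightarrow> nat) \<Rightarrow> nat \<Rightarrow> nat \<Rightarrow> bool" where
  "pos_digits x m n \<longleftrightarrow> (\<forall>i\<in>{m..<m + n}. 1 \<le> x i)"

lemma pos_digits_Suc [simp]:
  "pos_digits x m (Suc n) \<longleftrightarrow> 1 \<le> x m \<and> pos_digits x (Suc m) n"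
proof -
  have "{m..<m + Suc n} = insert m {Suc m..<Suc m + n}"
    by auto
  then show ?thesis
    by (simp add: pos_digits_def)
qed

lemma pos_digits_add:
  "pos_digits x m (n + k) \<longleftrightarrow> pos_digits x m n \<and> pos_digits x (m + n) k"
  by (induction n arbitrary: m) (auto simp: pos_digits_def[of x _ 0])

lemma cf_branch_nonneg:
  assumes "0 \<le> t"
  shows "0 \<le> cf_branch x m n t"
  using assms by (induction n arbitrary: m) auto

lemma cf_branch_bounds:
  assumes "pos_digits x m n" "0 \<le> t" "t \<le> 1"
  shows "0 \<le> cf_branch x m n t" "cf_branch x m n t \<le> 1"
proof -
  show "0 \<le> cf_branch x m n t"
    by (rule cf_branch_nonneg) fact
  show "cf_branch x m n t \<le> 1"
  proof (cases n)
    case (Suc k)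
    then have "1 \<le> real (x m) + cf_branch x (Suc m) k t"
      using assms cf_branch_nonneg[of t x "Suc m" k] by (simp add: add_increasing2)
    then show ?thesis
      using Suc by simp
  qed (use assms in simp)
qed

lemma cf_den_ge_1:
  assumes "pos_digits x m n" "0 \<le> t"
  shows "1 \<le> cf_den x m n t"
  using assms
proof (induction n arbitrary: m)
  case (Suc n)
  then have "1 \<le> real (x m) + cf_branch x (Suc m) n t" "1 \<le> cf_den x (Suc m) n t"
    using cf_branch_nonneg[of t x "Suc m" n] by (auto simp: add_increasing2)
  then have "1 * 1 \<le> (real (x m) + cf_branch x (Suc m) n t) * cf_den x (Suc m) n t"
    by (intro mult_mono) auto
  then show ?case by simp
qed simp

text \<open>The induction must carry the numerator along: prepending a digit turns the old
  denominator into the new numerator. Length 0 is split off because there the numerator is t itself,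
  whose coefficients violate d \<le> c. The inequality b \<le> a is what limits the distortion on
  [0,1] to a factor 2.\<close>

lemma cf_den_linear:
  assumes "pos_digits x m n"
  shows "\<exists>a b. 0 \<le> b \<and> b \<le> a \<and> (\<forall>t\<ge>0. cf_den x m n t = a + b * t)"
proof -
  have "n = 0 \<or> (\<exists>a b c d. 0 \<le> b \<and> b \<le> a \<and> 0 \<le> d \<and> d \<le> c \<and>
      (\<forall>t\<ge>0. cf_den x m n t = a + b * t \<and> cf_branch x m n t * cf_den x m n t = c + d * t))"
    using assms
  proof (induction n arbitrary: m)
    case (Suc n)
    show ?case
    proof (cases "n = 0")
      case True
      then show ?thesis
        using Suc.prems
        by (intro disjI2 exI[of _ "real (x m)"] exI[of _ 1] exI[of _ 0])
           (auto simp: field_simps add_nonneg_eq_0_iff)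
    next
      case False
      then obtain a b c d where *: "0 \<le> b" "b \<le> a" "0 \<le> d" "d \<le> c"
        and t: "\<And>t. t \<ge> 0 \<Longrightarrow> cf_den x (Suc m) n t = a + b * t"
          "\<And>t. t \<ge> 0 \<Longrightarrow> cf_branch x (Suc m) n t * cf_den x (Suc m) n t = c + d * t"
        using Suc by (metis pos_digits_Suc)
      have x: "0 \<le> real (x m)" by simp
      have den: "cf_den x m (Suc n) t = (real (x m) * a + c) + (real (x m) * b + d) * t"
        if "t \<ge> 0" for t
        using t[OF that] by (simp add: algebra_simps)
      have num: "cf_branch x m (Suc n) t * cf_den x m (Suc n) t = a + b * t" if "t \<ge> 0" for t
      proof -
        have "real (x m) + cf_branch x (Suc m) n t > 0"
          using Suc.prems cf_branch_nonneg[of t x "Suc m" n] that by (simp add: add_pos_nonneg)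
        then show ?thesis
          using t(1)[OF that] by simp
      qed
      have "0 \<le> real (x m) * b + d" "real (x m) * b + d \<le> real (x m) * a + c"
        using * x by (auto intro!: add_mono mult_left_mono)
      then show ?thesis
        using *(1,2) den num by blast
    qed
  qed simp
  then show ?thesis
  proof
    assume "n = 0"
    then show ?thesis
      by (intro exI[of _ "1::real"] exI[of _ "0::real"]) auto
  qed blast
qed

lemma cf_den_bounds:
  assumes "pos_digits x m n" "0 \<le> t" "t \<le> 1"
  shows "cf_den x m n 0 \<le> cf_den x m n t" "cf_den x m n t \<le> 2 * cf_den x m n 0"
proof -
  obtain a b where ab: "0 \<le> b" "b \<le> a" "\<And>t. t \<ge> 0 \<Longrightarrow> cf_den x m n t = a + b * t"
    using cf_den_linear[OF assms(1)] by blast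
  have "b * t \<le> a"
    using ab assms mult_left_le[of t b] by simp
  then show "cf_den x m n 0 \<le> cf_den x m n t" "cf_den x m n t \<le> 2 * cf_den x m n 0"
    using ab assms by auto
qed

text \<open>In the exact rule \<open>cf_den_add\<close> the first factor is evaluated at a point of
  [0,1] instead of 0, which costs at most the factor 2. This is the source of the additive errors ln
  2 in the block estimates.\<close>

lemma cf_den_quasi_mult:
  assumes "pos_digits x m (n + k)"
  shows "cf_den x m n 0 * cf_den x (m + n) k 0 \<le> cf_den x m (n + k) 0"
    and "cf_den x m (n + k) 0 \<le> 2 * (cf_den x m n 0 * cf_den x (m + n) k 0)"
proof -
  have *: "pos_digits x m n" "pos_digits x (m + n) k"
    using assms by (simp_all add: pos_digits_add)
  have "0 \<le> cf_den x (m + n) k 0"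
    using cf_den_ge_1[OF *(2), of 0] by simp
  then show "cf_den x m n 0 * cf_den x (m + n) k 0 \<le> cf_den x m (n + k) 0"
    "cf_den x m (n + k) 0 \<le> 2 * (cf_den x m n 0 * cf_den x (m + n) k 0)"
    using cf_den_bounds[OF *(1) cf_branch_bounds[OF *(2)], of 0]
    by (auto simp: cf_den_add mult_right_mono mult.assoc[symmetric])
qed

text \<open>The Moebius map has determinant 1 or -1, so only the two denominators remain.\<close>

lemma abs_cf_branch_diff:
  assumes "pos_digits x m n" "0 \<le> t" "0 \<le> u"
  shows "\<bar>cf_branch x m n t - cf_branch x m n u\<bar> = \<bar>t - u\<bar> / (cf_den x m n t * cf_den x m n u)"
  using assms
proof (induction n arbitrary: m)
  case (Suc n)
  define a b where "a = real (x m) + cf_branch x (Suc m) n t"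
    and "b = real (x m) + cf_branch x (Suc m) n u"
  have pos: "a > 0" "b > 0"
    using Suc.prems cf_branch_nonneg[of t x "Suc m" n] cf_branch_nonneg[of u x "Suc m" n]
    unfolding a_def b_def by (simp_all add: add_pos_nonneg)
  have "\<bar>1 / a - 1 / b\<bar> = \<bar>a - b\<bar> / (a * b)"
    using pos by (simp add: diff_frac_eq abs_minus_commute)
  also have "\<bar>a - b\<bar> = \<bar>t - u\<bar> / (cf_den x (Suc m) n t * cf_den x (Suc m) n u)"
    using Suc by (simp add: a_def b_def)
  finally show ?case
    by (simp add: a_def b_def field_simps)
qed simp

text \<open>Two consecutive digits contribute (a + 1/b) b = a b + 1 \<ge> 2, hence the induction in
  steps of two.\<close>

lemma power2_le_cf_den:
  assumes "pos_digits x m n" "0 \<le> t"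
  shows "2 ^ (n div 2) \<le> cf_den x m n t"
  using assms
proof (induction n arbitrary: m rule: induct_nat_012)
  case (ge2 n)
  define b where "b = real (x (Suc m)) + cf_branch x (Suc (Suc m)) n t"
  have b: "b \<ge> 1"
    using ge2.prems cf_branch_nonneg[of t x "Suc (Suc m)" n] by (simp add: b_def add_increasing2)
  have "1 * 1 \<le> real (x m) * b"
    using b ge2.prems by (intro mult_mono) auto
  then have "2 \<le> (real (x m) + 1 / b) * b"
    using b by (simp add: field_simps)
  moreover have "2 ^ (n div 2) \<le> cf_den x (Suc (Suc m)) n t"
    using ge2 by auto
  ultimately have "2 * 2 ^ (n div 2) \<le> (real (x m) + 1 / b) * b * cf_den x (Suc (Suc m)) n t"
    by (intro mult_mono) auto
  then show ?case
    by (simp add: b_def mult.assoc)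
qed (auto simp: cf_den_ge_1 add_increasing2)

lemma prod_le_cf_den:
  assumes "0 \<le> t"
  shows "(\<Prod>i\<in>{m..<m + n}. real (x i)) \<le> cf_den x m n t"
  using assms
proof (induction n arbitrary: m)
  case (Suc n)
  have "{m..<m + Suc n} = insert m {Suc m..<Suc m + n}"
    by auto
  then have "(\<Prod>i\<in>{m..<m + Suc n}. real (x i)) = real (x m) * (\<Prod>i\<in>{Suc m..<Suc m + n}. real (x i))"
    by simp
  also have "\<dots> \<le> (real (x m) + cf_branch x (Suc m) n t) * cf_den x (Suc m) n t"
    using Suc.prems cf_branch_nonneg[of t x "Suc m" n]
    by (intro mult_mono Suc.IH prod_nonneg) simp_all
  finally show ?case by simp
qed simp

lemma cf_den_le_prod:
  assumes "pos_digits x m n" "0 \<le> t" "t \<le> 1"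
  shows "cf_den x m n t \<le> (\<Prod>i\<in>{m..<m + n}. 2 * real (x i))"
  using assms
proof (induction n arbitrary: m)
  case (Suc n)
  have *: "{m..<m + Suc n} = insert m {Suc m..<Suc m + n}"
    by auto
  have "cf_branch x (Suc m) n t \<le> real (x m)"
    using cf_branch_bounds[of x "Suc m" n t] Suc.prems by (force intro: order_trans[of _ 1])
  then have "(real (x m) + cf_branch x (Suc m) n t) * cf_den x (Suc m) n t
    \<le> (2 * real (x m)) * (\<Prod>i\<in>{Suc m..<Suc m + n}. 2 * real (x i))"
    using Suc cf_den_ge_1[of x "Suc m" n t] by (intro mult_mono Suc.IH) auto
  then show ?case
    using * by simp
qed simp

section \<open>Infinite continued fractions\<close>

text \<open>For positive digits, \<open>cf_tail x (n + 1)\<close> is the image of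
  \<open>cf_map x\<close> under the n-th iterate of the Gauss map, so orbits are indexed by the
  starting position.\<close>

definition cf_tail :: "(nat \<Rightarrow> nat) \<Rightarrow> nat \<Rightarrow> real" where
  "cf_tail x m = lim (\<lambda>n. cf_convergent x m n)"

lemma cf_map_eq_tail: "cf_map x = cf_tail x 1"
  by (simp add: cf_map_def cf_tail_def)

definition digits :: "(nat \<Rightarrow> nat) \<Rightarrow> bool" where
  "digits x \<longleftrightarrow> (\<forall>i\<ge>1. 1 \<le> x i)"

lemma digits_pos: "digits x \<Longrightarrow> 1 \<le> m \<Longrightarrow> pos_digits x m n"
  by (auto simp: digits_def pos_digits_def)

context
  fixes x :: "nat \<Rightarrow> nat" and m :: nat
  assumes digits: "digits x" and m: "1 \<le> m"
begin

lemma cf_convergent_LIMSEQ: "(\<lambda>n. cf_convergent x m n) \<longlonglongrightarrow> cf_tail x m"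
proof -
  have "Cauchy (\<lambda>n. cf_convergent x m n)"
  proof (rule CauchyI')
    fix e :: real
    assume "0 < e"
    then obtain j where j: "(1 / 2 :: real) ^ j < e"
      using real_arch_pow_inv[of e "1 / 2"] by auto
    show "\<exists>M. \<forall>a\<ge>M. \<forall>b>a. dist (cf_convergent x m a) (cf_convergent x m b) < e"
    proof (intro exI[of _ "2 * j"] allI impI)
      fix a b :: nat
      assume ab: "2 * j \<le> a" "a < b"
      define u where "u = cf_branch x (m + a) (b - a) 0"
      have u: "0 \<le> u" "u \<le> 1"
        using digits_pos[OF digits] m unfolding u_def by (auto intro!: cf_branch_bounds)
      have p: "pos_digits x m a"
        by (intro digits_pos digits m)
      have "cf_convergent x m b = cf_branch x m a u"
        using ab cf_branch_add[of x m a "b - a" 0] by (simp add: u_def cf_convergent_eq_branch)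
      then have "dist (cf_convergent x m a) (cf_convergent x m b)
        = u / (cf_den x m a 0 * cf_den x m a u)"
        using abs_cf_branch_diff[OF p, of 0 u] u by (simp add: cf_convergent_eq_branch dist_real_def)
      also have "\<dots> \<le> 1 / (2 ^ j * 1)"
      proof (intro frac_le mult_mono)
        have "(2::real) ^ j \<le> 2 ^ (a div 2)"
          using ab by (intro power_increasing) auto
        also have "\<dots> \<le> cf_den x m a 0"
          using power2_le_cf_den[OF p, of 0] by simp
        finally show "2 ^ j \<le> cf_den x m a 0" .
      qed (use u cf_den_ge_1[OF p, of u] cf_den_ge_1[OF p, of 0] in auto)
      finally show "dist (cf_convergent x m a) (cf_convergent x m b) < e"
        using j by (simp add: power_one_over)
    qed
  qed
  then show ?thesis
    unfolding cf_tail_def by (simp add: Cauchy_convergent_iff convergent_LIMSEQ_iff)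
qed

lemma cf_tail_nonneg_le_1: "0 \<le> cf_tail x m" "cf_tail x m \<le> 1"
  using cf_branch_bounds[OF digits_pos[OF digits m], of 0]
  by (auto intro!: LIMSEQ_le_const[OF cf_convergent_LIMSEQ] LIMSEQ_le_const2[OF cf_convergent_LIMSEQ]
      simp: cf_convergent_eq_branch)

end

lemma cf_tail_Suc:
  assumes "digits x" "1 \<le> m"
  shows "cf_tail x m = 1 / (real (x m) + cf_tail x (Suc m))"
proof -
  have "1 \<le> x m"
    using assms by (simp add: digits_def)
  then have pos: "real (x m) + cf_tail x (Suc m) > 0"
    using assms cf_tail_nonneg_le_1[of x "Suc m"] by (simp add: add_pos_nonneg)
  have "(\<lambda>n. cf_convergent x m (Suc n)) \<longlonglongrightarrow> 1 / (real (x m) + cf_tail x (Suc m))"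
    using pos cf_convergent_LIMSEQ[of x "Suc m"] assms by (auto intro!: tendsto_intros)
  moreover have "(\<lambda>n. cf_convergent x m (Suc n)) \<longlonglongrightarrow> cf_tail x m"
    using assms by (intro LIMSEQ_Suc cf_convergent_LIMSEQ)
  ultimately show ?thesis
    using LIMSEQ_unique by blast
qed

lemma cf_tail_pos:
  assumes "digits x" "1 \<le> m"
  shows "1 / (real (x m) + 1) \<le> cf_tail x m" "0 < cf_tail x m"
proof -
  have x: "1 \<le> x m"
    using assms by (simp add: digits_def)
  have "cf_tail x (Suc m) \<le> 1" "cf_tail x (Suc m) \<ge> 0"
    using assms cf_tail_nonneg_le_1[of x "Suc m"] by auto
  then show *: "1 / (real (x m) + 1) \<le> cf_tail x m"
    using x unfolding cf_tail_Suc[OF assms] by (intro frac_le) auto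
  have "0 < 1 / (real (x m) + 1)"
    by simp
  with * show "0 < cf_tail x m"
    by linarith
qed

lemma cf_tail_less_1:
  assumes "digits x" "1 \<le> m"
  shows "cf_tail x m < 1"
proof -
  have "1 \<le> x m"
    using assms by (simp add: digits_def)
  then show ?thesis
    using assms cf_tail_pos[of x "Suc m"] unfolding cf_tail_Suc[OF assms] by simp
qed

lemma cf_tail_eq_branch:
  assumes "digits x" "1 \<le> m"
  shows "cf_tail x m = cf_branch x m n (cf_tail x (m + n))"
  using assms(2)
proof (induction n arbitrary: m)
  case (Suc n)
  have "cf_tail x (Suc m) = cf_branch x (Suc m) n (cf_tail x (m + Suc n))"
    using Suc.IH[of "Suc m"] by simp
  then show ?case
    by (subst cf_tail_Suc[OF assms(1) Suc.prems]) simp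
qed simp

text \<open>At the true tail the denominator is an exact product along the Gauss orbit. This makes
  its logarithm a Birkhoff sum, which is how the single integral \<open>excess\<close> can describe
  all block lengths.\<close>

lemma cf_den_tail:
  assumes "digits x" "1 \<le> m"
  shows "cf_den x m n (cf_tail x (m + n)) = (\<Prod>i\<in>{m..<m + n}. 1 / cf_tail x i)"
  using assms(2)
proof (induction n arbitrary: m)
  case (Suc n)
  have "{m..<m + Suc n} = insert m {Suc m..<Suc m + n}"
    by auto
  then have "(\<Prod>i\<in>{m..<m + Suc n}. 1 / cf_tail x i)
      = 1 / cf_tail x m * (\<Prod>i\<in>{Suc m..<Suc m + n}. 1 / cf_tail x i)"
    by simp
  also have "1 / cf_tail x m = real (x m) + cf_branch x (Suc m) n (cf_tail x (m + Suc n))"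
    using cf_tail_eq_branch[OF assms(1), of "Suc m" n]
    by (subst cf_tail_Suc[OF assms(1) Suc.prems]) simp
  also have "(\<Prod>i\<in>{Suc m..<Suc m + n}. 1 / cf_tail x i) = cf_den x (Suc m) n (cf_tail x (m + Suc n))"
    using Suc.IH[of "Suc m"] by simp
  finally show ?case
    by simp
qed simp

lemma cf_convergent_approx:
  assumes "digits x" "1 \<le> m"
  shows "\<bar>cf_convergent x m n - cf_tail x m\<bar> \<le> 1 / (cf_den x m n 0)\<^sup>2"
proof -
  define u where "u = cf_tail x (m + n)"
  have u: "0 \<le> u" "u \<le> 1"
    using cf_tail_nonneg_le_1[OF assms(1), of "m + n"] assms by (auto simp: u_def)
  have p: "pos_digits x m n"
    by (intro digits_pos assms)
  have "\<bar>cf_convergent x m n - cf_tail x m\<bar> = u / (cf_den x m n 0 * cf_den x m n u)"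
    using abs_cf_branch_diff[OF p, of 0 u] u cf_tail_eq_branch[OF assms, of n]
    by (simp add: cf_convergent_eq_branch u_def)
  also have "\<dots> \<le> 1 / (cf_den x m n 0 * cf_den x m n 0)"
    using u cf_den_ge_1[OF p, of 0] cf_den_bounds(1)[OF p u] by (intro frac_le mult_mono) auto
  finally show ?thesis
    by (simp add: power2_eq_square)
qed

text \<open>After n common digits the tails are 1/(a + t) and 1/(b + s) with a + 1 \<le> b and t <
  1, so the denominators differ by at least s. This s is small only if the next digit of y is large,
  which is why \<open>y (n + 2)\<close> enters. The common inverse branch contracts by at most (2
  Q)^2.\<close>

lemma cf_map_separation:
  assumes "digits x" "digits y" and eq: "\<And>i. i \<in> {1..n} \<Longrightarrow> x i = y i" and "x (Suc n) < y (Suc n)"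
  shows "1 / (4 * (cf_den x 1 n 0)\<^sup>2 *
      ((real (x (Suc n)) + 1) * (real (y (Suc n)) + 1) * (real (y (n + 2)) + 1)))
    \<le> \<bar>cf_map x - cf_map y\<bar>"
proof -
  define u v where "u = cf_tail x (Suc n)" and "v = cf_tail y (Suc n)"
  define t s where "t = cf_tail x (n + 2)" and "s = cf_tail y (n + 2)"
  define a b where "a = real (x (Suc n))" and "b = real (y (Suc n))"
  have p: "pos_digits x 1 n" "pos_digits y 1 n"
    by (intro digits_pos assms order_refl)+
  have den: "cf_den y 1 n r = cf_den x 1 n r" "cf_branch y 1 n r = cf_branch x 1 n r" for r
    using eq by (auto intro!: cf_den_cong cf_branch_cong)
  have uv: "0 \<le> u" "u \<le> 1" "0 \<le> v" "v \<le> 1" "0 \<le> t" "t < 1" "1 / (real (y (n + 2)) + 1) \<le> s" "s \<le> 1"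
    using cf_tail_nonneg_le_1[OF assms(1), of "Suc n"] cf_tail_nonneg_le_1[OF assms(1), of "n + 2"]
      cf_tail_nonneg_le_1[OF assms(2), of "Suc n"] cf_tail_nonneg_le_1[OF assms(2), of "n + 2"]
      cf_tail_less_1[OF assms(1), of "n + 2"] cf_tail_pos[OF assms(2), of "n + 2"]
    by (auto simp: u_def v_def t_def s_def)
  have "0 < 1 / (real (y (n + 2)) + 1)"
    by simp
  with uv have s: "0 < s"
    by linarith
  have ab: "1 \<le> a" "a + 1 \<le> b"
    using assms unfolding digits_def a_def b_def by auto
  have u_eq: "u = 1 / (a + t)" and v_eq: "v = 1 / (b + s)"
    using cf_tail_Suc[OF assms(1), of "Suc n"] cf_tail_Suc[OF assms(2), of "Suc n"]
    by (auto simp: u_def v_def t_def s_def a_def b_def)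
  have "1 / ((a + 1) * (b + 1) * (real (y (n + 2)) + 1)) = (1 / (real (y (n + 2)) + 1)) / ((a + 1) * (b + 1))"
    by (simp add: field_simps)
  also have "\<dots> \<le> s / ((a + t) * (b + s))"
    using ab uv s by (intro frac_le mult_mono mult_pos_pos) auto
  also have "\<dots> \<le> ((b + s) - (a + t)) / ((a + t) * (b + s))"
    using ab uv s by (intro divide_right_mono mult_nonneg_nonneg) auto
  also have "\<dots> = u - v"
    using ab uv s unfolding u_eq v_eq by (subst diff_frac_eq) auto
  finally have *: "1 / ((a + 1) * (b + 1) * (real (y (n + 2)) + 1)) \<le> \<bar>u - v\<bar>"
    by linarith
  have "1 / (4 * (cf_den x 1 n 0)\<^sup>2 * ((a + 1) * (b + 1) * (real (y (n + 2)) + 1)))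
    = 1 / ((a + 1) * (b + 1) * (real (y (n + 2)) + 1)) / (2 * cf_den x 1 n 0 * (2 * cf_den x 1 n 0))"
    by (simp add: power2_eq_square)
  also have "\<dots> \<le> \<bar>u - v\<bar> / (cf_den x 1 n u * cf_den x 1 n v)"
  proof (rule frac_le)
    show "cf_den x 1 n u * cf_den x 1 n v \<le> 2 * cf_den x 1 n 0 * (2 * cf_den x 1 n 0)"
      using cf_den_bounds(2)[OF p(1)] uv cf_den_ge_1[OF p(1)]
      by (intro mult_mono) (auto intro: order_trans[of 0 1])
    show "0 < cf_den x 1 n u * cf_den x 1 n v"
      using cf_den_ge_1[OF p(1)] uv by (intro mult_pos_pos) (auto intro: less_le_trans[of 0 1])
  qed (use * in auto)
  also have "\<dots> = \<bar>cf_branch x 1 n u - cf_branch x 1 n v\<bar>"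
    using abs_cf_branch_diff[OF p(1), of u v] uv by simp
  also have "\<dots> = \<bar>cf_map x - cf_map y\<bar>"
    using cf_tail_eq_branch[OF assms(1), of 1 n] cf_tail_eq_branch[OF assms(2), of 1 n] den
    by (simp add: cf_map_eq_tail u_def v_def)
  finally show ?thesis
    by (simp add: a_def b_def)
qed

section \<open>The logarithmic distortion\<close>

text \<open>Subtracting the digit logarithms removes the unbounded part of the logarithm of the
  denominator; what remains is integrable for every probability vector, even when the Lyapunov
  exponent is infinite.\<close>

definition cf_psi :: "(nat \<Rightarrow> nat) \<Rightarrow> nat \<Rightarrow> nat \<Rightarrow> real" where
  "cf_psi x m n = ln (cf_den x m n 0) - (\<Sum>i\<in>{m..<m + n}. ln (real (x i)))"

lemma cf_psi_bounds:
  assumes "pos_digits x m n"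
  shows "0 \<le> cf_psi x m n" "cf_psi x m n \<le> real n * ln 2"
proof -
  have x: "x i \<ge> 1" if "i \<in> {m..<m + n}" for i
    using assms that by (auto simp: pos_digits_def)
  have pos: "0 < (\<Prod>i\<in>{m..<m + n}. real (x i))"
    using x by (intro prod_pos) (auto simp: Suc_le_eq)
  have ln1: "ln (\<Prod>i\<in>{m..<m + n}. real (x i)) = (\<Sum>i\<in>{m..<m + n}. ln (real (x i)))"
    using x by (intro ln_prod) (auto simp: Suc_le_eq)
  have "ln (\<Prod>i\<in>{m..<m + n}. 2 * real (x i)) = (\<Sum>i\<in>{m..<m + n}. ln (2 * real (x i)))"
    using x by (intro ln_prod) (auto simp: Suc_le_eq)
  also have "\<dots> = (\<Sum>i\<in>{m..<m + n}. ln 2 + ln (real (x i)))"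
    using x by (intro sum.cong refl ln_mult_pos) (auto simp: Suc_le_eq)
  finally have ln2: "ln (\<Prod>i\<in>{m..<m + n}. 2 * real (x i)) = n * ln 2 + (\<Sum>i\<in>{m..<m + n}. ln (real (x i)))"
    by (simp add: sum.distrib)
  show "0 \<le> cf_psi x m n"
    using prod_le_cf_den[of 0 x m n] pos ln1 unfolding cf_psi_def
    by (metis diff_ge_0_iff_ge ln_mono order_refl)
  have "ln (cf_den x m n 0) \<le> ln (\<Prod>i\<in>{m..<m + n}. 2 * real (x i))"
    using cf_den_le_prod[OF assms, of 0] cf_den_ge_1[OF assms, of 0] by (intro ln_mono) auto
  then show "cf_psi x m n \<le> real n * ln 2"
    unfolding cf_psi_def ln2 by simp
qed

lemma cf_psi_add_bounds:
  assumes "pos_digits x m (n + k)"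
  shows "cf_psi x m n + cf_psi x (m + n) k \<le> cf_psi x m (n + k)"
    and "cf_psi x m (n + k) \<le> cf_psi x m n + cf_psi x (m + n) k + ln 2"
proof -
  have p: "pos_digits x m n" "pos_digits x (m + n) k"
    using assms by (simp_all add: pos_digits_add)
  define a b c where "a = cf_den x m n 0" and "b = cf_den x (m + n) k 0" and "c = cf_den x m (n + k) 0"
  have ge: "1 \<le> a" "1 \<le> b" "1 \<le> c"
    using p assms unfolding a_def b_def c_def by (auto intro!: cf_den_ge_1)
  have le: "a * b \<le> c" "c \<le> 2 * (a * b)"
    unfolding a_def b_def c_def by (rule cf_den_quasi_mult[OF assms])+
  have "ln (a * b) \<le> ln c" "ln c \<le> ln (2 * (a * b))"
    using ge le by (auto intro!: ln_mono)
  then have l: "ln a + ln b \<le> ln c" "ln c \<le> ln 2 + (ln a + ln b)"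
    using ge by (simp_all add: ln_mult)
  have "{m..<m + (n + k)} = {m..<m + n} \<union> {m + n..<m + n + k}"
    by auto
  then have "(\<Sum>i\<in>{m..<m + (n + k)}. ln (real (x i)))
      = (\<Sum>i\<in>{m..<m + n}. ln (real (x i))) + (\<Sum>i\<in>{m + n..<m + n + k}. ln (real (x i)))"
    by (simp add: sum.union_disjoint)
  then show "cf_psi x m n + cf_psi x (m + n) k \<le> cf_psi x m (n + k)"
    "cf_psi x m (n + k) \<le> cf_psi x m n + cf_psi x (m + n) k + ln 2"
    using l unfolding cf_psi_def a_def b_def c_def by linarith+
qed

lemma cf_psi_cong:
  assumes "\<And>i. i \<in> {m..<m + n} \<Longrightarrow> x i = y i"
  shows "cf_psi x m n = cf_psi y m n"
  unfolding cf_psi_def using assms cf_den_cong[of m n x y] by (auto intro!: arg_cong2[where f = minus] sum.cong)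

lemma cf_psi_1: "1 \<le> x m \<Longrightarrow> cf_psi x m (Suc 0) = 0"
  by (simp add: cf_psi_def)

text \<open>Splitting the digit block at the changed digit costs at most \<open>2 ln 2\<close> by quasi-multiplicativity.\<close>

lemma cf_psi_update:
  assumes "pos_digits x m n" "pos_digits (x(j := k)) m n"
  shows "\<bar>cf_psi (x(j := k)) m n - cf_psi x m n\<bar> \<le> 2 * ln 2"
proof (cases "j \<in> {m..<m + n}")
  case False
  then have "cf_psi (x(j := k)) m n = cf_psi x m n"
    by (intro cf_psi_cong) auto
  then show ?thesis by simp
next
  case True
  define a b where "a = j - m" and "b = n - Suc (j - m)"
  have n: "n = a + (1 + b)" and j: "j = m + a"
    using True by (auto simp: a_def b_def)
  have split: "cf_psi z m a + cf_psi z (Suc j) b \<le> cf_psi z m n"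
    "cf_psi z m n \<le> cf_psi z m a + cf_psi z (Suc j) b + 2 * ln 2" if "pos_digits z m n" for z
  proof -
    have p: "pos_digits z m (a + (1 + b))" "pos_digits z (m + a) (1 + b)" "1 \<le> z (m + a)"
      using that unfolding n pos_digits_add by simp_all
    show "cf_psi z m a + cf_psi z (Suc j) b \<le> cf_psi z m n"
      "cf_psi z m n \<le> cf_psi z m a + cf_psi z (Suc j) b + 2 * ln 2"
      using cf_psi_add_bounds[OF p(1)] cf_psi_add_bounds[OF p(2)] cf_psi_1[of z "m + a"] p(3)
      unfolding n j by auto
  qed
  have eq: "cf_psi (x(j := k)) m a = cf_psi x m a" "cf_psi (x(j := k)) (Suc j) b = cf_psi x (Suc j) b"
    using j by (auto intro!: cf_psi_cong)
  show ?thesis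
    using split[OF assms(1)] split[OF assms(2)] eq by auto
qed

section \<open>Bernoulli measures\<close>

abbreviation CN :: "nat measure" where
  "CN \<equiv> count_space {1..}"

text \<open>Sums over digits become integrals against counting measure, so that Fatou's and
  Scheffe's lemmas apply to the weights.\<close>

lemma prob_vectors_iff:
  "p \<in> prob_vectors \<longleftrightarrow>
     p \<in> {1..} \<rightarrow>\<^sub>E {0..1} \<and> integrable CN p \<and> integral\<^sup>L CN p = 1"
proof -
  have "(p has_sum 1) {1..} \<longleftrightarrow> integrable CN p \<and> integral\<^sup>L CN p = 1"
    if "p \<in> {1..} \<rightarrow>\<^sub>E {0..1}"
  proof -
    have nonneg: "0 \<le> p k" if "k \<in> {1..}" for k
      using that \<open>p \<in> _\<close> by (auto simp: PiE_iff)
    have *: "Infinite_Sum.abs_summable_on p {1..} \<longleftrightarrow> p summable_on {1..}"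
      using nonneg by (auto intro!: summable_on_cong)
    show ?thesis
    proof
      assume h: "(p has_sum 1) {1..}"
      then have "Infinite_Sum.abs_summable_on p {1..}"
        using * has_sum_imp_summable by blast
      then have "Infinite_Set_Sum.abs_summable_on p {1..}"
        using abs_summable_equivalent by blast
      moreover from this have "infsetsum p {1..} = infsum p {1..}"
        by (rule infsetsum_infsum)
      ultimately show "integrable CN p \<and> integral\<^sup>L CN p = 1"
        using infsumI[OF h] by (simp add: abs_summable_on_def infsetsum_def)
    next
      assume "integrable CN p \<and> integral\<^sup>L CN p = 1"
      then have a: "Infinite_Set_Sum.abs_summable_on p {1..}" and s: "infsetsum p {1..} = 1"
        by (simp_all add: abs_summable_on_def infsetsum_def)
      then have "p summable_on {1..}"
        using * abs_summable_equivalent by blast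
      moreover have "infsum p {1..} = 1"
        using infsetsum_infsum[OF a] s by simp
      ultimately show "(p has_sum 1) {1..}"
        using has_sum_infsum by fastforce
    qed
  qed
  then show ?thesis
    by (auto simp: prob_vectors_def)
qed

text \<open>The restriction keeps shifted sequences in the extensional product space, where index 0
  holds \<open>undefined\<close>; consequently \<open>shift 0\<close> is the identity on that space
  only.\<close>

definition shift :: "nat \<Rightarrow> (nat \<Rightarrow> nat) \<Rightarrow> nat \<Rightarrow> nat" where
  "shift n x = (\<lambda>i\<in>{1..}. x (i + n))"

lemma space_weight [simp]: "space (weight_measure p) = {1..}"
  and sets_weight: "sets (weight_measure p) = Pow {1..}"
  by (simp_all add: weight_measure_def)

lemma measurable_weight: "f \<in> measurable (weight_measure p) N \<longleftrightarrow> f \<in> {1..} \<rightarrow> space N"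
  by (simp add: weight_measure_def)

lemma measurable_weight_borel [measurable]: "f \<in> borel_measurable (weight_measure p)"
  by (simp add: measurable_weight)

lemma space_bernoulli: "space (bernoulli_measure p) = {1..} \<rightarrow>\<^sub>E {1..}"
  by (simp add: bernoulli_measure_def space_PiM)

lemma digits_bernoulli: "x \<in> space (bernoulli_measure p) \<Longrightarrow> digits x"
  by (auto simp: space_bernoulli digits_def PiE_iff)

lemma measurable_coord:
  assumes "1 \<le> i"
  shows "(\<lambda>x. x i) \<in> measurable (bernoulli_measure p) (weight_measure p)"
  unfolding bernoulli_measure_def using assms by (intro measurable_component_singleton) auto

lemma measurable_coord_comp [measurable (raw)]:
  fixes f :: "nat \<Rightarrow> 'a::topological_space"
  assumes "1 \<le> i"
  shows "(\<lambda>x. f (x i)) \<in> borel_measurable (bernoulli_measure p)"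
  by (rule measurable_compose[OF measurable_coord[OF assms]]) (rule measurable_weight_borel)

lemma coord_set_measurable [measurable]:
  assumes "1 \<le> i"
  shows "{x \<in> space (bernoulli_measure p). P (x i)} \<in> sets (bernoulli_measure p)"
proof -
  have "(\<lambda>x. x i) -` {k \<in> {1..}. P k} \<inter> space (bernoulli_measure p) \<in> sets (bernoulli_measure p)"
    by (rule measurable_sets[OF measurable_coord[OF assms]]) (auto simp: sets_weight)
  also have "(\<lambda>x. x i) -` {k \<in> {1..}. P k} \<inter> space (bernoulli_measure p)
      = {x \<in> space (bernoulli_measure p). P (x i)}"
    using assms by (auto simp: space_bernoulli PiE_def)
  finally show ?thesis .
qed

lemma shift_measurable [measurable]:
  "shift n \<in> measurable (bernoulli_measure p) (bernoulli_measure p)"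
  unfolding shift_def bernoulli_measure_def
  by (intro measurable_restrict measurable_component_singleton) auto

lemma shift_space: "x \<in> space (bernoulli_measure p) \<Longrightarrow> shift n x \<in> space (bernoulli_measure p)"
  by (auto simp: space_bernoulli shift_def PiE_iff)

lemma shift_add: "shift n (shift k x) = shift (n + k) x"
  by (auto simp: shift_def fun_eq_iff ac_simps)

lemma cf_branch_shift_n: "1 \<le> m \<Longrightarrow> cf_branch (shift d x) m n t = cf_branch x (m + d) n t"
  by (subst cf_branch_shift[symmetric]) (rule cf_branch_cong, simp add: shift_def)

lemma cf_den_shift_n: "1 \<le> m \<Longrightarrow> cf_den (shift d x) m n t = cf_den x (m + d) n t"
  by (subst cf_den_shift[symmetric]) (rule cf_den_cong, simp add: shift_def)

lemma cf_tail_shift_n: "1 \<le> m \<Longrightarrow> cf_tail (shift d x) m = cf_tail x (m + d)"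
  by (simp add: cf_tail_def cf_convergent_eq_branch cf_branch_shift_n)

lemma cf_branch_measurable [measurable (raw)]:
  assumes "1 \<le> m"
  shows "(\<lambda>x. cf_branch x m n t) \<in> borel_measurable (bernoulli_measure p)"
  using assms
proof (induction n arbitrary: m)
  case (Suc n)
  have [measurable]: "(\<lambda>x. real (x m)) \<in> borel_measurable (bernoulli_measure p)"
    using Suc.prems by (rule measurable_coord_comp)
  have [measurable]: "(\<lambda>x. cf_branch x (Suc m) n t) \<in> borel_measurable (bernoulli_measure p)"
    by (rule Suc.IH) simp
  show ?case by simp
qed simp

lemma cf_den_measurable [measurable (raw)]:
  assumes "1 \<le> m"
  shows "(\<lambda>x. cf_den x m n t) \<in> borel_measurable (bernoulli_measure p)"
  using assms
proof (induction n arbitrary: m)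
  case (Suc n)
  have [measurable]: "(\<lambda>x. real (x m)) \<in> borel_measurable (bernoulli_measure p)"
    using Suc.prems by (rule measurable_coord_comp)
  have [measurable]: "(\<lambda>x. cf_branch x (Suc m) n t) \<in> borel_measurable (bernoulli_measure p)"
    "(\<lambda>x. cf_den x (Suc m) n t) \<in> borel_measurable (bernoulli_measure p)"
    by (rule cf_branch_measurable Suc.IH; simp)+
  show ?case by simp
qed simp

lemma cf_tail_measurable [measurable (raw)]:
  assumes "1 \<le> m"
  shows "(\<lambda>x. cf_tail x m) \<in> borel_measurable (bernoulli_measure p)"
  unfolding cf_tail_def cf_convergent_eq_branch
  using assms by (intro borel_measurable_lim_metric cf_branch_measurable)

lemma cf_map_measurable:
  "cf_map \<in> measurable (bernoulli_measure p) (restrict_space borel {0..<1})"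
proof (rule measurable_restrict_space2)
  show "cf_map \<in> space (bernoulli_measure p) \<rightarrow> {0..<1}"
    using cf_tail_nonneg_le_1(1)[OF digits_bernoulli] cf_tail_less_1[OF digits_bernoulli]
    by (auto simp: cf_map_eq_tail)
  show "cf_map \<in> borel_measurable (bernoulli_measure p)"
    unfolding cf_map_eq_tail[abs_def] by measurable
qed

lemma cf_psi_measurable [measurable (raw)]:
  assumes "1 \<le> m"
  shows "(\<lambda>x. cf_psi x m n) \<in> borel_measurable (bernoulli_measure p)"
  unfolding cf_psi_def using assms
  by (intro borel_measurable_diff borel_measurable_sum borel_measurable_ln cf_den_measurable
      measurable_coord_comp) auto

section \<open>Stationarity and independence of the digits\<close>

locale bernoulli =
  fixes p :: "nat \<Rightarrow> real"
  assumes prob_vector: "p \<in> prob_vectors"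
begin

abbreviation "W \<equiv> weight_measure p"
abbreviation "\<nu> \<equiv> bernoulli_measure p"

lemma p_nonneg: "1 \<le> k \<Longrightarrow> 0 \<le> p k" and p_le_1: "1 \<le> k \<Longrightarrow> p k \<le> 1"
  and p_integrable: "integrable CN p" and p_integral: "integral\<^sup>L CN p = 1"
  using prob_vector by (auto simp: prob_vectors_iff PiE_iff)

lemma AE_p_nonneg: "AE k in CN. 0 \<le> p k"
  by (auto simp: AE_count_space p_nonneg)

lemma prob_space_weight: "prob_space W"
proof
  have "emeasure W (space W) = (\<integral>\<^sup>+ k. ennreal (p k) \<partial>CN)"
    unfolding weight_measure_def
    by (subst emeasure_density) (auto intro!: nn_integral_cong simp: indicator_def)
  also have "\<dots> = 1"
    using nn_integral_eq_integral[OF p_integrable AE_p_nonneg] p_integral by simp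
  finally show "emeasure W (space W) = 1" .
qed

sublocale W: prob_space W
  by (rule prob_space_weight)

sublocale PP: product_prob_space "\<lambda>_. W" "{1..}"
  by unfold_locales

sublocale prob_space \<nu>
  unfolding bernoulli_measure_def by (rule PP.prob_space_axioms prob_space_PiM prob_space_weight)+

lemma integral_weight: "integral\<^sup>L W f = (\<integral>k. p k * f k \<partial>CN)" for f :: "nat \<Rightarrow> real"
  unfolding weight_measure_def by (subst integral_density) (auto simp: AE_p_nonneg)

lemma integrable_weight: "integrable W f \<longleftrightarrow> integrable CN (\<lambda>k. p k * f k)" for f :: "nat \<Rightarrow> real"
  unfolding weight_measure_def by (subst integrable_density) (auto simp: AE_p_nonneg)

lemma distr_coord: "1 \<le> i \<Longrightarrow> distr \<nu> W (\<lambda>x. x i) = W"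
  unfolding bernoulli_measure_def by (rule PP.PiM_component) simp

lemma integral_coord:
  fixes f :: "nat \<Rightarrow> real"
  assumes "1 \<le> i"
  shows "(\<integral>x. f (x i) \<partial>\<nu>) = integral\<^sup>L W f"
  using integral_distr[OF measurable_coord[OF assms, of p], where f = f] distr_coord[OF assms] by simp

lemma integrable_coord:
  fixes f :: "nat \<Rightarrow> real"
  assumes "1 \<le> i"
  shows "integrable \<nu> (\<lambda>x. f (x i)) \<longleftrightarrow> integrable W f"
  using integrable_distr_eq[OF measurable_coord[OF assms, of p], where f = f] distr_coord[OF assms] by simp

lemma nn_integral_coord:
  assumes "1 \<le> i"
  shows "(\<integral>\<^sup>+x. f (x i) \<partial>\<nu>) = integral\<^sup>N W f"
  using nn_integral_distr[OF measurable_coord[OF assms, of p], where f = f] distr_coord[OF assms] by simp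

lemma distr_shift: "distr \<nu> \<nu> (shift n) = \<nu>"
  using distr_PiM_reindex[of "{1..}" "\<lambda>_. W" "\<lambda>i. i + n" "{1..}"] prob_space_weight
  unfolding bernoulli_measure_def shift_def by (auto simp: inj_on_def)

lemma integral_shift:
  fixes f :: "_ \<Rightarrow> real"
  assumes "f \<in> borel_measurable \<nu>"
  shows "(\<integral>x. f (shift n x) \<partial>\<nu>) = integral\<^sup>L \<nu> f"
  using integral_distr[of "shift n" \<nu> \<nu> f] assms distr_shift by simp

lemma indep_coords: "indep_vars (\<lambda>_. W) (\<lambda>i x. x i) {1..}"
proof (subst indep_vars_iff_distr_eq_PiM')
  have "distr \<nu> (Pi\<^sub>M {1..} (\<lambda>_. W)) (\<lambda>x. \<lambda>i\<in>{1..}. x i) = distr \<nu> \<nu> (\<lambda>x. x)"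
    by (intro distr_cong) (auto simp: bernoulli_measure_def space_PiM)
  also have "\<dots> = \<nu>"
    by simp
  also have "\<dots> = (\<Pi>\<^sub>M i\<in>{1..}. distr \<nu> W (\<lambda>x. x i))"
    unfolding bernoulli_measure_def[of p] using distr_coord
    by (intro PiM_cong refl) (simp add: bernoulli_measure_def)
  finally show "distr \<nu> (Pi\<^sub>M {1..} (\<lambda>_. W)) (\<lambda>x. \<lambda>i\<in>{1..}. x i)
      = (\<Pi>\<^sub>M i\<in>{1..}. distr \<nu> W (\<lambda>x. x i))" .
qed (auto intro: measurable_coord)

text \<open>The first factor sees only the digits up to n and the second only those beyond. Both the
  zero-one law and the submultiplicativity of moments rest on this splitting.\<close>

lemma nn_integral_block_indep:
  fixes G H :: "(nat \<Rightarrow> nat) \<Rightarrow> ennreal"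
  assumes G [measurable]: "G \<in> borel_measurable \<nu>" and H [measurable]: "H \<in> borel_measurable \<nu>"
    and local: "\<And>x y. x \<in> space \<nu> \<Longrightarrow> y \<in> space \<nu> \<Longrightarrow> (\<And>i. i \<in> {1..n} \<Longrightarrow> x i = y i) \<Longrightarrow> G x = G y"
  shows "(\<integral>\<^sup>+x. G x * H (shift n x) \<partial>\<nu>) = (\<integral>\<^sup>+x. G x \<partial>\<nu>) * (\<integral>\<^sup>+x. H x \<partial>\<nu>)"
proof -
  \<comment> \<open>Padding with the legal digit 1 turns a finite word into a point of the space, so
    that \<open>G\<close> factors through the restriction \<open>X\<close>.\<close>
  define ext where "ext z = (\<lambda>i\<in>{1..}. if i \<le> n then z i else 1)" for z :: "nat \<Rightarrow> nat"
  define X where "X x = restrict (\<lambda>i. x i) {1..n}" for x :: "nat \<Rightarrow> nat"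
  define Y where "Y x = restrict (\<lambda>i. x i) {n<..}" for x :: "nat \<Rightarrow> nat"
  have ind: "indep_var (PiM {1..n} (\<lambda>_. W)) X (PiM {n<..} (\<lambda>_. W)) Y"
    unfolding X_def[abs_def] Y_def[abs_def]
    by (rule indep_var_restrict[OF indep_coords]) auto
  have ext: "ext \<in> measurable (PiM {1..n} (\<lambda>_. W)) \<nu>"
    unfolding ext_def[abs_def] bernoulli_measure_def
  proof (rule measurable_restrict)
    fix i :: nat
    assume "i \<in> {1..}"
    then show "(\<lambda>z. if i \<le> n then z i else 1) \<in> measurable (PiM {1..n} (\<lambda>_. W)) W"
      by (cases "i \<le> n") (auto intro: measurable_component_singleton)
  qed
  have sh: "shift n \<in> measurable (PiM {n<..} (\<lambda>_. W)) \<nu>"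
    unfolding shift_def[abs_def] bernoulli_measure_def
    by (intro measurable_restrict measurable_component_singleton) auto
  have ind': "indep_var borel (G \<circ> ext \<circ> X) borel (H \<circ> shift n \<circ> Y)"
    by (rule indep_var_compose[OF ind]) (use ext sh in measurable)
  have eqG: "(G \<circ> ext \<circ> X) x = G x" if "x \<in> space \<nu>" for x
    unfolding o_def
  proof (rule local)
    show "ext (X x) \<in> space \<nu>"
      using that by (auto simp: space_bernoulli ext_def X_def PiE_iff)
  qed (auto simp: that ext_def X_def)
  have eqH: "(H \<circ> shift n \<circ> Y) x = H (shift n x)" for x
    by (auto simp: shift_def Y_def intro!: arg_cong[of _ _ H])
  have "indep_vars (\<lambda>_. borel) (case_bool (G \<circ> ext \<circ> X) (H \<circ> shift n \<circ> Y)) UNIV"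
    using ind' unfolding indep_var_def
    by (rule indep_vars_cong[THEN iffD1, rotated 3]) (auto split: bool.splits)
  from indep_vars_nn_integral[OF _ this]
  have "(\<integral>\<^sup>+x. (G \<circ> ext \<circ> X) x * (H \<circ> shift n \<circ> Y) x \<partial>\<nu>)
      = (\<integral>\<^sup>+x. (G \<circ> ext \<circ> X) x \<partial>\<nu>) * (\<integral>\<^sup>+x. (H \<circ> shift n \<circ> Y) x \<partial>\<nu>)"
    by (simp add: UNIV_bool mult.commute o_def)
  also have "(\<integral>\<^sup>+x. (G \<circ> ext \<circ> X) x * (H \<circ> shift n \<circ> Y) x \<partial>\<nu>) = (\<integral>\<^sup>+x. G x * H (shift n x) \<partial>\<nu>)"
    by (intro nn_integral_cong) (simp only: eqG eqH)
  also have "(\<integral>\<^sup>+x. (G \<circ> ext \<circ> X) x \<partial>\<nu>) = (\<integral>\<^sup>+x. G x \<partial>\<nu>)"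
    by (intro nn_integral_cong) (simp only: eqG)
  also have "(\<integral>\<^sup>+x. (H \<circ> shift n \<circ> Y) x \<partial>\<nu>) = (\<integral>\<^sup>+x. H (shift n x) \<partial>\<nu>)"
    by (simp only: eqH)
  also have "\<dots> = (\<integral>\<^sup>+x. H x \<partial>\<nu>)"
    using nn_integral_distr[of "shift n" \<nu> \<nu> H] distr_shift by simp
  finally show ?thesis .
qed

section \<open>Ergodicity\<close>

text \<open>A shift-invariant event is independent of every cylinder, so conditioning on it leaves
  \<open>\<nu>\<close> unchanged.\<close>

lemma shift_invariant_0_1:
  assumes E: "E \<in> sets \<nu>" and inv: "\<And>x. x \<in> space \<nu> \<Longrightarrow> shift 1 x \<in> E \<longleftrightarrow> x \<in> E"
  shows "emeasure \<nu> E = 0 \<or> emeasure \<nu> E = 1"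
proof (rule disjCI)
  assume "emeasure \<nu> E \<noteq> 1"
  show "emeasure \<nu> E = 0"
  proof (rule ccontr)
    assume nz: "emeasure \<nu> E \<noteq> 0"
    have inv_n: "shift n x \<in> E \<longleftrightarrow> x \<in> E" if "x \<in> space \<nu>" for n x
    proof (induction n)
      case 0
      have "shift 0 x = x"
        using that by (auto simp: shift_def space_bernoulli fun_eq_iff PiE_iff extensional_def)
      then show ?case by simp
    next
      case (Suc n)
      then show ?case
        using inv[OF shift_space[OF that], of n] shift_add[of 1 n x] by simp
    qed
    have "uniform_measure \<nu> E = \<nu>"
      unfolding bernoulli_measure_def[of p]
    proof (rule PP.PiM_eq)
      fix J :: "nat set" and F :: "nat \<Rightarrow> nat set"
      assume J: "finite J" "J \<subseteq> {1..}" and F: "\<And>j. j \<in> J \<Longrightarrow> F j \<in> sets W"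
      define C where "C = prod_emb {1..} (\<lambda>_. W) J (Pi\<^sub>E J F)"
      have C [measurable]: "C \<in> sets \<nu>"
        unfolding C_def bernoulli_measure_def using J F by (intro sets_PiM_I) auto
      obtain n where n: "J \<subseteq> {1..n}"
        using J by (metis atLeastAtMost_iff atLeast_iff finite_nat_set_iff_bounded_le subset_iff)
      \<comment> \<open>By invariance E may be replaced by its preimage under
        \<open>shift n\<close>, which involves only digits beyond those that determine C.\<close>
      have "emeasure \<nu> (E \<inter> C) = (\<integral>\<^sup>+x. indicator C x * indicator E (shift n x) \<partial>\<nu>)"
        using E by (subst nn_integral_indicator[symmetric])
          (auto intro!: nn_integral_cong simp: inv_n indicator_def simp del: nn_integral_indicator)
      also have "\<dots> = emeasure \<nu> C * emeasure \<nu> E"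
      proof (subst nn_integral_block_indep)
        fix x y assume xy: "x \<in> space \<nu>" "y \<in> space \<nu>" "\<And>i. i \<in> {1..n} \<Longrightarrow> x i = y i"
        then have "restrict x J = restrict y J"
          using n by (auto simp: restrict_def fun_eq_iff)
        moreover have "z \<in> C \<longleftrightarrow> restrict z J \<in> Pi\<^sub>E J F" if "z \<in> space \<nu>" for z
          using that by (simp add: C_def prod_emb_def bernoulli_measure_def space_PiM del: restrict_PiE_iff)
        ultimately have "x \<in> C \<longleftrightarrow> y \<in> C"
          using xy(1,2) by metis
        then show "indicator C x = (indicator C y :: ennreal)"
          by (simp add: indicator_def)
      qed (use E in auto)
      also have "emeasure \<nu> C = (\<Prod>j\<in>J. emeasure W (F j))"
        unfolding C_def bernoulli_measure_def using J F by (intro PP.emeasure_PiM_emb) auto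
      finally have EC: "emeasure \<nu> (E \<inter> C) = (\<Prod>j\<in>J. emeasure W (F j)) * emeasure \<nu> E" .
      have "emeasure (uniform_measure \<nu> E) C = emeasure \<nu> (E \<inter> C) / emeasure \<nu> E"
        using E C by (rule emeasure_uniform_measure)
      also have "\<dots> = (\<Prod>j\<in>J. emeasure W (F j))"
        unfolding EC using nz by (intro ennreal_mult_divide_eq) auto
      finally have "emeasure (uniform_measure \<nu> E) C = (\<Prod>j\<in>J. emeasure W (F j))" .
      then show "emeasure (uniform_measure (Pi\<^sub>M {1..} (\<lambda>_. W)) E)
          (prod_emb {1..} (\<lambda>_. W) J (Pi\<^sub>E J F)) = (\<Prod>j\<in>J. emeasure W (F j))"
        by (simp add: C_def bernoulli_measure_def)
    qed simp
    then have "emeasure \<nu> E = emeasure (uniform_measure \<nu> E) E"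
      by simp
    also have "\<dots> = 1"
      using nz E ennreal_mult_divide_eq[of "emeasure \<nu> E" 1] by simp
    finally show False
      using \<open>emeasure \<nu> E \<noteq> 1\<close> by simp
  qed
qed

lemma gauss_map_cf_map:
  assumes "x \<in> space \<nu>"
  shows "gauss_map (cf_map x) = cf_map (shift 1 x)"
proof -
  have d: "digits x"
    using assms by (rule digits_bernoulli)
  have t: "cf_map x = 1 / (real (x 1) + cf_tail x 2)" "0 < cf_map x"
    using cf_tail_Suc[OF d, of 1] cf_tail_pos[OF d, of 1] by (simp_all add: cf_map_eq_tail numeral_2_eq_2)
  have "frac (real (x 1) + cf_tail x 2) = cf_tail x 2"
    using cf_tail_nonneg_le_1(1)[OF d, of 2] cf_tail_less_1[OF d, of 2]
    by (subst frac_unique_iff) auto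
  moreover have "cf_map (shift 1 x) = cf_tail x 2"
    unfolding cf_map_eq_tail by (subst cf_tail_shift_n) (auto simp: numeral_2_eq_2)
  ultimately show ?thesis
    using t by (simp add: gauss_map_def)
qed

lemma prob_space_cf_measure: "prob_space (cf_measure p)"
  unfolding cf_measure_def by (rule prob_space_distr[OF cf_map_measurable])

lemma emeasure_cf_measure:
  assumes "B \<in> sets (cf_measure p)"
  shows "emeasure (cf_measure p) B = emeasure \<nu> (cf_map -` B \<inter> space \<nu>)"
  using assms unfolding cf_measure_def by (simp add: emeasure_distr[OF cf_map_measurable])

text \<open>Through \<open>cf_map\<close> the Gauss map is a factor of the shift. Invariance of sets
  is meant as an equality and not up to null sets, so the pulled-back event is strictly
  shift-invariant and the zero-one law applies directly.\<close>

lemma ergodic_cf_measure: "ergodic (cf_measure p) gauss_map"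
  unfolding ergodic_def
proof (intro conjI ballI impI prob_space_cf_measure)
  define R :: "real measure" where "R = restrict_space borel {0..<1}"
  have R: "sets (cf_measure p) = sets R" "space (cf_measure p) = {0..<1}"
    by (simp_all add: cf_measure_def R_def space_restrict_space)
  have "gauss_map \<in> borel_measurable borel"
    unfolding gauss_map_def[abs_def] frac_def by measurable
  then have "gauss_map \<in> borel_measurable R"
    unfolding R_def by (rule measurable_restrict_space1)
  moreover have "gauss_map \<in> space R \<rightarrow> {0..<1}"
    by (auto simp: gauss_map_def frac_lt_1)
  ultimately have "gauss_map \<in> measurable R R"
    unfolding R_def by (intro measurable_restrict_space2)
  then show g: "gauss_map \<in> measurable (cf_measure p) (cf_measure p)"
    using measurable_cong_sets[OF R(1) R(1)] by simp
  have pi: "cf_map \<in> measurable \<nu> R"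
    unfolding R_def by (rule cf_map_measurable)
  have gR: "gauss_map \<in> measurable R R"
    by fact
  have "distr (cf_measure p) (cf_measure p) gauss_map = distr (distr \<nu> R cf_map) R gauss_map"
    by (rule distr_cong) (simp_all add: cf_measure_def R_def)
  also have "\<dots> = distr \<nu> R (\<lambda>x. gauss_map (cf_map x))"
    using gR pi by (subst distr_distr) (auto simp: o_def)
  also have "\<dots> = distr \<nu> R (\<lambda>x. cf_map (shift 1 x))"
    by (intro distr_cong refl gauss_map_cf_map)
  also have "\<dots> = distr (distr \<nu> \<nu> (shift 1)) R cf_map"
    using pi by (subst distr_distr) (auto simp: o_def)
  also have "\<dots> = cf_measure p"
    by (simp add: distr_shift cf_measure_def R_def)
  finally show "distr (cf_measure p) (cf_measure p) gauss_map = cf_measure p" .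
  fix A
  assume A: "A \<in> sets (cf_measure p)" "gauss_map -` A \<inter> space (cf_measure p) = A"
  define E where "E = cf_map -` A \<inter> space \<nu>"
  have "E \<in> sets \<nu>"
    unfolding E_def using pi A R by (auto intro: measurable_sets)
  moreover have "shift 1 x \<in> E \<longleftrightarrow> x \<in> E" if "x \<in> space \<nu>" for x
  proof -
    have "cf_map x \<in> {0..<1}"
      using measurable_space[OF pi that] by (simp add: R_def space_restrict_space)
    then have "cf_map x \<in> A \<longleftrightarrow> gauss_map (cf_map x) \<in> A"
      using A(2) R(2) by blast
    then show ?thesis
      using that shift_space[OF that] gauss_map_cf_map[OF that] by (simp add: E_def)
  qed
  ultimately have "emeasure \<nu> E = 0 \<or> emeasure \<nu> E = 1"
    by (rule shift_invariant_0_1)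
  then show "emeasure (cf_measure p) A = 0 \<or> emeasure (cf_measure p) A = 1"
    using emeasure_cf_measure[OF A(1)] by (simp add: E_def)
qed

end

section \<open>Excess, Lyapunov exponent and entropy\<close>

text \<open>The Lyapunov exponent \<open>-2 \<integral> ln x d\<mu>\<^sub>p\<close> splits into the unbounded one-digit part
  \<open>2 \<Sum> p\<^sub>k ln k\<close> and twice the bounded \<open>excess p\<close>.\<close>

definition excess :: "(nat \<Rightarrow> real) \<Rightarrow> real" where
  "excess p = (\<integral>x. - ln (cf_tail x 1) - ln (real (x 1)) \<partial>bernoulli_measure p)"

definition log_moment :: "(nat \<Rightarrow> real) \<Rightarrow> real" where
  "log_moment p = (\<integral>k. p k * ln (real k) \<partial>CN)"

definition lyapunov :: "(nat \<Rightarrow> real) \<Rightarrow> real" where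
  "lyapunov p = 2 * (log_moment p + excess p)"

definition weight_entropy :: "(nat \<Rightarrow> real) \<Rightarrow> real" where
  "weight_entropy p = (\<integral>k. - (p k * ln (p k)) \<partial>CN)"

definition finite_log_moment :: "(nat \<Rightarrow> real) \<Rightarrow> bool" where
  "finite_log_moment p \<longleftrightarrow> integrable CN (\<lambda>k. p k * ln (real k))"

section \<open>Lipschitz dependence of the excess on the weights\<close>

definition tv_dist :: "(nat \<Rightarrow> real) \<Rightarrow> (nat \<Rightarrow> real) \<Rightarrow> real" where
  "tv_dist q p = (\<integral>k. \<bar>q k - p k\<bar> \<partial>CN)"

text \<open>Since q - p has total mass zero, h may be replaced by h - h 1. Hence only the
  oscillation of h enters the estimate, while K merely secures integrability.\<close>

lemma weight_integral_diff:
  assumes "bernoulli p" "bernoulli q"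
    and bdd: "\<And>k. 1 \<le> k \<Longrightarrow> \<bar>h k\<bar> \<le> K"
    and osc: "\<And>k. 1 \<le> k \<Longrightarrow> \<bar>h k - h 1\<bar> \<le> c"
  shows "\<bar>integral\<^sup>L (weight_measure q) h - integral\<^sup>L (weight_measure p) h\<bar> \<le> c * tv_dist q p"
proof -
  interpret p: bernoulli p by fact
  interpret q: bernoulli q by fact
  have int: "integrable CN (\<lambda>k. r k * h k)" if "bernoulli r" for r
  proof -
    interpret r: bernoulli r by fact
    have "integrable CN (\<lambda>k. r k * K)"
      using r.p_integrable by simp
    then show ?thesis
    proof (rule Bochner_Integration.integrable_bound)
      show "AE k in CN. norm (r k * h k) \<le> norm (r k * K)"
        unfolding AE_count_space abs_mult real_norm_def
        using bdd by (intro ballI mult_left_mono) (auto intro: order_trans[OF _ abs_ge_self])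
    qed simp
  qed
  have "integral\<^sup>L (weight_measure q) h - integral\<^sup>L (weight_measure p) h
      = (\<integral>k. q k * h k - p k * h k \<partial>CN) - (\<integral>k. q k * h 1 - p k * h 1 \<partial>CN)"
    using p.p_integrable q.p_integrable p.p_integral q.p_integral int[OF assms(1)] int[OF assms(2)]
    by (simp add: p.integral_weight q.integral_weight)
  also have "\<dots> = (\<integral>k. (q k - p k) * (h k - h 1) \<partial>CN)"
    using p.p_integrable q.p_integrable int[OF assms(1)] int[OF assms(2)]
    by (subst Bochner_Integration.integral_diff[symmetric]) (auto simp: algebra_simps)
  also have "\<bar>\<dots>\<bar> \<le> (\<integral>k. c * \<bar>q k - p k\<bar> \<partial>CN)"
  proof (rule order_trans[OF integral_abs_bound integral_mono])
    show "integrable CN (\<lambda>k. \<bar>(q k - p k) * (h k - h 1)\<bar>)"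
      using p.p_integrable q.p_integrable int[OF assms(1)] int[OF assms(2)]
      by (intro integrable_abs) (simp add: algebra_simps)
    show "integrable CN (\<lambda>k. c * \<bar>q k - p k\<bar>)"
      using p.p_integrable q.p_integrable by (intro integrable_mult_right integrable_abs) simp
    fix k
    assume "k \<in> space CN"
    then show "\<bar>(q k - p k) * (h k - h 1)\<bar> \<le> c * \<bar>q k - p k\<bar>"
      using osc[of k] by (simp add: abs_mult mult.commute[of c] mult_left_mono)
  qed
  also have "\<dots> = c * tv_dist q p"
    by (simp add: tv_dist_def)
  finally show ?thesis .
qed

lemma sets_PiM_weight:
  assumes "finite I"
  shows "sets (PiM I (\<lambda>_. weight_measure p)) = Pow (PiE I (\<lambda>_. {1..}))"
proof -
  have "sets (PiM I (\<lambda>_. weight_measure p)) = sets (PiM I (\<lambda>_. CN))"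
    by (intro sets_PiM_cong refl) (simp add: sets_weight)
  also have "\<dots> = Pow (PiE I (\<lambda>_. {1..}))"
    using assms by (subst count_space_PiM_finite) auto
  finally show ?thesis .
qed

lemma space_PiM_weight: "space (PiM I (\<lambda>_. weight_measure p)) = PiE I (\<lambda>_. {1..})"
  by (simp add: space_PiM)

lemma measurable_PiM_weight:
  fixes f :: "_ \<Rightarrow> 'a::topological_space"
  assumes "finite I"
  shows "f \<in> borel_measurable (PiM I (\<lambda>_. weight_measure p))"
  unfolding measurable_def using sets_PiM_weight[OF assms] space_PiM_weight[of I p] by auto

text \<open>Bounded differences imply Lipschitz dependence on the weights; the digits are exchanged
  one at a time.\<close>

lemma product_integral_diff:
  fixes f :: "('i \<Rightarrow> nat) \<Rightarrow> real"
  assumes "bernoulli p" "bernoulli q" and "finite I"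
    and "\<And>x. x \<in> PiE I (\<lambda>_. {1..}) \<Longrightarrow> \<bar>f x\<bar> \<le> K"
    and "\<And>x i k. x \<in> PiE I (\<lambda>_. {1..}) \<Longrightarrow> i \<in> I \<Longrightarrow> 1 \<le> k \<Longrightarrow> \<bar>f (x(i := k)) - f x\<bar> \<le> c"
  shows "\<bar>integral\<^sup>L (PiM I (\<lambda>_. weight_measure q)) f - integral\<^sup>L (PiM I (\<lambda>_. weight_measure p)) f\<bar>
      \<le> real (card I) * (c * tv_dist q p)"
  using assms(3-5)
proof (induction I arbitrary: f rule: finite_induct)
  case empty
  interpret p: bernoulli p by fact
  interpret q: bernoulli q by fact
  show ?case
    by (simp add: PiM_empty)
next
  case (insert j I)
  interpret p: bernoulli p by fact
  interpret q: bernoulli q by fact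
  define g where "g r x = (\<integral>y. f (x(j := y)) \<partial>weight_measure r)" for r x
  have f: "\<bar>f (x(j := y))\<bar> \<le> K" if "x \<in> PiE I (\<lambda>_. {1..})" "1 \<le> y" for x y
  proof -
    have "x(j := y) \<in> PiE (insert j I) (\<lambda>_. {1..})"
      using that by (auto simp: PiE_iff extensional_def)
    then show ?thesis
      by (rule insert.prems(1))
  qed
  have int: "integrable (PiM J (\<lambda>_. weight_measure r)) h"
    if "bernoulli r" "finite J" "\<And>x. x \<in> PiE J (\<lambda>_. {1..}) \<Longrightarrow> \<bar>h x\<bar> \<le> K" for r J h
  proof -
    interpret r: bernoulli r by fact
    interpret P: prob_space "PiM J (\<lambda>_. weight_measure r)"
      by (intro prob_space_PiM r.prob_space_weight)
    show ?thesis
      using that by (intro P.integrable_const_bound[of _ K] measurable_PiM_weight AE_I2)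
        (auto simp: space_PiM_weight)
  qed
  have eq: "integral\<^sup>L (PiM (insert j I) (\<lambda>_. weight_measure r)) f
      = integral\<^sup>L (PiM I (\<lambda>_. weight_measure r)) (g r)" if "bernoulli r" for r
  proof -
    interpret r: bernoulli r by fact
    interpret P: product_sigma_finite "\<lambda>_. weight_measure r" ..
    show ?thesis
      unfolding g_def using insert int[OF that, of "insert j I" f] by (intro P.product_integral_insert) auto
  qed
  have g_bdd: "\<bar>g r x\<bar> \<le> K" if "bernoulli r" "x \<in> PiE I (\<lambda>_. {1..})" for r x
  proof -
    interpret r: bernoulli r by fact
    have K: "0 \<le> K"
      using f[OF that(2), of 1] by simp
    have "\<bar>g r x\<bar> \<le> (\<integral>y. K \<partial>weight_measure r)"
      unfolding g_def using f[OF that(2)] K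
      by (intro order_trans[OF integral_abs_bound] integral_mono' ) auto
    then show ?thesis
      using r.W.prob_space by simp
  qed
  have diff1: "\<bar>g q x - g p x\<bar> \<le> c * tv_dist q p" if "x \<in> PiE I (\<lambda>_. {1..})" for x
    unfolding g_def
  proof (rule weight_integral_diff[OF assms(1,2), of _ K])
    fix k :: nat
    assume "1 \<le> k"
    then show "\<bar>f (x(j := k))\<bar> \<le> K"
      using f that by auto
    have "x(j := 1) \<in> PiE (insert j I) (\<lambda>_. {1..})"
      using that by (auto simp: PiE_iff extensional_def)
    from insert.prems(2)[OF this _ \<open>1 \<le> k\<close>, of j] show "\<bar>f (x(j := k)) - f (x(j := 1))\<bar> \<le> c"
      unfolding fun_upd_upd by blast
  qed
  \<comment> \<open>The comparison passes through the mixed integral of \<open>g p\<close> against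
    the product of q: here the induction hypothesis changes the measure, whereas
    \<open>diff1\<close> changes the integrand.\<close>
  have diff2: "\<bar>integral\<^sup>L (PiM I (\<lambda>_. weight_measure q)) (g p) - integral\<^sup>L (PiM I (\<lambda>_. weight_measure p)) (g p)\<bar>
      \<le> real (card I) * (c * tv_dist q p)"
  proof (rule insert.IH)
    show "\<bar>g p x\<bar> \<le> K" if "x \<in> PiE I (\<lambda>_. {1..})" for x
      using g_bdd[OF assms(1) that] .
    fix x :: "'i \<Rightarrow> nat" and i and k :: nat
    assume *: "x \<in> PiE I (\<lambda>_. {1..})" "i \<in> I" "1 \<le> k"
    then have ij: "i \<noteq> j"
      using insert.hyps by auto
    have x': "x(i := k) \<in> PiE I (\<lambda>_. {1..})"
      using * by (auto simp: PiE_iff extensional_def)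
    have ints: "integrable (weight_measure p) (\<lambda>y. f (z(j := y)))" if "z \<in> PiE I (\<lambda>_. {1..})" for z
      using f[OF that] by (intro p.W.integrable_const_bound[of _ K] AE_I2) auto
    have c: "\<bar>f ((x(i := k))(j := y)) - f (x(j := y))\<bar> \<le> c" if "1 \<le> y" for y
    proof -
      have "x(j := y) \<in> PiE (insert j I) (\<lambda>_. {1..})"
        using * that by (auto simp: PiE_iff extensional_def)
      from insert.prems(2)[OF this _ *(3), of i] show ?thesis
        using * unfolding fun_upd_twist[OF ij] by blast
    qed
    have c0: "0 \<le> c"
      using c[of 1] by simp
    have "g p (x(i := k)) - g p x = (\<integral>y. f ((x(i := k))(j := y)) - f (x(j := y)) \<partial>weight_measure p)"
      unfolding g_def using ints[OF x'] ints[OF *(1)] by simp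
    also have "\<bar>\<dots>\<bar> \<le> (\<integral>y. c \<partial>weight_measure p)"
      using c c0 by (intro order_trans[OF integral_abs_bound] integral_mono') auto
    also have "\<dots> = c"
      using p.W.prob_space by simp
    finally show "\<bar>g p (x(i := k)) - g p x\<bar> \<le> c" .
  qed
  interpret Q: prob_space "PiM I (\<lambda>_. weight_measure q)"
    by (intro prob_space_PiM q.prob_space_weight)
  have "c * tv_dist q p \<ge> 0"
    using diff1[of "\<lambda>i\<in>I. 1"] by (auto intro: order_trans[OF abs_ge_zero])
  then have "\<bar>\<integral>x. g q x - g p x \<partial>PiM I (\<lambda>_. weight_measure q)\<bar>
      \<le> (\<integral>x. c * tv_dist q p \<partial>PiM I (\<lambda>_. weight_measure q))"
    using diff1 by (intro order_trans[OF integral_abs_bound] integral_mono') (auto simp: space_PiM_weight)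
  also have "\<dots> = c * tv_dist q p"
    using Q.prob_space by simp
  also have "(\<integral>x. g q x - g p x \<partial>PiM I (\<lambda>_. weight_measure q))
      = integral\<^sup>L (PiM I (\<lambda>_. weight_measure q)) (g q) - integral\<^sup>L (PiM I (\<lambda>_. weight_measure q)) (g p)"
    using insert.hyps g_bdd assms(1,2) by (intro Bochner_Integration.integral_diff int) auto
  finally have "\<bar>integral\<^sup>L (PiM I (\<lambda>_. weight_measure q)) (g q)
      - integral\<^sup>L (PiM I (\<lambda>_. weight_measure q)) (g p)\<bar> \<le> c * tv_dist q p" .
  with diff2 have "\<bar>integral\<^sup>L (PiM I (\<lambda>_. weight_measure q)) (g q)
      - integral\<^sup>L (PiM I (\<lambda>_. weight_measure p)) (g p)\<bar> \<le> c * tv_dist q p + real (card I) * (c * tv_dist q p)"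
    by linarith
  then show ?case
    using insert.hyps eq[OF assms(1)] eq[OF assms(2)] by (simp add: distrib_right)
qed

section \<open>The excess as asymptotic mean of the block distortion\<close>

context bernoulli
begin

lemma psi_pos_digits: "x \<in> space \<nu> \<Longrightarrow> 1 \<le> m \<Longrightarrow> pos_digits x m n"
  by (rule digits_pos[OF digits_bernoulli])

lemma integrable_psi: "1 \<le> m \<Longrightarrow> integrable \<nu> (\<lambda>x. cf_psi x m n)"
  using cf_psi_bounds[OF psi_pos_digits]
  by (intro integrable_const_bound[of _ "real n * ln 2"] AE_I2 cf_psi_measurable) auto

lemma integral_psi_PiM:
  "(\<integral>x. cf_psi x 1 n \<partial>\<nu>) = (\<integral>x. cf_psi x 1 n \<partial>PiM {1..n} (\<lambda>_. W))"
proof -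
  have eq: "distr \<nu> (PiM {1..n} (\<lambda>_. W)) (\<lambda>x. restrict x {1..n}) = PiM {1..n} (\<lambda>_. W)"
    unfolding bernoulli_measure_def by (rule PP.distr_PiM_restrict_finite) auto
  have "(\<lambda>x. restrict x {1..n}) \<in> measurable \<nu> (PiM {1..n} (\<lambda>_. W))"
    unfolding bernoulli_measure_def by (intro measurable_restrict_subset) auto
  then have "(\<integral>x. cf_psi x 1 n \<partial>PiM {1..n} (\<lambda>_. W)) = (\<integral>x. cf_psi (restrict x {1..n}) 1 n \<partial>\<nu>)"
    by (subst eq[symmetric], subst integral_distr) (auto intro: measurable_PiM_weight)
  also have "\<dots> = (\<integral>x. cf_psi x 1 n \<partial>\<nu>)"
    by (intro Bochner_Integration.integral_cong refl cf_psi_cong) auto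
  finally show ?thesis ..
qed

lemma excess_integrand_bounds:
  assumes "x \<in> space \<nu>" "1 \<le> m"
  shows "0 \<le> - ln (cf_tail x m) - ln (real (x m))" "- ln (cf_tail x m) - ln (real (x m)) \<le> ln 2"
proof -
  have d: "digits x"
    using assms(1) by (rule digits_bernoulli)
  have x: "1 \<le> x m"
    using d assms by (simp add: digits_def)
  have t: "0 \<le> cf_tail x (Suc m)" "cf_tail x (Suc m) \<le> 1"
    using cf_tail_nonneg_le_1[OF d, of "Suc m"] by auto
  have "- ln (cf_tail x m) = ln (real (x m) + cf_tail x (Suc m))"
    using x t by (subst cf_tail_Suc[OF d assms(2)]) (simp add: ln_div)
  moreover have "ln (real (x m)) \<le> ln (real (x m) + cf_tail x (Suc m))"
    using x t by (intro ln_mono) auto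
  moreover have "ln (real (x m) + cf_tail x (Suc m)) \<le> ln (2 * real (x m))"
    using x t by (intro ln_mono) auto
  moreover have "ln (2 * real (x m)) = ln 2 + ln (real (x m))"
    using x by (simp add: ln_mult)
  ultimately show "0 \<le> - ln (cf_tail x m) - ln (real (x m))"
    "- ln (cf_tail x m) - ln (real (x m)) \<le> ln 2"
    by linarith+
qed

lemma excess_integrand_measurable:
  "1 \<le> m \<Longrightarrow> (\<lambda>x. - ln (cf_tail x m) - ln (real (x m))) \<in> borel_measurable \<nu>"
  by (intro borel_measurable_diff borel_measurable_uminus borel_measurable_ln cf_tail_measurable
      measurable_coord_comp)

lemma integrable_excess_integrand:
  "1 \<le> m \<Longrightarrow> integrable \<nu> (\<lambda>x. - ln (cf_tail x m) - ln (real (x m)))"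
  using excess_integrand_bounds
  by (intro integrable_const_bound[of _ "ln 2"] AE_I2 excess_integrand_measurable) auto

lemma integral_excess_integrand:
  assumes "1 \<le> m"
  shows "(\<integral>x. - ln (cf_tail x m) - ln (real (x m)) \<partial>\<nu>) = excess p"
proof -
  have "cf_tail (shift (m - 1) x) 1 = cf_tail x m" "shift (m - 1) x 1 = x m" for x :: "nat \<Rightarrow> nat"
    using assms by (cases m; simp add: cf_tail_shift_n; simp add: shift_def)+
  then have "(\<integral>x. - ln (cf_tail x m) - ln (real (x m)) \<partial>\<nu>)
      = (\<integral>x. - ln (cf_tail (shift (m - 1) x) 1) - ln (real (shift (m - 1) x 1)) \<partial>\<nu>)"
    by (simp only:)
  also have "\<dots> = excess p"
    unfolding excess_def using excess_integrand_measurable[of 1]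
    by (intro integral_shift[where f = "\<lambda>x. - ln (cf_tail x 1) - ln (real (x 1))"]) simp
  finally show ?thesis .
qed

text \<open>The Birkhoff sum S of the excess integrand is the block distortion with the denominator
  taken at the true tail instead of 0. These denominators differ by at most a factor 2, so the error
  ln 2 does not grow with n; stationarity gives each summand the mean
  \<open>excess p\<close>.\<close>

lemma excess_psi_bounds:
  shows "(\<integral>x. cf_psi x 1 n \<partial>\<nu>) \<le> real n * excess p"
    and "real n * excess p \<le> (\<integral>x. cf_psi x 1 n \<partial>\<nu>) + ln 2"
proof -
  define S where "S x = (\<Sum>i\<in>{1..<1 + n}. - ln (cf_tail x i) - ln (real (x i)))" for x
  have int: "integrable \<nu> (\<lambda>x. - ln (cf_tail x i) - ln (real (x i)))" if "i \<in> {1..<1 + n}" for i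
    using that by (intro integrable_excess_integrand) auto
  have S: "integrable \<nu> S"
    unfolding S_def[abs_def] by (intro Bochner_Integration.integrable_sum int)
  have "integral\<^sup>L \<nu> S = (\<Sum>i\<in>{1..<1 + n}. excess p)"
    unfolding S_def[abs_def] by (subst Bochner_Integration.integral_sum[OF int])
      (auto intro!: sum.cong integral_excess_integrand simp del: One_nat_def sum_constant)
  then have S': "integral\<^sup>L \<nu> S = real n * excess p"
    by simp
  have b: "cf_psi x 1 n \<le> S x" "S x \<le> cf_psi x 1 n + ln 2" if "x \<in> space \<nu>" for x
  proof -
    have d: "digits x"
      using that by (rule digits_bernoulli)
    define t where "t = cf_tail x (1 + n)"
    have t: "0 \<le> t" "t \<le> 1"
      using cf_tail_nonneg_le_1[OF d, of "1 + n"] by (auto simp: t_def)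
    have p: "pos_digits x 1 n"
      by (rule psi_pos_digits[OF that]) simp
    have "ln (cf_den x 1 n t) = (\<Sum>i\<in>{1..<1 + n}. ln (1 / cf_tail x i))"
      unfolding t_def cf_den_tail[OF d order_refl]
    proof (rule ln_prod)
      fix i
      assume "i \<in> {1..<1 + n}"
      then have "0 < cf_tail x i"
        by (intro cf_tail_pos(2)[OF d]) auto
      then show "1 / cf_tail x i \<noteq> 0"
        by simp
    qed simp
    also have "\<dots> = (\<Sum>i\<in>{1..<1 + n}. - ln (cf_tail x i))"
      by (intro sum.cong refl) (auto simp: ln_div)
    finally have "S x = ln (cf_den x 1 n t) - (\<Sum>i\<in>{1..<1 + n}. ln (real (x i)))"
      by (simp add: S_def sum_subtractf)
    moreover have "ln (cf_den x 1 n 0) \<le> ln (cf_den x 1 n t)"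
      using cf_den_bounds(1)[OF p t] cf_den_ge_1[OF p, of 0] by (intro ln_mono) auto
    moreover have "ln (cf_den x 1 n t) \<le> ln (2 * cf_den x 1 n 0)"
      using cf_den_bounds(2)[OF p t] cf_den_ge_1[OF p, of t] t by (intro ln_mono) auto
    moreover have "ln (2 * cf_den x 1 n 0) = ln 2 + ln (cf_den x 1 n 0)"
      using cf_den_ge_1[OF p, of 0] by (intro ln_mult_pos) auto
    ultimately show "cf_psi x 1 n \<le> S x" "S x \<le> cf_psi x 1 n + ln 2"
      by (auto simp: cf_psi_def)
  qed
  have "(\<integral>x. cf_psi x 1 n \<partial>\<nu>) \<le> integral\<^sup>L \<nu> S"
    using b(1) S integrable_psi[of 1 n] by (intro integral_mono) auto
  then show "(\<integral>x. cf_psi x 1 n \<partial>\<nu>) \<le> real n * excess p"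
    by (simp add: S')
  have "integral\<^sup>L \<nu> S \<le> (\<integral>x. cf_psi x 1 n + ln 2 \<partial>\<nu>)"
    using b(2) S integrable_psi[of 1 n] by (intro integral_mono) auto
  then show "real n * excess p \<le> (\<integral>x. cf_psi x 1 n \<partial>\<nu>) + ln 2"
    using integrable_psi[of 1 n] by (simp add: S' prob_space)
qed

lemma excess_bounds: "0 \<le> excess p" "excess p \<le> ln 2"
proof -
  show "0 \<le> excess p"
    unfolding excess_def using excess_integrand_bounds(1)[of _ 1] by (intro integral_nonneg_AE AE_I2) auto
  have "excess p \<le> (\<integral>x. ln 2 \<partial>\<nu>)"
    unfolding excess_def using excess_integrand_bounds(2)[of _ 1] integrable_excess_integrand[of 1]
    by (intro integral_mono) auto
  then show "excess p \<le> ln 2"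
    by (simp add: prob_space)
qed

end

text \<open>The bounded-differences estimate on n digits is linear in n up to the fixed error ln 2,
  so the error disappears per digit as n grows: a number d with n d \<le> ln 2 for all n is at most
  0.\<close>

lemma excess_lipschitz:
  assumes "bernoulli p" "bernoulli q"
  shows "\<bar>excess q - excess p\<bar> \<le> 2 * ln 2 * tv_dist q p"
proof -
  interpret p: bernoulli p by fact
  interpret q: bernoulli q by fact
  define d where "d = \<bar>excess q - excess p\<bar> - 2 * ln 2 * tv_dist q p"
  have "real n * d \<le> ln 2" for n
  proof -
    have "\<bar>(\<integral>x. cf_psi x 1 n \<partial>bernoulli_measure q) - (\<integral>x. cf_psi x 1 n \<partial>bernoulli_measure p)\<bar>
        \<le> real (card {1..n}) * (2 * ln 2 * tv_dist q p)"
      unfolding p.integral_psi_PiM q.integral_psi_PiM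
    proof (rule product_integral_diff[OF assms])
      have pos: "pos_digits x 1 n" if "x \<in> PiE {1..n} (\<lambda>_. {1..})" for x
        using that by (auto simp: pos_digits_def PiE_iff)
      then show "\<bar>cf_psi x 1 n\<bar> \<le> real n * ln 2" if "x \<in> PiE {1..n} (\<lambda>_. {1..})" for x
        using that cf_psi_bounds[OF pos[OF that]] by simp
      fix x :: "nat \<Rightarrow> nat" and i and k :: nat
      assume *: "x \<in> PiE {1..n} (\<lambda>_. {1..})" "i \<in> {1..n}" "1 \<le> k"
      then have "x(i := k) \<in> PiE {1..n} (\<lambda>_. {1..})"
        by (auto simp: PiE_iff extensional_def)
      then show "\<bar>cf_psi (x(i := k)) 1 n - cf_psi x 1 n\<bar> \<le> 2 * ln 2"
        using pos * by (intro cf_psi_update) auto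
    qed auto
    then have "\<bar>real n * excess q - real n * excess p\<bar> \<le> real n * (2 * ln 2 * tv_dist q p) + ln 2"
      using p.excess_psi_bounds[of n] q.excess_psi_bounds[of n] by simp
    then show ?thesis
      by (simp add: d_def right_diff_distrib flip: abs_mult[of "real n", simplified])
  qed
  then have "d \<le> 0"
    by (meson ex_less_of_nat_mult not_le)
  then show ?thesis
    by (simp add: d_def)
qed

context bernoulli
begin

lemma digit_log_integral:
  assumes "finite_log_moment p" "1 \<le> i"
  shows "integrable \<nu> (\<lambda>x. ln (real (x i)))" "(\<integral>x. ln (real (x i)) \<partial>\<nu>) = log_moment p"
  using assms integrable_coord[of i "\<lambda>k. ln (real k)"] integral_coord[of i "\<lambda>k. ln (real k)"]
  by (auto simp: integrable_weight integral_weight finite_log_moment_def log_moment_def)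

lemma log_den_integral:
  assumes "finite_log_moment p"
  shows "integrable \<nu> (\<lambda>x. ln (cf_den x 1 n 0))"
    and "2 * (\<integral>x. ln (cf_den x 1 n 0) \<partial>\<nu>) \<le> real n * lyapunov p"
    and "real n * lyapunov p \<le> 2 * (\<integral>x. ln (cf_den x 1 n 0) \<partial>\<nu>) + 2 * ln 2"
proof -
  have eq: "ln (cf_den x 1 n 0) = cf_psi x 1 n + (\<Sum>i\<in>{1..<1 + n}. ln (real (x i)))" for x
    by (simp add: cf_psi_def)
  have s: "integrable \<nu> (\<lambda>x. \<Sum>i\<in>{1..<1 + n}. ln (real (x i)))"
    using digit_log_integral(1)[OF assms] by (intro Bochner_Integration.integrable_sum) auto
  show "integrable \<nu> (\<lambda>x. ln (cf_den x 1 n 0))"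
    unfolding eq using s integrable_psi[of 1 n] by simp
  have "(\<integral>x. (\<Sum>i\<in>{1..<1 + n}. ln (real (x i))) \<partial>\<nu>) = real n * log_moment p"
    using digit_log_integral[OF assms] by (subst Bochner_Integration.integral_sum) auto
  then have "(\<integral>x. ln (cf_den x 1 n 0) \<partial>\<nu>) = (\<integral>x. cf_psi x 1 n \<partial>\<nu>) + real n * log_moment p"
    unfolding eq using s integrable_psi[of 1 n] by simp
  then show "2 * (\<integral>x. ln (cf_den x 1 n 0) \<partial>\<nu>) \<le> real n * lyapunov p"
    "real n * lyapunov p \<le> 2 * (\<integral>x. ln (cf_den x 1 n 0) \<partial>\<nu>) + 2 * ln 2"
    using excess_psi_bounds[of n] by (auto simp: lyapunov_def algebra_simps)
qed

lemma log_moment_nonneg: "0 \<le> log_moment p"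
  unfolding log_moment_def by (intro integral_nonneg_AE) (auto simp: AE_count_space p_nonneg)

text \<open>Two digits already force a denominator of at least 2. The uniform lower bound keeps the
  ratio of entropy to exponent bounded in \<open>bdd_above_ratio\<close>.\<close>

lemma lyapunov_ge:
  assumes "finite_log_moment p"
  shows "ln 2 \<le> lyapunov p"
proof -
  have "ln 2 = (\<integral>x. ln 2 \<partial>\<nu>)"
    by (simp add: prob_space)
  also have "\<dots> \<le> (\<integral>x. ln (cf_den x 1 2 0) \<partial>\<nu>)"
  proof (intro integral_mono log_den_integral(1) assms)
    fix x
    assume "x \<in> space \<nu>"
    then show "ln 2 \<le> ln (cf_den x 1 2 0)"
      using power2_le_cf_den[OF psi_pos_digits[of x 1 2], of 0] by (intro ln_mono) auto
  qed simp
  also have "\<dots> \<le> lyapunov p"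
    using log_den_integral(2)[OF assms, of 2] by simp
  finally show ?thesis .
qed

end

section \<open>Entropy compared with power weights\<close>

lemma integrable_CN_powr:
  assumes "1 < s"
  shows "integrable CN (\<lambda>k. real k powr - s)"
proof -
  have "integrable (count_space UNIV) (\<lambda>k::nat. real k powr - s)"
    using assms by (simp add: integrable_count_space_nat_iff summable_real_powr_iff)
  then show ?thesis
    using abs_summable_on_subset[of "\<lambda>k::nat. real k powr - s" UNIV "{1..}"]
    by (simp add: abs_summable_on_def)
qed

text \<open>This is \<open>ln y \<le> y - 1\<close> at \<open>y = k\<^sup>-\<^sup>2\<^sup>s / x\<close>.\<close>

lemma entropy_term_le:
  assumes "0 \<le> x" "1 \<le> k"
  shows "- (x * ln x) - 2 * s * (x * ln (real k)) \<le> real k powr - (2 * s) - x"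
proof (cases "x = 0")
  case False
  define y where "y = real k powr - (2 * s) / x"
  have k: "real k powr - (2 * s) > 0" "x > 0"
    using assms False by auto
  then have "ln y = - (2 * s) * ln (real k) - ln x"
    using assms by (simp add: y_def ln_div ln_powr)
  moreover have "ln y \<le> y - 1"
    using k by (intro ln_le_minus_one) (simp add: y_def)
  ultimately have "x * (- (2 * s) * ln (real k) - ln x) \<le> x * (y - 1)"
    using k by (intro mult_left_mono) auto
  also have "x * (y - 1) = real k powr - (2 * s) - x"
    using k by (simp add: y_def field_simps)
  finally show ?thesis
    by (simp add: algebra_simps)
qed simp

lemma (in bernoulli) entropy_term_nonneg:
  assumes "1 \<le> k"
  shows "0 \<le> - (p k * ln (p k))"
proof (cases "p k = 0")
  case False
  then have "ln (p k) \<le> 0"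
    using p_nonneg[OF assms] p_le_1[OF assms] by simp
  then show ?thesis
    using p_nonneg[OF assms] by (simp add: mult_nonneg_nonpos)
qed simp

lemma (in bernoulli) integrable_entropy:
  assumes "finite_log_moment p"
  shows "integrable CN (\<lambda>k. - (p k * ln (p k)))"
proof (rule Bochner_Integration.integrable_bound)
  \<comment> \<open>The majorant is Gibbs' inequality \<open>entropy_term_le\<close> at s = 1, a
    convenient exponent for which k^(-2s) is summable.\<close>
  show "integrable CN (\<lambda>k. 2 * (p k * ln (real k)) + real k powr - 2)"
    using assms integrable_CN_powr[of 2] by (simp add: finite_log_moment_def)
  show "AE k in CN. norm (- (p k * ln (p k))) \<le> norm (2 * (p k * ln (real k)) + real k powr - 2)"
  proof (unfold AE_count_space, intro ballI)
    fix k :: nat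
    assume "k \<in> {1..}"
    then show "norm (- (p k * ln (p k))) \<le> norm (2 * (p k * ln (real k)) + real k powr - 2)"
      using entropy_term_le[of "p k" k 1] entropy_term_nonneg[of k] p_nonneg[of k] by simp
  qed
qed simp

section \<open>The variational problem\<close>

lemma CN_finite_support:
  fixes f :: "nat \<Rightarrow> real"
  assumes "finite F" "F \<subseteq> {1..}" "\<And>k. 1 \<le> k \<Longrightarrow> k \<notin> F \<Longrightarrow> f k = 0"
  shows "integrable CN f" "integral\<^sup>L CN f = sum f F"
proof -
  have sub: "{k \<in> {1..}. f k \<noteq> 0} \<subseteq> F"
    using assms(3) by auto
  then have fin: "finite {k \<in> {1..}. f k \<noteq> 0}"
    using assms(1) finite_subset by blast
  have "(\<integral>\<^sup>+k. ennreal (norm (f k)) \<partial>CN) = (\<Sum>k | k \<in> {1..} \<and> 0 < ennreal (norm (f k)). ennreal (norm (f k)))"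
    using fin by (intro nn_integral_count_space) auto
  also have "\<dots> < \<infinity>"
    using fin by (simp add: ennreal_zero_less_top)
  finally show "integrable CN f"
    by (intro integrableI_bounded) auto
  have "integral\<^sup>L CN f = (\<Sum>k | k \<in> {1..} \<and> f k \<noteq> 0. f k)"
    by (rule lebesgue_integral_count_space_finite_support[OF fin])
  also have "\<dots> = sum f F"
    using assms(1,2) sub by (intro sum.mono_neutral_left) auto
  finally show "integral\<^sup>L CN f = sum f F" .
qed

lemma CN_fatou:
  fixes f :: "nat \<Rightarrow> nat \<Rightarrow> real"
  assumes int: "\<And>n. integrable CN (f n)"
    and nonneg: "\<And>n k. 1 \<le> k \<Longrightarrow> 0 \<le> f n k"
    and lim: "\<And>k. 1 \<le> k \<Longrightarrow> (\<lambda>n. f n k) \<longlonglongrightarrow> g k"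
    and bound: "\<And>n. integral\<^sup>L CN (f n) \<le> b n" "b \<longlonglongrightarrow> c"
  shows "integrable CN g" "integral\<^sup>L CN g \<le> c"
proof -
  have g: "0 \<le> g k" if "1 \<le> k" for k
    using nonneg[OF that] by (intro LIMSEQ_le_const[OF lim[OF that]]) auto
  have b: "0 \<le> b n" for n
    using nonneg by (intro order_trans[OF integral_nonneg_AE bound(1)]) (auto simp: AE_count_space)
  then have c: "0 \<le> c"
    by (intro LIMSEQ_le_const[OF bound(2)]) auto
  have "(\<integral>\<^sup>+k. ennreal (g k) \<partial>CN) = (\<integral>\<^sup>+k. liminf (\<lambda>n. ennreal (f n k)) \<partial>CN)"
  proof (rule nn_integral_cong)
    fix k :: nat
    assume "k \<in> space CN"
    then have "(\<lambda>n. ennreal (f n k)) \<longlonglongrightarrow> ennreal (g k)"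
      using lim by (intro tendsto_ennrealI) auto
    then show "ennreal (g k) = liminf (\<lambda>n. ennreal (f n k))"
      by (simp add: lim_imp_Liminf)
  qed
  also have "\<dots> \<le> liminf (\<lambda>n. \<integral>\<^sup>+k. ennreal (f n k) \<partial>CN)"
    by (intro nn_integral_liminf) simp
  also have "\<dots> \<le> liminf (\<lambda>n. ennreal (b n))"
  proof (intro Liminf_mono always_eventually allI)
    fix n
    have "(\<integral>\<^sup>+k. ennreal (f n k) \<partial>CN) = ennreal (integral\<^sup>L CN (f n))"
      using nonneg by (intro nn_integral_eq_integral int) (auto simp: AE_count_space)
    then show "(\<integral>\<^sup>+k. ennreal (f n k) \<partial>CN) \<le> ennreal (b n)"
      using bound(1) by (simp add: ennreal_leI)
  qed
  also have "\<dots> = ennreal c"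
    by (intro lim_imp_Liminf tendsto_ennrealI bound) simp
  finally have le: "(\<integral>\<^sup>+k. ennreal (g k) \<partial>CN) \<le> ennreal c" .
  have eq: "(\<integral>\<^sup>+k. ennreal (norm (g k)) \<partial>CN) = (\<integral>\<^sup>+k. ennreal (g k) \<partial>CN)"
    using g by (intro nn_integral_cong) simp
  show int_g: "integrable CN g"
    using le eq by (intro integrableI_bounded) (auto intro: le_less_trans)
  have "ennreal (integral\<^sup>L CN g) = (\<integral>\<^sup>+k. ennreal (g k) \<partial>CN)"
    using g by (intro nn_integral_eq_integral[symmetric] int_g) (auto simp: AE_count_space)
  then show "integral\<^sup>L CN g \<le> c"
    using le c by (metis ennreal_le_iff)
qed

text \<open>A diagonal argument in the form of Tychonoff's theorem: a countable power of the unit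
  interval is compact and metrizable, hence sequentially compact.\<close>

lemma pointwise_convergent_subseq:
  fixes f :: "nat \<Rightarrow> nat \<Rightarrow> real"
  assumes "\<And>n k. f n k \<in> {0..1}"
  obtains r g where "strict_mono r" "\<And>k. (\<lambda>n. f (r n) k) \<longlonglongrightarrow> g k"
proof -
  have "compactin (product_topology (\<lambda>_::nat. euclidean :: real topology) UNIV) (PiE UNIV (\<lambda>_. {0..1}))"
    by (simp add: compactin_PiE)
  then have "compact (PiE UNIV (\<lambda>_::nat. {0..1::real}))"
    by (simp add: euclidean_product_topology)
  then have "seq_compact (PiE UNIV (\<lambda>_::nat. {0..1::real}))"
    by (rule compact_imp_seq_compact)
  moreover have "\<forall>n. f n \<in> PiE UNIV (\<lambda>_::nat. {0..1::real})"
    using assms by (auto simp: PiE_iff)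
  ultimately obtain g r where r: "strict_mono r" "(f \<circ> r) \<longlonglongrightarrow> g"
    unfolding seq_compact_def by blast
  have "(\<lambda>n. f (r n) k) \<longlonglongrightarrow> g k" for k
  proof -
    have "isCont (\<lambda>x::nat \<Rightarrow> real. x k) g"
      using continuous_on_product_coordinates[of k] by (metis UNIV_I continuous_on_eq_continuous_at open_UNIV)
    then show ?thesis
      using isCont_tendsto_compose[OF _ r(2)] by (simp add: o_def)
  qed
  then show thesis
    using r(1) that by blast
qed

text \<open>Only the limit 0 needs work. There ln z \<le> z - 1 at z = 1 / sqrt y bounds the
  absolute value of y ln y by 2 sqrt y on [0,1].\<close>

lemma tendsto_mult_ln_self:
  fixes X :: "nat \<Rightarrow> real"
  assumes "X \<longlonglongrightarrow> x" "\<And>n. 0 \<le> X n"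
  shows "(\<lambda>n. X n * ln (X n)) \<longlonglongrightarrow> x * ln x"
proof (cases "x = 0")
  case False
  then show ?thesis
    using assms(1) by (intro tendsto_intros)
next
  case True
  have bound: "\<bar>y * ln y\<bar> \<le> 2 * sqrt y" if "0 \<le> y" "y \<le> 1" for y :: real
  proof (cases "y = 0")
    case False
    then have y: "0 < y"
      using that by simp
    have "- ln y = 2 * ln (1 / sqrt y)"
      using y by (simp add: ln_div ln_sqrt)
    also have "ln (1 / sqrt y) \<le> 1 / sqrt y"
      using y ln_le_minus_one[of "1 / sqrt y"] by simp
    finally have "y * - ln y \<le> y * (2 * (1 / sqrt y))"
      using y by (intro mult_left_mono) auto
    also have "\<dots> = 2 * sqrt y"
      using y by (simp add: real_div_sqrt mult.commute[of y] flip: times_divide_eq_right)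
    finally have "y * - ln y \<le> 2 * sqrt y" .
    moreover have "ln y \<le> 0"
      using y that by simp
    ultimately show ?thesis
      using y by (simp add: abs_mult)
  qed simp
  have "(\<lambda>n. 2 * sqrt (X n)) \<longlonglongrightarrow> 2 * sqrt 0"
    using assms(1) True by (intro tendsto_intros) simp
  then have lim: "(\<lambda>n. 2 * sqrt (X n)) \<longlonglongrightarrow> 0"
    by simp
  have "\<forall>\<^sub>F n in sequentially. X n < 1"
    using assms(1) True by (intro order_tendstoD(2)) auto
  then have "\<forall>\<^sub>F n in sequentially. norm (X n * ln (X n)) \<le> 2 * sqrt (X n)"
    by eventually_elim (use bound assms(2) in simp)
  from Lim_null_comparison[OF this lim] show ?thesis
    using True by simp
qed

definition log_vectors :: "(nat \<Rightarrow> real) set" where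
  "log_vectors = {p \<in> prob_vectors. finite_log_moment p}"

text \<open>The ratio is the expected dimension formula, entropy over Lyapunov exponent. Vectors of
  infinite mean log-digit are left out here; they are dealt with by
  \<open>cover_moment_infinite_log\<close>, which gives the covering estimate for every exponent
  above 1/2.\<close>

definition opt_dim :: real where
  "opt_dim = (SUP p \<in> log_vectors. weight_entropy p / lyapunov p)"

lemma bernoulli_log_vectors: "p \<in> log_vectors \<Longrightarrow> bernoulli p"
  by (simp add: log_vectors_def bernoulli_def)

lemma lyapunov_pos: "p \<in> log_vectors \<Longrightarrow> 0 < lyapunov p"
  using bernoulli.lyapunov_ge[OF bernoulli_log_vectors, of p]
  by (auto simp: log_vectors_def intro: less_le_trans[of 0 "ln 2"])

text \<open>The integrand of the relative entropy of p with respect to the unnormalised weights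
  k^(-2s). Being nonnegative it is accessible to Fatou's lemma, which yields upper semicontinuity of
  entropy minus 2s times the log moment although entropy alone is not upper semicontinuous.\<close>

definition entropy_gap :: "real \<Rightarrow> (nat \<Rightarrow> real) \<Rightarrow> nat \<Rightarrow> real" where
  "entropy_gap s p k = real k powr - (2 * s) - p k - (- (p k * ln (p k)) - 2 * s * (p k * ln (real k)))"

lemma entropy_gap:
  assumes "p \<in> log_vectors" "1 / 2 < s"
  shows "\<And>k. 1 \<le> k \<Longrightarrow> 0 \<le> entropy_gap s p k"
    and "integrable CN (entropy_gap s p)"
    and "integral\<^sup>L CN (entropy_gap s p)
      = (\<integral>k. real k powr - (2 * s) \<partial>CN) - 1 - (weight_entropy p - 2 * s * log_moment p)"
proof -
  interpret bernoulli p
    using assms(1) by (rule bernoulli_log_vectors)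
  have fl: "finite_log_moment p"
    using assms(1) by (simp add: log_vectors_def)
  show "0 \<le> entropy_gap s p k" if "1 \<le> k" for k
    using entropy_term_le[OF p_nonneg[OF that] that, of s] by (simp add: entropy_gap_def)
  have i: "integrable CN (\<lambda>k. real k powr - (2 * s))" "integrable CN (\<lambda>k. - (p k * ln (p k)))"
    "integrable CN (\<lambda>k. p k * ln (real k))"
    using assms(2) fl integrable_CN_powr[of "2 * s"] integrable_entropy[OF fl]
    by (auto simp: finite_log_moment_def)
  show "integrable CN (entropy_gap s p)"
    unfolding entropy_gap_def[abs_def]
    by (intro Bochner_Integration.integrable_diff integrable_mult_right i p_integrable)
  show "integral\<^sup>L CN (entropy_gap s p)
      = (\<integral>k. real k powr - (2 * s) \<partial>CN) - 1 - (weight_entropy p - 2 * s * log_moment p)"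
    unfolding entropy_gap_def[abs_def] weight_entropy_def log_moment_def
    by (subst Bochner_Integration.integral_diff Bochner_Integration.integral_mult_right
        | intro Bochner_Integration.integrable_diff integrable_mult_right i p_integrable)+
      (use p_integral in simp)
qed

text \<open>With a slope s below \<open>opt_dim\<close> this bounds the Lyapunov exponents of
  near-maximisers; with s = 1 it bounds the ratio.\<close>

lemma entropy_le:
  assumes "p \<in> log_vectors" "1 / 2 < s"
  shows "weight_entropy p \<le> s * lyapunov p + (\<integral>k. real k powr - (2 * s) \<partial>CN)"
proof -
  interpret bernoulli p
    using assms(1) by (rule bernoulli_log_vectors)
  have "0 \<le> integral\<^sup>L CN (entropy_gap s p)"
    using entropy_gap(1)[OF assms] by (intro integral_nonneg_AE) (auto simp: AE_count_space)
  then have "weight_entropy p \<le> 2 * s * log_moment p + (\<integral>k. real k powr - (2 * s) \<partial>CN)"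
    using entropy_gap(3)[OF assms] by simp
  moreover have "0 \<le> s * excess p"
    using excess_bounds assms(2) by simp
  ultimately show ?thesis
    by (simp add: lyapunov_def algebra_simps)
qed

lemma bdd_above_ratio: "bdd_above ((\<lambda>p. weight_entropy p / lyapunov p) ` log_vectors)"
proof (rule bdd_aboveI2)
  fix p
  assume p: "p \<in> log_vectors"
  define Z where "Z = (\<integral>k. real k powr - (2 * 1) \<partial>CN)"
  have Z: "0 \<le> Z"
    unfolding Z_def by (intro integral_nonneg_AE) auto
  have l: "ln 2 \<le> lyapunov p"
    using bernoulli.lyapunov_ge[OF bernoulli_log_vectors[OF p]] p by (simp add: log_vectors_def)
  have "weight_entropy p / lyapunov p \<le> (lyapunov p + Z) / lyapunov p"
    using entropy_le[OF p, of 1] lyapunov_pos[OF p] by (intro divide_right_mono) (auto simp: Z_def)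
  also have "\<dots> = 1 + Z / lyapunov p"
    using lyapunov_pos[OF p] by (simp add: add_divide_distrib)
  also have "\<dots> \<le> 1 + Z / ln 2"
    using l Z by (intro add_left_mono divide_left_mono mult_pos_pos) (auto simp: lyapunov_pos[OF p])
  finally show "weight_entropy p / lyapunov p \<le> 1 + Z / ln 2" .
qed

lemma entropy_le_opt_dim:
  assumes "p \<in> log_vectors"
  shows "weight_entropy p \<le> opt_dim * lyapunov p"
proof -
  have "weight_entropy p / lyapunov p \<le> opt_dim"
    unfolding opt_dim_def by (rule cSUP_upper[OF assms bdd_above_ratio])
  then show ?thesis
    using lyapunov_pos[OF assms] by (simp add: divide_le_eq)
qed

text \<open>The witness has \<open>p\<^sub>k\<close> proportional to \<open>1/k\<close> for \<open>k \<le> 4\<close>. With harmonic number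
  \<open>25/12 > 2\<close> as normalisation its entropy exceeds half of the trivial upper bound
  \<open>2 \<Sum> p\<^sub>k ln k + 2 ln 2\<close> for the Lyapunov exponent.\<close>

lemma opt_dim_gt_half: "1 / 2 < opt_dim"
  and log_vectors_nonempty: "log_vectors \<noteq> {}"
proof -
  define p where "p = (\<lambda>k\<in>{1..}. if k \<le> 4 then 12 / (25 * real k) else 0)"
  have F: "finite {1..4::nat}" "{1..4} \<subseteq> {1::nat..}"
    by auto
  have F4: "{1..4} = {1, 2, 3, 4::nat}"
    by auto
  have p: "p k = (if k \<le> 4 then 12 / (25 * real k) else 0)" if "1 \<le> k" for k
    using that by (simp add: p_def)
  have p_int: "integrable CN p" "integral\<^sup>L CN p = sum p {1..4}"
    using CN_finite_support[OF F, of p] p by auto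
  have "p \<in> prob_vectors"
    unfolding prob_vectors_iff
  proof (intro conjI p_int)
    show "p \<in> {1..} \<rightarrow>\<^sub>E {0..1}"
      by (auto simp: p_def)
    show "integral\<^sup>L CN p = 1"
      unfolding p_int(2) F4 using p by simp
  qed
  moreover have "finite_log_moment p"
    unfolding finite_log_moment_def using p by (intro CN_finite_support[OF F]) auto
  ultimately have pl: "p \<in> log_vectors"
    by (simp add: log_vectors_def)
  then show "log_vectors \<noteq> {}"
    by blast
  interpret bernoulli p
    using pl by (rule bernoulli_log_vectors)
  have lm: "log_moment p = (\<Sum>k\<in>{1..4}. p k * ln (real k))"
    unfolding log_moment_def using p by (intro CN_finite_support[OF F]) auto
  have "weight_entropy p = (\<Sum>k\<in>{1..4}. - (p k * ln (p k)))"
    unfolding weight_entropy_def using p by (intro CN_finite_support[OF F]) auto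
  also have "\<dots> = (\<Sum>k\<in>{1..4}. p k * ln (25 / 12) + p k * ln (real k))"
  proof (intro sum.cong refl)
    fix k :: nat
    assume k: "k \<in> {1..4}"
    then have "p k = (12 / 25) / real k"
      using p[of k] by simp
    then have "ln (p k) = ln (12 / 25) - ln (real k)"
      using k by (simp add: ln_div ln_mult)
    also have "ln (12 / 25 :: real) = - ln (25 / 12)"
      by (simp add: ln_div)
    finally have "ln (p k) = - ln (25 / 12) - ln (real k)" .
    then show "- (p k * ln (p k)) = p k * ln (25 / 12) + p k * ln (real k)"
      by (simp only:) (simp add: algebra_simps)
  qed
  also have "\<dots> = ln (25 / 12) + log_moment p"
    using p_int p_integral by (simp add: sum.distrib lm flip: sum_distrib_right)
  finally have "2 * weight_entropy p = 2 * ln (25 / 12) + 2 * log_moment p"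
    by simp
  moreover have "excess p < ln (25 / 12)"
    by (rule le_less_trans[OF excess_bounds(2)]) simp
  ultimately have "lyapunov p < 2 * weight_entropy p"
    by (simp add: lyapunov_def)
  also have "\<dots> \<le> 2 * (opt_dim * lyapunov p)"
    using entropy_le_opt_dim[OF pl] by simp
  finally have "1 * lyapunov p < (2 * opt_dim) * lyapunov p"
    by simp
  then show "1 / 2 < opt_dim"
    using lyapunov_pos[OF pl] by simp
qed

section \<open>Existence of a maximiser\<close>

lemma exists_maximizer: "\<exists>p \<in> log_vectors. weight_entropy p = opt_dim * lyapunov p"
proof -
  obtain s where s: "1 / 2 < s" "s < opt_dim"
    using opt_dim_gt_half dense by blast
  obtain t where t: "s < t" "t < opt_dim"
    using s dense by blast
  define Z where "Z = (\<integral>k. real k powr - (2 * s) \<partial>CN)"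
  define Z' where "Z' = (\<integral>k. real k powr - (2 * opt_dim) \<partial>CN)"
  define C where "C = Z / (t - s)"
  define e where "e n = (opt_dim - t) / (real n + 1)" for n
  have e_lim: "e \<longlonglongrightarrow> 0"
    unfolding e_def using LIMSEQ_inverse_real_of_nat[THEN tendsto_mult_right_zero, of "opt_dim - t"]
    by (simp add: divide_inverse add.commute)
  have e: "0 < e n" "e n \<le> opt_dim - t" for n
    using t frac_le[of "opt_dim - t" "opt_dim - t" 1 "real n + 1"] by (auto simp: e_def)
  have "\<exists>p \<in> log_vectors. opt_dim - e n < weight_entropy p / lyapunov p" for n
    using less_cSUP_iff[OF log_vectors_nonempty bdd_above_ratio, of "opt_dim - e n"] e(1)[of n]
    by (simp add: opt_dim_def)
  then obtain q where q: "\<And>n. q n \<in> log_vectors" "\<And>n. opt_dim - e n < weight_entropy (q n) / lyapunov (q n)"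
    by metis
  have ent: "(opt_dim - e n) * lyapunov (q n) \<le> weight_entropy (q n)" for n
    using q(2)[of n] lyapunov_pos[OF q(1)[of n]] by (simp add: less_divide_eq less_imp_le)
  \<comment> \<open>Along the sequence the entropy is at least t times the exponent, while
    \<open>entropy_le\<close> bounds it by s times the exponent plus Z; the gap t - s bounds the
    exponent.\<close>
  have lyap: "lyapunov (q n) \<le> C" for n
  proof -
    have "t * lyapunov (q n) \<le> (opt_dim - e n) * lyapunov (q n)"
      using e(2)[of n] lyapunov_pos[OF q(1)[of n]] by (intro mult_right_mono) auto
    also have "\<dots> \<le> s * lyapunov (q n) + Z"
      using ent[of n] entropy_le[OF q(1) s(1), of n] by (simp add: Z_def)
    finally show ?thesis
      using t by (simp add: C_def le_divide_eq algebra_simps)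
  qed
  have bern: "bernoulli (q n)" for n
    using q(1) by (rule bernoulli_log_vectors)
  have q01: "q n k \<in> {0..1}" if "1 \<le> k" for n k
    using bernoulli.p_nonneg[OF bern that] bernoulli.p_le_1[OF bern that] by simp
  \<comment> \<open>Index 0 holds the unspecified value \<open>undefined\<close>; it is overwritten
    by 0 so that all values lie in [0,1].\<close>
  obtain r g where r: "strict_mono r"
    and g: "\<And>k. (\<lambda>n. if 1 \<le> k then q (r n) k else 0) \<longlonglongrightarrow> g k"
    by (rule pointwise_convergent_subseq[of "\<lambda>n k. if 1 \<le> k then q n k else 0"]) (use q01 in auto)
  define p where "p = restrict g {1..}"
  have lim: "(\<lambda>n. q (r n) k) \<longlonglongrightarrow> p k" if "1 \<le> k" for k
    using g[of k] that by (simp add: p_def)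
  have p01: "p k \<in> {0..1}" if "1 \<le> k" for k
    using q01[OF that] by (auto intro!: LIMSEQ_le_const[OF lim[OF that]] LIMSEQ_le_const2[OF lim[OF that]])
  have lm: "log_moment (q n) \<le> C" for n
    using lyap[of n] bernoulli.excess_bounds(1)[OF bern[of n]] bernoulli.log_moment_nonneg[OF bern[of n]]
    by (simp add: lyapunov_def)
  have q_int: "integrable CN (q n)" "integral\<^sup>L CN (q n) = 1" for n
    using bernoulli.p_integrable[OF bern] bernoulli.p_integral[OF bern] by auto
  have ql_int: "integrable CN (\<lambda>k. q n k * ln (real k))" for n
    using q(1)[of n] by (simp add: log_vectors_def finite_log_moment_def)
  have p_int: "integrable CN p" "integral\<^sup>L CN p \<le> 1"
    by (rule CN_fatou[of "\<lambda>n. q (r n)" p "\<lambda>_. 1" 1]; use q_int q01 lim in auto)+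
  have pl_int: "integrable CN (\<lambda>k. p k * ln (real k))"
    by (rule CN_fatou(1)[of "\<lambda>n k. q (r n) k * ln (real k)" _ "\<lambda>_. C" C])
      (use ql_int q01 lm lim in \<open>auto intro!: tendsto_mult_right simp: log_moment_def\<close>)
  \<comment> \<open>Markov's inequality for the logarithm of the digit: at most C / ln K of the mass
    sits beyond K, so no mass escapes in the limit.\<close>
  have tight: "1 - C / ln (real K) \<le> integral\<^sup>L CN p" if K: "2 \<le> K" for K :: nat
  proof -
    have lnK: "0 < ln (real K)"
      using K by simp
    have fin: "finite {1..K}" "{1..K} \<subseteq> {1..}"
      by auto
    have ind: "integrable CN (\<lambda>k. h k * indicator {1..K} k)"
      "integral\<^sup>L CN (\<lambda>k. h k * indicator {1..K} k) = sum h {1..K}" for h :: "nat \<Rightarrow> real"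
      using CN_finite_support[OF fin, of "\<lambda>k. h k * indicator {1..K} k"] by auto
    have "1 \<le> sum (q (r n)) {1..K} + C / ln (real K)" for n
    proof -
      have "1 = integral\<^sup>L CN (q (r n))"
        using q_int(2)[of "r n"] by simp
      also have "\<dots> \<le> (\<integral>k. q (r n) k * indicator {1..K} k + (q (r n) k * ln (real k)) / ln (real K) \<partial>CN)"
      proof (intro integral_mono)
        fix k :: nat
        assume "k \<in> space CN"
        then have k: "1 \<le> k" "0 \<le> q (r n) k"
          using q01 by auto
        show "q (r n) k \<le> q (r n) k * indicator {1..K} k + (q (r n) k * ln (real k)) / ln (real K)"
        proof (cases "k \<le> K")
          case True
          then show ?thesis
            using k lnK by simp
        next
          case False
          then have "q (r n) k * ln (real K) \<le> q (r n) k * ln (real k)"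
            using k K by (intro mult_left_mono ln_mono) auto
          then show ?thesis
            using False lnK by (simp add: pos_le_divide_eq)
        qed
      qed (use q_int ind ql_int in auto)
      also have "\<dots> = sum (q (r n)) {1..K} + log_moment (q (r n)) / ln (real K)"
        using ind ql_int[of "r n"] by (subst Bochner_Integration.integral_add) (auto simp: log_moment_def)
      also have "\<dots> \<le> sum (q (r n)) {1..K} + C / ln (real K)"
        using lm lnK by (intro add_left_mono divide_right_mono) auto
      finally show ?thesis .
    qed
    moreover have "(\<lambda>n. sum (q (r n)) {1..K} + C / ln (real K)) \<longlonglongrightarrow> sum p {1..K} + C / ln (real K)"
      using lim by (intro tendsto_intros) auto
    ultimately have "1 \<le> sum p {1..K} + C / ln (real K)"
      by (intro LIMSEQ_le_const) auto
    also have "sum p {1..K} = (\<integral>k. p k * indicator {1..K} k \<partial>CN)"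
      by (rule ind(2)[symmetric])
    also have "\<dots> \<le> integral\<^sup>L CN p"
      using p01 by (intro integral_mono ind p_int) (auto simp: indicator_def)
    finally show ?thesis
      by simp
  qed
  have "(\<lambda>K::nat. 1 - C / ln (real K)) \<longlonglongrightarrow> 1 - 0"
    by (intro tendsto_diff tendsto_const real_tendsto_divide_at_top[where c = C]
        filterlim_compose[OF ln_at_top] filterlim_real_sequentially)
  then have "1 - 0 \<le> integral\<^sup>L CN p"
    using tight by (intro LIMSEQ_le_const2[of "\<lambda>K. 1 - C / ln (real K)"]) auto
  then have p_int1: "integral\<^sup>L CN p = 1"
    using p_int by simp
  then have "p \<in> prob_vectors"
    unfolding prob_vectors_iff using p_int p01 by (auto simp: p_def)
  then have pl: "p \<in> log_vectors"
    using pl_int by (simp add: log_vectors_def finite_log_moment_def)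
  then have bp: "bernoulli p"
    by (rule bernoulli_log_vectors)
  \<comment> \<open>By Scheffe's lemma, pointwise convergence without loss of mass is convergence in
    total variation.\<close>
  have tv: "(\<lambda>n. tv_dist (q (r n)) p) \<longlonglongrightarrow> 0"
  proof -
    have nn: "(\<integral>\<^sup>+k. ennreal (norm (h k)) \<partial>CN) = 1"
      if "integrable CN h" "integral\<^sup>L CN h = 1" "\<And>k. 1 \<le> k \<Longrightarrow> h k \<in> {0..1}" for h :: "nat \<Rightarrow> real"
    proof -
      have "(\<integral>\<^sup>+k. ennreal (norm (h k)) \<partial>CN) = (\<integral>\<^sup>+k. ennreal (h k) \<partial>CN)"
        using that(3) by (intro nn_integral_cong) auto
      also have "\<dots> = 1"
        using that by (subst nn_integral_eq_integral) (auto simp: AE_count_space)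
      finally show ?thesis .
    qed
    have "(\<lambda>n. \<integral>\<^sup>+k. ennreal (norm (q (r n) k - p k)) \<partial>CN) \<longlonglongrightarrow> 0"
    proof (rule Scheffe_lemma1)
      show "AE k in CN. (\<lambda>n. q (r n) k) \<longlonglongrightarrow> p k"
        using lim by (simp add: AE_count_space)
      have "limsup (\<lambda>n. \<integral>\<^sup>+k. ennreal (norm (q (r n) k)) \<partial>CN) = 1"
        using nn[OF q_int] q01 by (simp add: Limsup_const)
      also have "1 = (\<integral>\<^sup>+k. ennreal (norm (p k)) \<partial>CN)"
        using nn[OF p_int(1) p_int1] p01 by simp
      finally show "limsup (\<lambda>n. \<integral>\<^sup>+k. ennreal (norm (q (r n) k)) \<partial>CN) \<le> (\<integral>\<^sup>+k. ennreal (norm (p k)) \<partial>CN)"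
        by simp
    qed (use q_int p_int in auto)
    moreover have "(\<integral>\<^sup>+k. ennreal (norm (q (r n) k - p k)) \<partial>CN) = ennreal (tv_dist (q (r n)) p)" for n
      unfolding tv_dist_def using q_int p_int by (subst nn_integral_eq_integral) auto
    ultimately have "(\<lambda>n. ennreal (tv_dist (q (r n)) p)) \<longlonglongrightarrow> ennreal 0"
      by simp
    then show ?thesis
      by (rule tendsto_ennrealD) (auto simp: tv_dist_def intro!: always_eventually integral_nonneg_AE)
  qed
  have exc: "(\<lambda>n. excess (q (r n))) \<longlonglongrightarrow> excess p"
  proof (rule LIM_zero_cancel, rule Lim_null_comparison)
    show "\<forall>\<^sub>F n in sequentially. norm (excess (q (r n)) - excess p) \<le> 2 * ln 2 * tv_dist (q (r n)) p"
      using excess_lipschitz[OF bp bern] by simp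
    show "(\<lambda>n. 2 * ln 2 * tv_dist (q (r n)) p) \<longlonglongrightarrow> 0"
      using tv by (intro tendsto_mult_right_zero)
  qed
  \<comment> \<open>Near-maximality of \<open>q (r n)\<close> is rewritten as an upper bound for its
    entropy gap at the exponent \<open>opt_dim\<close>. The bound converges because e tends to 0 and
    the excess is continuous; Fatou's lemma then gives the reverse inequality for p.\<close>
  define b where "b n = Z' - 1 + e (r n) * C - 2 * opt_dim * excess (q (r n))" for n
  have "integral\<^sup>L CN (entropy_gap opt_dim p) \<le> Z' - 1 + 0 * C - 2 * opt_dim * excess p"
  proof (rule CN_fatou(2)[of "\<lambda>n. entropy_gap opt_dim (q (r n))" _ b])
    show "b \<longlonglongrightarrow> Z' - 1 + 0 * C - 2 * opt_dim * excess p"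
      unfolding b_def[abs_def] using LIMSEQ_subseq_LIMSEQ[OF e_lim r] exc
      by (intro tendsto_intros) (auto simp: o_def)
    show "integral\<^sup>L CN (entropy_gap opt_dim (q (r n))) \<le> b n" for n
    proof -
      have "opt_dim * lyapunov (q (r n)) - weight_entropy (q (r n)) \<le> e (r n) * lyapunov (q (r n))"
        using ent[of "r n"] by (simp add: algebra_simps)
      also have "\<dots> \<le> e (r n) * C"
        using lyap e by (intro mult_left_mono) (auto intro: less_imp_le)
      finally show ?thesis
        unfolding entropy_gap(3)[OF q(1) opt_dim_gt_half] b_def Z'_def
        by (simp add: lyapunov_def algebra_simps)
    qed
    show "(\<lambda>n. entropy_gap opt_dim (q (r n)) k) \<longlonglongrightarrow> entropy_gap opt_dim p k" if "1 \<le> k" for k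
      unfolding entropy_gap_def using lim[OF that] q01[OF that]
      by (intro tendsto_intros tendsto_mult_ln_self) auto
  qed (use entropy_gap[OF q(1) opt_dim_gt_half] in auto)
  then have "opt_dim * lyapunov p \<le> weight_entropy p"
    unfolding entropy_gap(3)[OF pl opt_dim_gt_half] by (simp add: Z'_def lyapunov_def algebra_simps)
  then have "weight_entropy p = opt_dim * lyapunov p"
    using entropy_le_opt_dim[OF pl] by simp
  then show ?thesis
    using pl by blast
qed

text \<open>First-order optimality: moving mass \<open>e\<close> from digit \<open>l\<close> to digit \<open>k\<close> changes the
  excess by at most \<open>4 e ln 2\<close>.\<close>

lemma maximizer_weight_ratio:
  assumes pl: "p \<in> log_vectors" and max: "weight_entropy p = opt_dim * lyapunov p"
    and k: "1 \<le> k" and l: "1 \<le> l"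
  shows "p l \<le> exp (8 * opt_dim * ln 2) * (real k / real l) powr (2 * opt_dim) * p k"
proof (cases "k = l \<or> p l = 0")
  case True
  interpret bernoulli p
    using pl by (rule bernoulli_log_vectors)
  have "1 \<le> exp (8 * opt_dim * ln 2)"
    using opt_dim_gt_half by simp
  then have "1 * p k \<le> exp (8 * opt_dim * ln 2) * p k"
    using p_nonneg[OF k] by (intro mult_right_mono) auto
  then show ?thesis
    using True k p_nonneg[OF k] by auto
next
  case False
  interpret bernoulli p
    using pl by (rule bernoulli_log_vectors)
  \<comment> \<open>The factor 8 is 2 times 4: the Lyapunov exponent contains twice the excess, and
    the excess moves by at most 4 e ln 2.\<close>
  define M where "M = exp (8 * opt_dim * ln 2) * (real k / real l) powr (2 * opt_dim)"
  have M: "0 < M"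
    using k l by (simp add: M_def)
  have pl0: "0 < p l"
    using False p_nonneg[OF l] by simp
  have F: "finite {k, l}" "{k, l} \<subseteq> {1..}"
    using k l by auto
  have step: "p l - e \<le> M * (p k + e)" if e: "0 < e" "e < p l" for e
  proof -
    define q where "q = p(k := p k + e, l := p l - e)"
    have ql: "q k = p k + e" "q l = p l - e" "\<And>i. i \<noteq> k \<Longrightarrow> i \<noteq> l \<Longrightarrow> q i = p i"
      using False by (auto simp: q_def)
    have diff: "integrable CN (\<lambda>i. G q i - G p i)"
      "(\<integral>i. G q i - G p i \<partial>CN) = (G q k - G p k) + (G q l - G p l)"
      if "\<And>i. i \<noteq> k \<Longrightarrow> i \<noteq> l \<Longrightarrow> G q i = G p i" for G :: "(nat \<Rightarrow> real) \<Rightarrow> nat \<Rightarrow> real"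
      using CN_finite_support[OF F, of "\<lambda>i. G q i - G p i"] that False by auto
    \<comment> \<open>Total mass, log moment and entropy are all integrals of a function of the
      single weight, so each changes only by its terms at k and l.\<close>
    have trans: "integrable CN (G q)"
      "integral\<^sup>L CN (G q) = integral\<^sup>L CN (G p) + ((G q k - G p k) + (G q l - G p l))"
      if "\<And>i. i \<noteq> k \<Longrightarrow> i \<noteq> l \<Longrightarrow> G q i = G p i" "integrable CN (G p)" for G :: "(nat \<Rightarrow> real) \<Rightarrow> nat \<Rightarrow> real"
    proof -
      have "integrable CN (\<lambda>i. G p i + (G q i - G p i))"
        using diff[of G] that by (intro Bochner_Integration.integrable_add) auto
      then show "integrable CN (G q)"
        by simp
      have "(\<integral>i. G p i + (G q i - G p i) \<partial>CN) = integral\<^sup>L CN (G p) + (\<integral>i. G q i - G p i \<partial>CN)"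
        using diff[of G] that by (intro Bochner_Integration.integral_add) auto
      then show "integral\<^sup>L CN (G q) = integral\<^sup>L CN (G p) + ((G q k - G p k) + (G q l - G p l))"
        using diff(2)[of G] that(1) by simp
    qed
    have q_int: "integrable CN q" "integral\<^sup>L CN q = 1"
      using trans[of "\<lambda>h. h"] ql p_integrable p_integral by auto
    have q_nonneg: "0 \<le> q i" if "1 \<le> i" for i
      using p_nonneg[OF that] p_nonneg[OF k] e by (auto simp: q_def)
    have q_le: "q i \<le> 1" if "1 \<le> i" for i
    proof -
      have "finite {i}" "{i} \<subseteq> {1..}"
        using that by auto
      from CN_finite_support[OF this, of "\<lambda>j. q j * indicator {i} j"]
      have "q i = (\<integral>j. q j * indicator {i} j \<partial>CN)" "integrable CN (\<lambda>j. q j * indicator {i} j)"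
        by auto
      moreover have "(\<integral>j. q j * indicator {i} j \<partial>CN) \<le> integral\<^sup>L CN q"
        using calculation q_int q_nonneg by (intro integral_mono) (auto simp: indicator_def)
      ultimately show ?thesis
        using q_int by simp
    qed
    have "q \<in> extensional {1..}"
      using prob_vector k l by (auto simp: prob_vectors_iff PiE_iff q_def extensional_def)
    then have "q \<in> prob_vectors"
      using q_nonneg q_le q_int by (auto simp: prob_vectors_iff PiE_iff)
    moreover have q_log: "finite_log_moment q"
      "log_moment q = log_moment p + (e * ln (real k) - e * ln (real l))"
      using trans[of "\<lambda>h i. h i * ln (real i)"] pl ql
      by (auto simp: finite_log_moment_def log_vectors_def log_moment_def algebra_simps)
    ultimately have qlv: "q \<in> log_vectors"
      by (simp add: log_vectors_def)
    have "finite_log_moment p"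
      using pl by (simp add: log_vectors_def)
    then have q_ent: "weight_entropy q = weight_entropy p - ((p k + e) * ln (p k + e) - p k * ln (p k)) 
        - ((p l - e) * ln (p l - e) - p l * ln (p l))"
      using trans(2)[of "\<lambda>h i. - (h i * ln (h i))"] ql integrable_entropy
      by (simp add: weight_entropy_def)
    have q_tv: "tv_dist q p = 2 * e"
      unfolding tv_dist_def using CN_finite_support(2)[OF F, of "\<lambda>i. \<bar>q i - p i\<bar>"] ql False e
      by simp
    have "opt_dim * excess q \<le> opt_dim * (excess p + 4 * ln 2 * e)"
      using excess_lipschitz[OF bernoulli_axioms bernoulli_log_vectors[OF qlv]] q_tv opt_dim_gt_half
      by (intro mult_left_mono) auto
    then have "opt_dim * lyapunov q \<le> opt_dim * lyapunov p
        + 2 * opt_dim * (e * ln (real k) - e * ln (real l)) + 8 * opt_dim * ln 2 * e"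
      by (simp add: lyapunov_def q_log algebra_simps)
    then have 1: "p k * ln (p k) - (p k + e) * ln (p k + e) + (p l * ln (p l) - (p l - e) * ln (p l - e))
        \<le> e * (2 * opt_dim * (ln (real k) - ln (real l)) + 8 * opt_dim * ln 2)"
      using entropy_le_opt_dim[OF qlv] max q_ent by (simp add: algebra_simps)
    \<comment> \<open>Convexity of x ln x with the derivative taken at the new point x + e, which is
      positive even if the old weight is 0.\<close>
    have tangent: "(x + e) * ln (x + e) - x * ln x \<le> e * (ln (x + e) + 1)" if "0 \<le> x" for x
    proof (cases "x = 0")
      case False
      then have x: "0 < x"
        using that by simp
      have "ln (x + e) - ln x = ln (1 + e / x)"
        using x e ln_div[of "x + e" x] by (simp add: add_divide_distrib)
      also have "\<dots> \<le> e / x"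
        using x e by (intro ln_add_one_self_le_self) auto
      finally have "x * (ln (x + e) - ln x) \<le> x * (e / x)"
        using x by (intro mult_left_mono) auto
      then show ?thesis
        using x by (simp add: algebra_simps)
    qed (use e in simp)
    have tangent': "e * (ln (y - e) + 1) \<le> y * ln y - (y - e) * ln (y - e)" if "e < y" for y
    proof -
      have "ln (y / (y - e)) = - ln ((y - e) / y)"
        using that e by (simp add: ln_div)
      moreover have "ln ((y - e) / y) \<le> (y - e) / y - 1"
        using that e by (intro ln_le_minus_one) auto
      ultimately have "1 - (y - e) / y \<le> ln y - ln (y - e)"
        using that e by (simp add: ln_div)
      then have "y * (1 - (y - e) / y) \<le> y * (ln y - ln (y - e))"
        using that e by (intro mult_left_mono) auto
      moreover have "y * (1 - (y - e) / y) = e"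
        using that e by (simp add: field_simps)
      ultimately show ?thesis
        by (simp add: algebra_simps)
    qed
    have "e * (ln (p l - e) - ln (p k + e))
        \<le> p k * ln (p k) - (p k + e) * ln (p k + e) + (p l * ln (p l) - (p l - e) * ln (p l - e))"
      using tangent[OF p_nonneg[OF k]] tangent'[OF e(2)] by (simp add: algebra_simps)
    also note 1
    finally have "ln (p l - e) - ln (p k + e) \<le> 2 * opt_dim * (ln (real k) - ln (real l)) + 8 * opt_dim * ln 2"
      using e by simp
    also have "\<dots> = ln M"
      using k l by (simp add: M_def ln_mult ln_powr ln_div)
    finally have "ln (p l - e) \<le> ln (M * (p k + e))"
      using M e p_nonneg[OF k] by (simp add: ln_mult)
    then show ?thesis
      using M e p_nonneg[OF k] by (subst (asm) ln_le_cancel_iff) auto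
  qed
  have "((\<lambda>e. M * (p k + e) - (p l - e)) \<longlongrightarrow> M * (p k + 0) - (p l - 0)) (at_right 0)"
    by (intro tendsto_intros)
  moreover have "\<forall>\<^sub>F e in at_right 0. 0 \<le> M * (p k + e) - (p l - e)"
    using eventually_at_right[OF pl0] step pl0 by (auto intro!: exI[of _ "p l"])
  ultimately have "0 \<le> M * (p k + 0) - (p l - 0)"
    by (rule tendsto_lowerbound) simp
  then show ?thesis
    by (simp add: M_def)
qed

text \<open>Each digit is compared with digit 1 in both directions. The weight of digit 1 is
  positive, for otherwise the upper comparison would annihilate all weights.\<close>

lemma maximizer_weights:
  assumes pl: "p \<in> log_vectors" and max: "weight_entropy p = opt_dim * lyapunov p"
  shows "\<exists>c>1. \<forall>k\<ge>1. 1 / (c * real k powr (2 * opt_dim)) \<le> p k \<and> p k \<le> c / real k powr (2 * opt_dim)"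
proof -
  interpret bernoulli p
    using pl by (rule bernoulli_log_vectors)
  define M where "M = exp (8 * opt_dim * ln 2)"
  have M: "0 < M"
    by (simp add: M_def)
  have up: "p k \<le> M * p 1 / real k powr (2 * opt_dim)" if "1 \<le> k" for k
    using maximizer_weight_ratio[OF assms, of 1 k] that
    by (simp add: M_def powr_divide)
  have low: "p 1 \<le> M * real k powr (2 * opt_dim) * p k" if "1 \<le> k" for k
    using maximizer_weight_ratio[OF assms that, of 1] by (simp add: M_def)
  have p1: "0 < p 1"
  proof (rule ccontr)
    assume "\<not> 0 < p 1"
    then have "p 1 = 0"
      using p_nonneg[of 1] by simp
    then have "p k = 0" if "1 \<le> k" for k
      using up[OF that] p_nonneg[OF that] by simp
    then have "integral\<^sup>L CN p = integral\<^sup>L CN (\<lambda>_. 0)"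
      by (intro Bochner_Integration.integral_cong) auto
    then show False
      using p_integral by simp
  qed
  define c where "c = M * p 1 + M / p 1 + 1"
  have c: "1 < c" "M * p 1 \<le> c" "M / p 1 \<le> c"
    using M p1 by (auto simp: c_def add_pos_pos)
  show ?thesis
  proof (intro exI[of _ c] conjI allI impI c)
    fix k :: nat
    assume k: "1 \<le> k"
    define w where "w = real k powr (2 * opt_dim)"
    have w: "0 < w"
      using k by (simp add: w_def)
    have "M * p 1 / w \<le> c / w"
      using c w by (intro divide_right_mono) auto
    then show "p k \<le> c / real k powr (2 * opt_dim)"
      using up[OF k] by (simp add: w_def)
    have "1 / (c * w) \<le> 1 / (M / p 1 * w)"
      using c w M p1 by (intro divide_left_mono mult_right_mono mult_pos_pos) auto
    also have "\<dots> = p 1 / (M * w)"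
      using p1 by simp
    also have "\<dots> \<le> p k"
      using low[OF k] M w by (simp add: w_def divide_le_eq mult.commute mult.left_commute)
    finally show "1 / (c * real k powr (2 * opt_dim)) \<le> p k"
      by (simp add: w_def)
  qed
qed

section \<open>Exponential moments of block functions\<close>

text \<open>Rearranged, it bounds the difference quotients (exp (t y) - 1) / t by exp y - 1, the
  integrable majorant in \<open>exp_moment_less_1\<close>. The proof adds the supporting line of exp
  at t y, evaluated at y and at 0 with weights t and 1 - t; the linear terms cancel.\<close>

lemma exp_convex_bound:
  fixes y t :: real
  assumes "0 \<le> t" "t \<le> 1"
  shows "exp (t * y) \<le> (1 - t) + t * exp y"
proof -
  define a where "a = exp (t * y)"
  have a: "0 \<le> a"
    by (simp add: a_def)
  have "exp y = a * exp ((1 - t) * y)"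
    by (simp add: a_def exp_add[symmetric] algebra_simps)
  moreover have "a * (1 + (1 - t) * y) \<le> a * exp ((1 - t) * y)"
    using a by (intro mult_left_mono) auto
  ultimately have 1: "t * (a * (1 + (1 - t) * y)) \<le> t * exp y"
    using assms by (intro mult_left_mono) auto
  have "1 = a * exp (- (t * y))"
    by (simp add: a_def exp_add[symmetric])
  moreover have "a * (1 + - (t * y)) \<le> a * exp (- (t * y))"
    using a by (intro mult_left_mono exp_ge_add_one_self)
  ultimately have 2: "(1 - t) * (a * (1 + - (t * y))) \<le> (1 - t) * 1"
    using assms by (intro mult_left_mono) auto
  have "t * (a * (1 + (1 - t) * y)) + (1 - t) * (a * (1 + - (t * y))) = a"
    by (simp add: algebra_simps)
  then show ?thesis
    using 1 2 by (simp add: a_def)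
qed

text \<open>The moment generating function has derivative \<open>expectation Y < 0\<close> at \<open>0\<close>.\<close>

lemma (in prob_space) exp_moment_less_1:
  fixes Y :: "'a \<Rightarrow> real"
  assumes Y: "integrable M Y" "expectation Y < 0" and expY: "integrable M (\<lambda>x. exp (Y x))"
  shows "\<exists>t. 0 < t \<and> t \<le> 1 \<and> (\<integral>\<^sup>+x. ennreal (exp (t * Y x)) \<partial>M) < 1"
proof -
  have [measurable]: "Y \<in> borel_measurable M"
    using Y by simp
  define t where "t n = 1 / (real n + 1)" for n
  have t: "0 < t n" "t n \<le> 1" for n
    by (auto simp: t_def)
  have t0: "t \<longlonglongrightarrow> 0"
    unfolding t_def using LIMSEQ_inverse_real_of_nat by (simp add: inverse_eq_divide add.commute)
  define f where "f n x = (exp (t n * Y x) - 1) / t n" for n x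
  have lower: "Y x \<le> f n x" for n x
  proof -
    have "t n * Y x \<le> exp (t n * Y x) - 1"
      using exp_ge_add_one_self[of "t n * Y x"] by linarith
    then show ?thesis
      using t[of n] by (simp add: f_def pos_le_divide_eq mult.commute[of "Y x"])
  qed
  have upper: "f n x \<le> exp (Y x) - 1" for n x
  proof -
    have "exp (t n * Y x) - 1 \<le> (exp (Y x) - 1) * t n"
      using t[of n] exp_convex_bound[of "t n" "Y x"] by (simp add: algebra_simps)
    then show ?thesis
      using t[of n] by (simp only: f_def pos_divide_le_eq)
  qed
  have lim: "(\<lambda>n. f n x) \<longlonglongrightarrow> Y x" for x
  proof -
    have "((\<lambda>h. exp (h * Y x)) has_field_derivative exp (0 * Y x) * Y x) (at 0)"
      by (auto intro!: derivative_eq_intros)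
    then have "((\<lambda>h. (exp (h * Y x) - 1) / h) \<longlongrightarrow> Y x) (at 0)"
      by (simp add: DERIV_def)
    moreover have "filterlim t (at 0) sequentially"
      using t0 t by (intro filterlim_atI) (auto intro!: always_eventually simp: less_imp_neq[symmetric])
    ultimately show ?thesis
      unfolding f_def by (rule filterlim_compose)
  qed
  have dom: "integrable M (\<lambda>x. \<bar>Y x\<bar> + exp (Y x) + 1)"
    using Y expY by simp
  have bnd: "norm (f n x) \<le> \<bar>Y x\<bar> + exp (Y x) + 1" for n x
    using lower[of x n] upper[of n x] exp_gt_zero[of "Y x"] unfolding real_norm_def by linarith
  have fm: "f n \<in> borel_measurable M" for n
    unfolding f_def[abs_def] by measurable
  have "(\<lambda>n. expectation (f n)) \<longlonglongrightarrow> expectation Y"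
    by (rule integral_dominated_convergence[OF _ fm dom]) (use lim bnd in auto)
  then have "\<forall>\<^sub>F n in sequentially. expectation (f n) < 0"
    using Y(2) by (rule order_tendstoD)
  then obtain n where n: "expectation (f n) < 0"
    by (auto simp: eventually_sequentially)
  have f_int: "integrable M (f n)"
    by (rule Bochner_Integration.integrable_bound[OF dom fm]) (use bnd in \<open>auto intro: order_trans[OF _ abs_ge_self]\<close>)
  have eq: "exp (t n * Y x) = 1 + t n * f n x" for x
    using t[of n] by (simp add: f_def)
  have "integrable M (\<lambda>x. exp (t n * Y x))"
    unfolding eq using f_int by simp
  then have "(\<integral>\<^sup>+x. ennreal (exp (t n * Y x)) \<partial>M) = ennreal (expectation (\<lambda>x. exp (t n * Y x)))"
    by (intro nn_integral_eq_integral) auto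
  also have "expectation (\<lambda>x. exp (t n * Y x)) = 1 + t n * expectation (f n)"
    unfolding eq using f_int by (simp add: prob_space)
  also have "ennreal \<dots> < 1"
    using n t[of n] by (intro ennreal_less_one_iff[THEN iffD2]) (simp add: mult_pos_neg)
  finally show ?thesis
    using t by blast
qed

text \<open>Markov's inequality for the t-th moment followed by Borel-Cantelli; \<phi> < r makes the
  exceptional probabilities summable. It serves both for decaying block functionals and, with \<phi>
  = 1, for the growth of single digits.\<close>

lemma (in prob_space) AE_eventually_le_if_moment_bound:
  fixes X :: "nat \<Rightarrow> 'a \<Rightarrow> real"
  assumes meas [measurable]: "\<And>n. X n \<in> borel_measurable M" and t: "0 < t"
    and moment: "\<And>n. (\<integral>\<^sup>+x. ennreal (X n x powr t) \<partial>M) \<le> ennreal (C * \<phi> ^ n)"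
    and b: "\<And>n. 0 \<le> b n" "\<And>n. b n powr t = r ^ n"
    and C: "0 \<le> C" and \<phi>: "0 \<le> \<phi>" "\<phi> < r"
  shows "AE x in M. \<forall>\<^sub>F n in sequentially. X n x \<le> b n"
proof -
  have r: "0 < r"
    using \<phi> by simp
  define A where "A n = {x \<in> space M. b n < X n x}" for n
  have A [measurable]: "A n \<in> sets M" for n
    unfolding A_def by measurable
  have "measure M (A n) \<le> C * (\<phi> / r) ^ n" for n
  proof -
    have "emeasure M (A n) \<le> emeasure M {x \<in> space M. 1 \<le> ennreal (1 / r ^ n) * ennreal (X n x powr t)}"
    proof (intro emeasure_mono subsetI)
      fix x
      assume x: "x \<in> A n"
      have "r ^ n \<le> X n x powr t"
        unfolding b(2)[symmetric] using x b(1)[of n] t by (intro powr_mono2) (auto simp: A_def)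
      then have "1 \<le> 1 / r ^ n * X n x powr t"
        using r by (simp add: le_divide_eq)
      then have "1 \<le> ennreal (1 / r ^ n) * ennreal (X n x powr t)"
        using r ennreal_leI[of 1] by (simp flip: ennreal_mult)
      then show "x \<in> {x \<in> space M. 1 \<le> ennreal (1 / r ^ n) * ennreal (X n x powr t)}"
        using x by (simp add: A_def)
    qed measurable
    also have "\<dots> \<le> ennreal (1 / r ^ n) * (\<integral>\<^sup>+x. ennreal (X n x powr t) * indicator (space M) x \<partial>M)"
      using nn_integral_Markov_inequality[of "\<lambda>x. ennreal (X n x powr t)" "space M" M "ennreal (1 / r ^ n)"]
      by simp
    also have "(\<integral>\<^sup>+x. ennreal (X n x powr t) * indicator (space M) x \<partial>M) = (\<integral>\<^sup>+x. ennreal (X n x powr t) \<partial>M)"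
      by (intro nn_integral_cong) simp
    also have "ennreal (1 / r ^ n) * \<dots> \<le> ennreal (1 / r ^ n) * ennreal (C * \<phi> ^ n)"
      using moment by (intro mult_left_mono) auto
    also have "\<dots> = ennreal (C * (\<phi> / r) ^ n)"
      using r \<phi> C by (simp add: power_divide flip: ennreal_mult)
    finally show ?thesis
      using \<phi> r C by (simp add: emeasure_eq_measure)
  qed
  moreover have "summable (\<lambda>n. C * (\<phi> / r) ^ n)"
    using \<phi> r by (intro summable_mult summable_geometric) simp
  ultimately have "summable (\<lambda>n. measure M (A n))"
    using summable_comparison_test'[of "\<lambda>n. C * (\<phi> / r) ^ n" 0 "\<lambda>n. measure M (A n)"] by simp
  then have "AE x in M. \<forall>\<^sub>F n in sequentially. x \<in> space M - A n"
    by (intro borel_cantelli_AE1) (auto simp: less_top[symmetric])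
  then show ?thesis
    by eventually_elim (auto elim!: eventually_mono simp: A_def not_less)
qed

section \<open>Moments of submultiplicative block functionals\<close>

context bernoulli
begin

text \<open>The common features of \<open>cover_ratio\<close> and \<open>mass_ratio\<close>.
  Dependence on the first n digits only makes the two factors of the product bound independent, so a
  single block with t-th moment below 1 already forces exponential decay.\<close>

definition submult_functional :: "((nat \<Rightarrow> nat) \<Rightarrow> nat \<Rightarrow> real) \<Rightarrow> bool" where
  "submult_functional g \<longleftrightarrow>
     (\<forall>n. (\<lambda>x. g x n) \<in> borel_measurable \<nu>) \<and>
     (\<forall>x n. 0 \<le> g x n) \<and>
     (\<forall>x y n. (\<forall>i\<in>{1..n}. x i = y i) \<longrightarrow> g x n = g y n) \<and>
     (\<forall>x\<in>space \<nu>. \<forall>n k. g x (n + k) \<le> g x n * g (shift n x) k) \<and>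
     (\<forall>x\<in>space \<nu>. g x 0 \<le> 1)"

lemma submult_functionalD:
  assumes "submult_functional g"
  shows "(\<lambda>x. g x n) \<in> borel_measurable \<nu>" and "0 \<le> g x n"
    and "(\<And>i. i \<in> {1..n} \<Longrightarrow> x i = y i) \<Longrightarrow> g x n = g y n"
    and "x \<in> space \<nu> \<Longrightarrow> g x (n + k) \<le> g x n * g (shift n x) k"
    and "x \<in> space \<nu> \<Longrightarrow> g x 0 \<le> 1"
  using assms unfolding submult_functional_def by blast+

lemma submult_moment_add:
  assumes g: "submult_functional g" and t: "0 \<le> t"
  shows "(\<integral>\<^sup>+x. ennreal (g x (n + k) powr t) \<partial>\<nu>)
    \<le> (\<integral>\<^sup>+x. ennreal (g x n powr t) \<partial>\<nu>) * (\<integral>\<^sup>+x. ennreal (g x k powr t) \<partial>\<nu>)"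
proof -
  have meas [measurable]: "(\<lambda>x. g x n) \<in> borel_measurable \<nu>" for n
    by (rule submult_functionalD[OF g])
  have nonneg: "0 \<le> g x n" for x n
    by (rule submult_functionalD[OF g])
  have "(\<integral>\<^sup>+x. ennreal (g x (n + k) powr t) \<partial>\<nu>)
      \<le> (\<integral>\<^sup>+x. ennreal (g x n powr t) * ennreal (g (shift n x) k powr t) \<partial>\<nu>)"
  proof (intro nn_integral_mono)
    fix x
    assume "x \<in> space \<nu>"
    then have "g x (n + k) powr t \<le> (g x n * g (shift n x) k) powr t"
      by (intro powr_mono2 submult_functionalD[OF g] t)
    then show "ennreal (g x (n + k) powr t) \<le> ennreal (g x n powr t) * ennreal (g (shift n x) k powr t)"
      by (simp add: powr_mult nonneg ennreal_leI flip: ennreal_mult)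
  qed
  also have "\<dots> = (\<integral>\<^sup>+x. ennreal (g x n powr t) \<partial>\<nu>) * (\<integral>\<^sup>+x. ennreal (g x k powr t) \<partial>\<nu>)"
  proof (rule nn_integral_block_indep[where H = "\<lambda>x. ennreal (g x k powr t)"])
    fix x y :: "nat \<Rightarrow> nat"
    assume "\<And>i. i \<in> {1..n} \<Longrightarrow> x i = y i"
    then have "g x n = g y n"
      by (rule submult_functionalD(3)[OF g])
    then show "ennreal (g x n powr t) = ennreal (g y n powr t)"
      by simp
  qed measurable
  finally show ?thesis .
qed

lemma submult_moment_power:
  assumes g: "submult_functional g" and t: "0 \<le> t"
  shows "(\<integral>\<^sup>+x. ennreal (g x (N * m) powr t) \<partial>\<nu>) \<le> (\<integral>\<^sup>+x. ennreal (g x m powr t) \<partial>\<nu>) ^ N"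
proof (induction N)
  case 0
  have "(\<integral>\<^sup>+x. ennreal (g x 0 powr t) \<partial>\<nu>) \<le> (\<integral>\<^sup>+x. 1 \<partial>\<nu>)"
  proof (intro nn_integral_mono)
    fix x
    assume "x \<in> space \<nu>"
    then have "g x 0 powr t \<le> 1 powr t"
      by (intro powr_mono2 submult_functionalD[OF g] t)
    then show "ennreal (g x 0 powr t) \<le> 1"
      by simp
  qed
  then show ?case
    by (simp add: emeasure_space_1)
next
  case (Suc N)
  have "(\<integral>\<^sup>+x. ennreal (g x (Suc N * m) powr t) \<partial>\<nu>)
      \<le> (\<integral>\<^sup>+x. ennreal (g x m powr t) \<partial>\<nu>) * (\<integral>\<^sup>+x. ennreal (g x (N * m) powr t) \<partial>\<nu>)"
    using submult_moment_add[OF g t, of m "N * m"] by simp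
  also have "\<dots> \<le> (\<integral>\<^sup>+x. ennreal (g x m powr t) \<partial>\<nu>) * (\<integral>\<^sup>+x. ennreal (g x m powr t) \<partial>\<nu>) ^ N"
    using Suc by (intro mult_left_mono) auto
  finally show ?case by simp
qed

lemma submult_decay:
  assumes g: "submult_functional g" and t: "0 < t"
    and less: "(\<integral>\<^sup>+x. ennreal (g x m powr t) \<partial>\<nu>) < 1"
  shows "\<exists>\<theta>. 0 < \<theta> \<and> \<theta> < 1 \<and> (AE x in \<nu>. \<forall>\<^sub>F N in sequentially. g x (N * m) \<le> \<theta> ^ N)"
proof -
  have meas [measurable]: "(\<lambda>x. g x n) \<in> borel_measurable \<nu>" for n
    by (rule submult_functionalD[OF g])
  obtain \<phi> where \<phi>: "(\<integral>\<^sup>+x. ennreal (g x m powr t) \<partial>\<nu>) = ennreal \<phi>" "0 \<le> \<phi>" "\<phi> < 1"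
    using less by (cases "\<integral>\<^sup>+x. ennreal (g x m powr t) \<partial>\<nu>") (auto simp: ennreal_less_one_iff)
  \<comment> \<open>The room between \<phi> and r makes the Markov bounds summable; the t-th root of
    r is then the almost sure rate of decay.\<close>
  obtain r where r: "\<phi> < r" "r < 1"
    using \<phi> dense by blast
  have r0: "0 < r"
    using \<phi> r by simp
  define \<theta> where "\<theta> = r powr (1 / t)"
  have \<theta>: "0 < \<theta>" "\<theta> < 1"
    using r r0 t powr_less_mono2[of "1 / t" r 1] by (auto simp: \<theta>_def)
  have "AE x in \<nu>. \<forall>\<^sub>F N in sequentially. g x (N * m) \<le> \<theta> ^ N"
  proof (rule AE_eventually_le_if_moment_bound[OF meas t])
    show "(\<integral>\<^sup>+x. ennreal (g x (N * m) powr t) \<partial>\<nu>) \<le> ennreal (1 * \<phi> ^ N)" for N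
      using submult_moment_power[OF g, of t N m] t \<phi> by (simp add: ennreal_power)
    show "(\<theta> ^ N) powr t = r ^ N" for N
      using r0 t by (simp add: \<theta>_def powr_realpow[symmetric] powr_powr)
  qed (use \<theta> \<phi> r in auto)
  then show ?thesis
    using \<theta> by blast
qed

section \<open>Word probabilities and the covering functional\<close>

definition word_prob :: "(nat \<Rightarrow> nat) \<Rightarrow> nat \<Rightarrow> nat \<Rightarrow> real" where
  "word_prob x m n = (\<Prod>i\<in>{m..<m + n}. p (x i))"

lemma word_prob_add: "word_prob x m (n + k) = word_prob x m n * word_prob x (m + n) k"
proof -
  have "{m..<m + (n + k)} = {m..<m + n} \<union> {m + n..<m + n + k}"
    by auto
  then show ?thesis
    by (simp add: word_prob_def prod.union_disjoint)
qed

lemma word_prob_shift: "1 \<le> m \<Longrightarrow> word_prob (shift d x) m n = word_prob x (m + d) n"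
  unfolding word_prob_def
  using prod.shift_bounds_nat_ivl[of "\<lambda>i. p (x i)" m d "m + n"]
  by (auto simp: shift_def add.commute add.left_commute intro!: prod.cong)

lemma word_prob_cong:
  assumes "\<And>i. i \<in> {m..<m + n} \<Longrightarrow> x i = y i"
  shows "word_prob x m n = word_prob y m n"
  unfolding word_prob_def using assms by (intro prod.cong) auto

lemma word_prob_measurable [measurable (raw)]:
  "1 \<le> m \<Longrightarrow> (\<lambda>x. word_prob x m n) \<in> borel_measurable \<nu>"
  unfolding word_prob_def by (intro borel_measurable_prod measurable_coord_comp) auto

lemma AE_W_pos: "AE k in W. 0 < p k"
  unfolding weight_measure_def by (subst AE_density) (auto simp: AE_count_space)

lemma AE_digit_weights_pos: "AE x in \<nu>. \<forall>i\<ge>1. 0 < p (x i)"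
proof -
  have "AE x in \<nu>. 1 \<le> i \<longrightarrow> 0 < p (x i)" for i
  proof (cases "1 \<le> i")
    case True
    have "AE x in \<nu>. 0 < p (x i)"
      unfolding bernoulli_measure_def using True by (intro PP.AE_component[OF _ AE_W_pos]) simp
    then show ?thesis
      by eventually_elim simp
  qed simp
  then show ?thesis
    by (simp add: AE_all_countable)
qed

lemma word_prob_pos: "\<forall>i\<ge>1. 0 < p (x i) \<Longrightarrow> 1 \<le> m \<Longrightarrow> 0 < word_prob x m n"
  unfolding word_prob_def by (intro prod_pos) auto

lemma AE_ln_word_prob: "AE x in \<nu>. ln (word_prob x 1 n) = (\<Sum>i\<in>{1..<1 + n}. ln (p (x i)))"
  using AE_digit_weights_pos
proof eventually_elim
  case (elim x)
  show ?case
    unfolding word_prob_def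
  proof (rule ln_prod)
    fix i
    assume "i \<in> {1..<1 + n}"
    then have "0 < p (x i)"
      using elim by auto
    then show "p (x i) \<noteq> 0"
      by simp
  qed simp
qed

text \<open>Up to constants the s-th power of the length of a cylinder divided by its measure, since
  lengths are comparable with Q^(-2). The absolute values make it nonnegative at every argument, and
  a word of probability 0 has ratio 0.\<close>

definition cover_ratio :: "real \<Rightarrow> (nat \<Rightarrow> nat) \<Rightarrow> nat \<Rightarrow> real" where
  "cover_ratio s x n = \<bar>cf_den x 1 n 0\<bar> powr - (2 * s) / \<bar>word_prob x 1 n\<bar>"

lemma submult_cover_ratio:
  assumes s: "0 \<le> s"
  shows "submult_functional (cover_ratio s)"
  unfolding submult_functional_def
proof (intro conjI allI ballI impI)
  show "(\<lambda>x. cover_ratio s x n) \<in> borel_measurable \<nu>" for n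
    unfolding cover_ratio_def by measurable
  show "0 \<le> cover_ratio s x n" for x n
    by (simp add: cover_ratio_def)
  show "cover_ratio s x n = cover_ratio s y n" if "\<forall>i\<in>{1..n}. x i = y i" for x y n
    using that cf_den_cong[of 1 n x y] word_prob_cong[of 1 n x y] by (simp add: cover_ratio_def)
  show "cover_ratio s x 0 \<le> 1" for x
    by (simp add: cover_ratio_def word_prob_def)
  fix x n k
  assume x: "x \<in> space \<nu>"
  define a b c where "a = cf_den x 1 n 0" and "b = cf_den x (1 + n) k 0" and "c = cf_den x 1 (n + k) 0"
  have ge: "1 \<le> a" "1 \<le> b" "1 \<le> c"
    unfolding a_def b_def c_def using psi_pos_digits[OF x] by (auto intro!: cf_den_ge_1)
  have "c powr - (2 * s) \<le> (a * b) powr - (2 * s)"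
    using cf_den_quasi_mult(1)[OF psi_pos_digits[OF x], of 1 n k] ge s
    by (intro powr_mono2') (auto simp: a_def b_def c_def)
  then have "\<bar>c\<bar> powr - (2 * s) / \<bar>word_prob x 1 (n + k)\<bar>
      \<le> (\<bar>a\<bar> powr - (2 * s) * \<bar>b\<bar> powr - (2 * s)) / (\<bar>word_prob x 1 n\<bar> * \<bar>word_prob x (1 + n) k\<bar>)"
    using ge by (simp add: powr_mult word_prob_add abs_mult divide_right_mono)
  then show "cover_ratio s x (n + k) \<le> cover_ratio s x n * cover_ratio s (shift n x) k"
    unfolding cover_ratio_def a_def b_def c_def
    by (simp add: cf_den_shift_n word_prob_shift)
qed

lemma cover_ratio_powr_eq_exp:
  assumes "0 < w" "1 \<le> (q::real)"
  shows "(\<bar>q\<bar> powr - (2 * s) / \<bar>w\<bar>) powr t = exp (t * (- ln w - 2 * s * ln q))"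
  using assms by (simp add: powr_def ln_div ln_mult algebra_simps)

lemma neg_ln_word_prob_integral:
  assumes fl: "finite_log_moment p"
  shows "integrable \<nu> (\<lambda>x. - ln (word_prob x 1 n))"
    and "(\<integral>x. - ln (word_prob x 1 n) \<partial>\<nu>) = real n * weight_entropy p"
proof -
  have int: "integrable \<nu> (\<lambda>x. - ln (p (x i)))" "(\<integral>x. - ln (p (x i)) \<partial>\<nu>) = weight_entropy p" if "1 \<le> i" for i
    using integrable_entropy[OF fl] integrable_coord[OF that, of "\<lambda>k. - ln (p k)"]
      integral_coord[OF that, of "\<lambda>k. - ln (p k)"]
    by (auto simp: integrable_weight integral_weight weight_entropy_def)
  have ae: "AE x in \<nu>. - ln (word_prob x 1 n) = (\<Sum>i\<in>{1..<1 + n}. - ln (p (x i)))"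
    using AE_ln_word_prob[of n] by eventually_elim (simp add: sum_negf del: sum.op_ivl_Suc)
  have int_sum: "integrable \<nu> (\<lambda>x. \<Sum>i\<in>{1..<1 + n}. - ln (p (x i)))"
    using int by (intro Bochner_Integration.integrable_sum) auto
  then show "integrable \<nu> (\<lambda>x. - ln (word_prob x 1 n))"
    using ae by (subst integrable_cong_AE) (auto intro: borel_measurable_integrable)
  have "(\<integral>x. - ln (word_prob x 1 n) \<partial>\<nu>) = (\<integral>x. (\<Sum>i\<in>{1..<1 + n}. - ln (p (x i))) \<partial>\<nu>)"
    using ae int_sum by (intro integral_cong_AE) (auto intro: borel_measurable_integrable)
  also have "\<dots> = (\<Sum>i\<in>{1..<1 + n}. weight_entropy p)"
    using int by (subst Bochner_Integration.integral_sum)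
      (auto intro!: sum.cong simp del: sum_constant One_nat_def)
  finally show "(\<integral>x. - ln (word_prob x 1 n) \<partial>\<nu>) = real n * weight_entropy p"
    by simp
qed

lemma nn_integral_weight: "(\<integral>\<^sup>+k. f k \<partial>W) = (\<integral>\<^sup>+k. ennreal (p k) * f k \<partial>CN)"
  unfolding weight_measure_def by (subst nn_integral_density) auto

text \<open>In the expectation the weight of the digit cancels against the denominator and leaves
  the convergent series of k^(-2s).\<close>

lemma cover_ratio_1_moment:
  assumes s: "1 / 2 < s"
  shows "(\<integral>\<^sup>+x. ennreal (cover_ratio s x 1 powr 1) \<partial>\<nu>) < \<infinity>"
proof -
  have "(\<integral>\<^sup>+x. ennreal (cover_ratio s x 1 powr 1) \<partial>\<nu>)
      = (\<integral>\<^sup>+x. ennreal (real (x 1) powr - (2 * s) / \<bar>p (x 1)\<bar>) \<partial>\<nu>)"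
    by (simp add: cover_ratio_def word_prob_def)
  also have "\<dots> = (\<integral>\<^sup>+k. ennreal (real k powr - (2 * s) / \<bar>p k\<bar>) \<partial>W)"
    by (rule nn_integral_coord) simp
  also have "\<dots> \<le> (\<integral>\<^sup>+k. ennreal (real k powr - (2 * s)) \<partial>CN)"
    unfolding nn_integral_weight using p_nonneg
    by (intro nn_integral_mono) (auto simp: ennreal_mult[symmetric] intro!: ennreal_leI)
  also have "\<dots> < \<infinity>"
    using integrable_CN_powr[of "2 * s"] s by (subst nn_integral_eq_integral) auto
  finally show ?thesis .
qed

text \<open>Y is the logarithm of the cover ratio of an m-block. Its mean is at most 2 s ln 2 - m d:
  comparing entropy with \<open>opt_dim\<close> gives the drift d per digit, and m is large enough
  to beat the distortion error. Integrability of exp Y is inherited from one digit by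
  submultiplicativity.\<close>

lemma cover_moment_finite_log:
  assumes pl: "p \<in> log_vectors" and s: "opt_dim < s"
  shows "\<exists>m t. 1 \<le> m \<and> 0 < t \<and> (\<integral>\<^sup>+x. ennreal (cover_ratio s x m powr t) \<partial>\<nu>) < 1"
proof -
  have fl: "finite_log_moment p"
    using pl by (simp add: log_vectors_def)
  have s0: "1 / 2 < s"
    using opt_dim_gt_half s by simp
  define d where "d = (s - opt_dim) * lyapunov p"
  have d: "0 < d"
    using s lyapunov_pos[OF pl] by (simp add: d_def)
  obtain m :: nat where m: "2 * s * ln 2 / d < real m"
    using reals_Archimedean2 by blast
  have "0 < 2 * s * ln 2 / d"
    using s0 d by simp
  then have m1: "1 \<le> m"
    using m by (cases m) auto
  define Y where "Y x = - ln (word_prob x 1 m) - 2 * s * ln (cf_den x 1 m 0)" for x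
  have int: "integrable \<nu> Y"
    unfolding Y_def[abs_def]
    by (intro Bochner_Integration.integrable_diff neg_ln_word_prob_integral(1) fl integrable_mult_right log_den_integral(1))
  have "integral\<^sup>L \<nu> Y = real m * weight_entropy p - s * (2 * (\<integral>x. ln (cf_den x 1 m 0) \<partial>\<nu>))"
    unfolding Y_def[abs_def] using neg_ln_word_prob_integral[OF fl, of m] log_den_integral(1)[OF fl, of m] by simp
  also have "\<dots> \<le> real m * (opt_dim * lyapunov p) - s * (real m * lyapunov p - 2 * ln 2)"
    using log_den_integral(3)[OF fl, of m] entropy_le_opt_dim[OF pl] s0
    by (intro diff_mono mult_left_mono) auto
  also have "\<dots> = 2 * s * ln 2 - real m * d"
    by (simp add: d_def algebra_simps)
  also have "\<dots> < 0"
    using m d by (simp add: divide_less_eq)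
  finally have neg: "integral\<^sup>L \<nu> Y < 0" .
  have eq: "AE x in \<nu>. cover_ratio s x m powr t = exp (t * Y x)" for t
    using AE_digit_weights_pos AE_space
  proof eventually_elim
    case (elim x)
    show ?case
      unfolding cover_ratio_def Y_def
      using word_prob_pos[OF elim(1)] cf_den_ge_1[OF psi_pos_digits[OF elim(2)]]
      by (intro cover_ratio_powr_eq_exp) auto
  qed
  have "(\<integral>\<^sup>+x. ennreal (exp (1 * Y x)) \<partial>\<nu>) = (\<integral>\<^sup>+x. ennreal (cover_ratio s x (m * 1) powr 1) \<partial>\<nu>)"
    using eq[of 1] by (intro nn_integral_cong_AE) (auto elim: eventually_mono)
  also have "\<dots> \<le> (\<integral>\<^sup>+x. ennreal (cover_ratio s x 1 powr 1) \<partial>\<nu>) ^ m"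
    using s0 by (intro submult_moment_power submult_cover_ratio) auto
  also have "\<dots> < \<infinity>"
    using cover_ratio_1_moment[OF s0] by (simp add: power_less_top_ennreal)
  finally have "integrable \<nu> (\<lambda>x. exp (Y x))"
    using int by (intro integrableI_bounded) auto
  from exp_moment_less_1[OF int neg this] obtain t where t: "0 < t" "(\<integral>\<^sup>+x. ennreal (exp (t * Y x)) \<partial>\<nu>) < 1"
    by blast
  have "(\<integral>\<^sup>+x. ennreal (cover_ratio s x m powr t) \<partial>\<nu>) = (\<integral>\<^sup>+x. ennreal (exp (t * Y x)) \<partial>\<nu>)"
    using eq[of t] by (intro nn_integral_cong_AE) (auto elim: eventually_mono)
  then have "(\<integral>\<^sup>+x. ennreal (cover_ratio s x m powr t) \<partial>\<nu>) < 1"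
    using t by simp
  then show ?thesis
    using m1 t(1) by blast
qed

text \<open>With infinite Lyapunov exponent a single digit suffices: flattening the exponent \<open>Y\<close> to
  its positive part outside a large finite set keeps it integrable while its mean becomes negative.\<close>

lemma cover_moment_infinite_log:
  assumes nfl: "\<not> finite_log_moment p" and s: "1 / 2 < s"
  shows "\<exists>m t. 1 \<le> m \<and> 0 < t \<and> (\<integral>\<^sup>+x. ennreal (cover_ratio s x m powr t) \<partial>\<nu>) < 1"
proof -
  obtain s' where s': "1 / 2 < s'" "s' < s"
    using s dense by blast
  define Z where "Z u = (\<integral>k. real k powr - (2 * u) \<partial>CN)" for u
  have Zint: "integrable CN (\<lambda>k. real k powr - (2 * u))" if "1 / 2 < u" for u
    using integrable_CN_powr[of "2 * u"] that by simp
  have ln_nonneg: "0 \<le> p k * ln (real k)" if "1 \<le> k" for k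
    using p_nonneg[OF that] that by simp
  have fin: "finite {1..K}" "{1..K} \<subseteq> {1::nat..}" for K
    by auto
  \<comment> \<open>The threshold solves Z s' - 2 (s - s') L < - Z s for the truncated log moment L.
    Splitting off s - s' from the exponent makes the head of the mean arbitrarily negative, and it
    has to outweigh the flattened tail, which is at most Z s.\<close>
  have "\<exists>K. (Z s' + Z s) / (2 * (s - s')) < (\<Sum>k\<in>{1..K}. p k * ln (real k))"
  proof (rule ccontr)
    assume no: "\<nexists>K. (Z s' + Z s) / (2 * (s - s')) < (\<Sum>k\<in>{1..K}. p k * ln (real k))"
    define f where "f n k = (if k \<le> n then p k * ln (real k) else 0)" for n k :: nat
    have f: "integrable CN (f n)" "integral\<^sup>L CN (f n) = (\<Sum>k\<in>{1..n}. p k * ln (real k))" for n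
      using CN_finite_support[OF fin, of n "f n"] by (auto simp: f_def)
    have "integrable CN (\<lambda>k. p k * ln (real k))"
    proof (rule CN_fatou(1)[of f])
      show "(\<lambda>n. f n k) \<longlonglongrightarrow> p k * ln (real k)" for k
        by (rule tendsto_eventually) (auto simp: f_def eventually_sequentially intro: exI[of _ k])
      show "integral\<^sup>L CN (f n) \<le> (Z s' + Z s) / (2 * (s - s'))" for n
        using no unfolding f by (auto simp: not_less)
    qed (use f ln_nonneg in \<open>auto simp: f_def\<close>)
    then show False
      using nfl by (simp add: finite_log_moment_def)
  qed
  then obtain K where K: "(Z s' + Z s) / (2 * (s - s')) < (\<Sum>k\<in>{1..K}. p k * ln (real k))"
    by blast
  define y where "y u k = - ln (p k) - 2 * u * ln (real k)" for u k
  have py: "p k * y u k \<le> real k powr - (2 * u)" if "1 \<le> k" for u k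
    using entropy_term_le[OF p_nonneg[OF that] that, of u] p_nonneg[OF that] by (simp add: y_def algebra_simps)
  define V where "V k = (if k \<le> K then y s k else max 0 (y s k))" for k
  define V1 where "V1 k = (if k \<le> K then p k * y s k else 0)" for k
  define V2 where "V2 k = (if k \<le> K then 0 else p k * max 0 (y s k))" for k
  have pV: "p k * V k = V1 k + V2 k" for k
    by (simp add: V_def V1_def V2_def)
  have V1: "integrable CN V1" "integral\<^sup>L CN V1 = (\<Sum>k\<in>{1..K}. p k * y s k)"
    using CN_finite_support[OF fin, of K V1] by (auto simp: V1_def)
  have V2b: "0 \<le> V2 k" "V2 k \<le> real k powr - (2 * s)" if "1 \<le> k" for k
    using py[OF that, of s] p_nonneg[OF that] by (auto simp: V2_def max_def)
  have V2: "integrable CN V2"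
    by (rule Bochner_Integration.integrable_bound[OF Zint[OF s]]) (use V2b in \<open>auto simp: AE_count_space\<close>)
  have V2i: "integral\<^sup>L CN V2 \<le> Z s"
    unfolding Z_def using V2b by (intro integral_mono V2 Zint s) auto
  have "(\<Sum>k\<in>{1..K}. p k * y s k) = (\<Sum>k\<in>{1..K}. p k * y s' k - 2 * (s - s') * (p k * ln (real k)))"
    by (intro sum.cong refl) (simp add: y_def algebra_simps)
  also have "\<dots> = (\<Sum>k\<in>{1..K}. p k * y s' k) - 2 * (s - s') * (\<Sum>k\<in>{1..K}. p k * ln (real k))"
    by (simp add: sum_subtractf sum_distrib_left)
  also have "(\<Sum>k\<in>{1..K}. p k * y s' k) \<le> (\<Sum>k\<in>{1..K}. real k powr - (2 * s'))"
    using py by (intro sum_mono) auto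
  also have "\<dots> = (\<integral>k. (if k \<le> K then real k powr - (2 * s') else 0) \<partial>CN)"
    by (subst CN_finite_support(2)[OF fin, of K]) auto
  also have "\<dots> \<le> Z s'"
    unfolding Z_def using CN_finite_support(1)[OF fin, of K "\<lambda>k. if k \<le> K then real k powr - (2 * s') else 0"] s'
    by (intro integral_mono Zint) auto
  finally have "(\<Sum>k\<in>{1..K}. p k * y s k) \<le> Z s' - 2 * (s - s') * (\<Sum>k\<in>{1..K}. p k * ln (real k))"
    by simp
  also have "\<dots> < - Z s"
    using K s' by (simp add: divide_less_eq mult.commute)
  finally have "integral\<^sup>L CN V1 + integral\<^sup>L CN V2 < 0"
    using V1 V2i by simp
  then have neg: "integral\<^sup>L W V < 0"
    unfolding integral_weight pV using V1 V2 by simp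
  have int: "integrable W V"
    unfolding integrable_weight pV using V1 V2 by simp
  \<comment> \<open>Flattening costs little: the exponential of the positive part of y is at most
    exp y + 1, and the weight times exp y is again k^(-2s).\<close>
  have expV: "p k * exp (V k) \<le> real k powr - (2 * s) + p k" if k: "1 \<le> k" for k
  proof (cases "p k = 0")
    case False
    then have pk: "0 < p k"
      using p_nonneg[OF k] by simp
    have "p k * exp (y s k) = real k powr - (2 * s)"
      using pk k by (simp add: y_def exp_diff exp_minus powr_def inverse_eq_divide)
    moreover have "exp (V k) \<le> exp (y s k) + 1"
      by (auto simp: V_def max_def)
    then have "p k * exp (V k) \<le> p k * (exp (y s k) + 1)"
      using pk by (intro mult_left_mono) auto
    ultimately show ?thesis
      by (simp add: algebra_simps)
  qed simp
  have "integrable CN (\<lambda>k. p k * exp (V k))"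
  proof (rule Bochner_Integration.integrable_bound)
    show "integrable CN (\<lambda>k. real k powr - (2 * s) + p k)"
      using Zint[OF s] p_integrable by simp
    show "AE k in CN. norm (p k * exp (V k)) \<le> norm (real k powr - (2 * s) + p k)"
      using expV p_nonneg by (auto simp: AE_count_space abs_mult intro: order_trans[OF _ abs_ge_self])
  qed simp
  then have "integrable W (\<lambda>k. exp (V k))"
    by (simp add: integrable_weight)
  from W.exp_moment_less_1[OF int neg this] obtain t
    where t: "0 < t" "(\<integral>\<^sup>+k. ennreal (exp (t * V k)) \<partial>W) < 1"
    by blast
  have "(\<integral>\<^sup>+x. ennreal (cover_ratio s x 1 powr t) \<partial>\<nu>)
      = (\<integral>\<^sup>+x. ennreal ((real (x 1) powr - (2 * s) / \<bar>p (x 1)\<bar>) powr t) \<partial>\<nu>)"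
    by (simp add: cover_ratio_def word_prob_def)
  also have "\<dots> = (\<integral>\<^sup>+k. ennreal ((real k powr - (2 * s) / \<bar>p k\<bar>) powr t) \<partial>W)"
    by (rule nn_integral_coord) simp
  also have "\<dots> \<le> (\<integral>\<^sup>+k. ennreal (exp (t * V k)) \<partial>W)"
  proof (rule nn_integral_mono_AE)
    show "AE k in W. ennreal ((real k powr - (2 * s) / \<bar>p k\<bar>) powr t) \<le> ennreal (exp (t * V k))"
      using AE_W_pos AE_space
    proof eventually_elim
      case (elim k)
      then have "(real k powr - (2 * s) / \<bar>p k\<bar>) powr t = exp (t * y s k)"
        using cover_ratio_powr_eq_exp[of "p k" "real k" s t] by (simp add: y_def)
      moreover have "y s k \<le> V k"
        by (simp add: V_def)
      ultimately show ?case
        using t by (simp add: ennreal_leI)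
    qed
  qed
  finally show ?thesis
    using t by (intro exI[of _ "1::nat"] exI[of _ t]) auto
qed

lemma cover_ratio_decay:
  assumes s: "opt_dim < s"
  shows "\<exists>m \<theta>. 1 \<le> m \<and> 0 < \<theta> \<and> \<theta> < 1 \<and>
    (AE x in \<nu>. \<forall>\<^sub>F N in sequentially. cover_ratio s x (N * m) \<le> \<theta> ^ N)"
proof -
  have s0: "1 / 2 < s"
    using opt_dim_gt_half s by simp
  have "\<exists>m t. 1 \<le> m \<and> 0 < t \<and> (\<integral>\<^sup>+x. ennreal (cover_ratio s x m powr t) \<partial>\<nu>) < 1"
  proof (cases "finite_log_moment p")
    case True
    then show ?thesis
      using cover_moment_finite_log[OF _ s] prob_vector by (simp add: log_vectors_def)
  next
    case False
    then show ?thesis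
      using cover_moment_infinite_log[OF _ s0] by blast
  qed
  then obtain m t where "1 \<le> m" "0 < t" "(\<integral>\<^sup>+x. ennreal (cover_ratio s x m powr t) \<partial>\<nu>) < 1"
    by blast
  then show ?thesis
    using submult_decay[OF submult_cover_ratio, of s t m] s0 by auto
qed

end

section \<open>Hausdorff dimension of subsets of the unit interval\<close>

lemma hausdorff_measure_zeroI:
  assumes "\<And>\<delta> \<epsilon>. 0 < \<delta> \<Longrightarrow> 0 < \<epsilon> \<Longrightarrow> \<exists>U. A \<subseteq> (\<Union>i. U i) \<and>
    (\<forall>i::nat. bounded (U i) \<and> diameter (U i) \<le> \<delta>) \<and> (\<Sum>i. ennreal (hausdorff_gauge s (U i))) \<le> ennreal \<epsilon>"
  shows "hausdorff_measure s A = 0"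
proof -
  have "hausdorff_premeasure \<delta> s A \<le> 0" if \<delta>: "0 < \<delta>" for \<delta>
  proof (rule ennreal_le_epsilon)
    fix \<epsilon> :: real
    assume "0 < \<epsilon>"
    from assms[OF \<delta> this] obtain U where U: "A \<subseteq> (\<Union>i. U i)"
      "\<forall>i::nat. bounded (U i) \<and> diameter (U i) \<le> \<delta>" "(\<Sum>i. ennreal (hausdorff_gauge s (U i))) \<le> ennreal \<epsilon>"
      by blast
    have "hausdorff_premeasure \<delta> s A \<le> (\<Sum>i. ennreal (hausdorff_gauge s (U i)))"
      unfolding hausdorff_premeasure_def using U(1,2) by (intro INF_lower) auto
    then show "hausdorff_premeasure \<delta> s A \<le> 0 + ennreal \<epsilon>"
      using U(3) by simp
  qed
  then have "hausdorff_measure s A \<le> 0"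
    unfolding hausdorff_measure_def by (intro SUP_least) simp
  then show ?thesis
    by simp
qed

text \<open>It makes the set in \<open>hausdorff_dim\<close> nonempty, so that lower bounds pass to
  the infimum. At exponent 2 the n intervals of length 1/n have total gauge only 1/n.\<close>

lemma hausdorff_measure_2_unit:
  fixes A :: "real set"
  assumes "A \<subseteq> {0..<1}"
  shows "hausdorff_measure 2 A = 0"
proof (rule hausdorff_measure_zeroI)
  fix \<delta> \<epsilon> :: real
  assume \<delta>: "0 < \<delta>" and \<epsilon>: "0 < \<epsilon>"
  obtain n :: nat where n: "1 / min \<delta> \<epsilon> < real n"
    using reals_Archimedean2 by blast
  have "0 < 1 / min \<delta> \<epsilon>"
    using \<delta> \<epsilon> by simp
  then have n0: "0 < real n"
    using n by linarith
  have "1 < real n * min \<delta> \<epsilon>"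
    using n \<delta> \<epsilon> by (simp only: pos_divide_less_eq min_less_iff_conj)
  then have "1 / real n \<le> min \<delta> \<epsilon>"
    using n0 by (simp only: pos_divide_le_eq mult.commute less_imp_le)
  then have le: "1 / real n \<le> \<delta>" "1 / real n \<le> \<epsilon>"
    by auto
  define U where "U i = (if i < n then {real i / real n..(real i + 1) / real n} else {})" for i
  have diam: "diameter (U i) = 1 / real n" if "i < n" for i
    using that n0 by (simp add: U_def diameter_closed_interval add_divide_distrib divide_right_mono)
  have gauge: "hausdorff_gauge 2 (U i) = (if i < n then (1 / real n)\<^sup>2 else 0)" for i
    using diam[of i] n0 by (auto simp: hausdorff_gauge_def U_def divide_right_mono)
  show "\<exists>U. A \<subseteq> (\<Union>i. U i) \<and> (\<forall>i::nat. bounded (U i) \<and> diameter (U i) \<le> \<delta>) \<and>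
      (\<Sum>i. ennreal (hausdorff_gauge 2 (U i))) \<le> ennreal \<epsilon>"
  proof (intro exI[of _ U] conjI allI subsetI)
    fix x
    assume "x \<in> A"
    then have x: "0 \<le> x" "x < 1"
      using assms by auto
    define i where "i = nat \<lfloor>x * real n\<rfloor>"
    have i: "real i \<le> x * real n" "x * real n < real i + 1"
      using x n0 by (auto simp: i_def)
    have "x * real n < 1 * real n"
      using x n0 by (intro mult_strict_right_mono) auto
    then have "i < n"
      using i by simp
    then have "x \<in> U i"
      using i n0 by (simp add: U_def divide_le_eq le_divide_eq)
    then show "x \<in> (\<Union>i. U i)"
      by blast
  next
    fix i
    show "bounded (U i)"
      by (simp add: U_def)
    show "diameter (U i) \<le> \<delta>"
      using diam[of i] le \<delta> by (cases "i < n") (auto simp: U_def)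
  next
    have "(\<Sum>i. ennreal (hausdorff_gauge 2 (U i))) = (\<Sum>i<n. ennreal ((1 / real n)\<^sup>2))"
      unfolding gauge by (subst suminf_finite[of "{..<n}"]) auto
    also have "\<dots> = ennreal (1 / real n)"
      using n0 by (simp add: ennreal_of_nat_eq_real_of_nat power2_eq_square flip: ennreal_mult)
    finally show "(\<Sum>i. ennreal (hausdorff_gauge 2 (U i))) \<le> ennreal \<epsilon>"
      using le by (simp add: ennreal_leI)
  qed
qed

text \<open>The mass distribution estimate works for positive exponents; this supplies the remaining
  exponent 0, where the gauge counts nonempty sets.\<close>

lemma hausdorff_measure_0_nonempty:
  fixes B :: "real set"
  assumes "B \<noteq> {}"
  shows "hausdorff_measure 0 B \<noteq> 0"
proof
  assume "hausdorff_measure 0 B = 0"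
  moreover have "hausdorff_premeasure 1 0 B \<le> hausdorff_measure 0 B"
    unfolding hausdorff_measure_def by (rule SUP_upper) simp
  ultimately have "hausdorff_premeasure 1 0 B < 1"
    by simp
  then obtain U where U: "B \<subseteq> (\<Union>i::nat. U i)" "(\<Sum>i. ennreal (hausdorff_gauge 0 (U i))) < 1"
    unfolding hausdorff_premeasure_def by (auto simp: INF_less_iff)
  obtain i where "U i \<noteq> {}"
    using U(1) assms by blast
  then have "1 \<le> (\<Sum>i\<in>{i}. ennreal (hausdorff_gauge 0 (U i)))"
    by (simp add: hausdorff_gauge_def)
  also have "\<dots> \<le> (\<Sum>i. ennreal (hausdorff_gauge 0 (U i)))"
    by (rule sum_le_suminf) auto
  finally show False
    using U(2) by simp
qed

lemma hausdorff_dim_le: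
  assumes "0 \<le> s" "hausdorff_measure s A = 0"
  shows "hausdorff_dim A \<le> s"
  unfolding hausdorff_dim_def using assms by (intro cInf_lower) (auto intro: bdd_belowI[of _ 0])

lemma hausdorff_dim_ge:
  assumes "A \<subseteq> {0..<1}" "\<And>s. 0 \<le> s \<Longrightarrow> s < d \<Longrightarrow> hausdorff_measure s A \<noteq> 0"
  shows "d \<le> hausdorff_dim A"
proof -
  have "2 \<in> {s. 0 \<le> s \<and> hausdorff_measure s A = 0}"
    using hausdorff_measure_2_unit[OF assms(1)] by simp
  then show ?thesis
    unfolding hausdorff_dim_def
  proof (intro cInf_greatest)
    fix s
    assume "s \<in> {s. 0 \<le> s \<and> hausdorff_measure s A = 0}"
    then show "d \<le> s"
      using assms(2)[of s] by force
  qed blast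
qed

lemma hausdorff_dim_nonneg: "A \<subseteq> {0..<1} \<Longrightarrow> 0 \<le> hausdorff_dim A"
  by (rule hausdorff_dim_ge) auto

lemma sets_cf_measure: "sets (cf_measure p) = sets (restrict_space borel {0..<1})"
  by (simp add: cf_measure_def)

lemma sets_cf_measure_subset: "B \<in> sets (cf_measure p) \<Longrightarrow> B \<subseteq> {0..<1}"
  by (auto simp: sets_cf_measure sets_restrict_space)

lemma measure_dim_le:
  assumes "B \<in> sets (cf_measure p)" "emeasure (cf_measure p) B = 1"
  shows "measure_dim (cf_measure p) \<le> hausdorff_dim B"
  unfolding measure_dim_def using assms sets_cf_measure_subset
  by (intro cINF_lower bdd_belowI2[of _ 0] hausdorff_dim_nonneg) auto

context bernoulli
begin

lemma measure_dim_ge: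
  assumes "\<And>B. B \<in> sets (cf_measure p) \<Longrightarrow> emeasure (cf_measure p) B = 1 \<Longrightarrow> d \<le> hausdorff_dim B"
  shows "d \<le> measure_dim (cf_measure p)"
  unfolding measure_dim_def
proof (rule cINF_greatest)
  have "space (cf_measure p) \<in> {B \<in> sets (cf_measure p). emeasure (cf_measure p) B = 1}"
    using prob_space.emeasure_space_1[OF prob_space_cf_measure] by simp
  then show "{B \<in> sets (cf_measure p). emeasure (cf_measure p) B = 1} \<noteq> {}"
    by blast
qed (use assms in auto)

section \<open>Cylinders and their indexing by finite words\<close>

lemma emeasure_weight_singleton:
  assumes "1 \<le> k"
  shows "emeasure W {k} = ennreal (p k)"
proof -
  have "emeasure W {k} = (\<integral>\<^sup>+j. ennreal (p j) * indicator {k} j \<partial>CN)"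
    unfolding weight_measure_def using assms by (intro emeasure_density) auto
  also have "\<dots> = ennreal (p k) * emeasure CN {k}"
    using assms by (intro nn_integral_indicator_singleton) auto
  finally show ?thesis
    using assms by simp
qed

definition cylinder :: "(nat \<Rightarrow> nat) \<Rightarrow> nat \<Rightarrow> (nat \<Rightarrow> nat) set" where
  "cylinder w n = {x \<in> space \<nu>. \<forall>i\<in>{1..<1 + n}. x i = w i}"

lemma emeasure_cylinder:
  assumes w: "pos_digits w 1 n"
  shows "emeasure \<nu> (cylinder w n) = ennreal (word_prob w 1 n)"
proof -
  have w1: "1 \<le> w i" if "i \<in> {1..<1 + n}" for i
    using w that by (simp add: pos_digits_def)
  have "cylinder w n = {x \<in> space (PiM {1..} (\<lambda>_. W)). \<forall>i\<in>{1..<1 + n}. x i \<in> {w i}}"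
    by (simp add: cylinder_def bernoulli_measure_def)
  then have "emeasure \<nu> (cylinder w n) = (\<Prod>i\<in>{1..<1 + n}. emeasure W {w i})"
    unfolding bernoulli_measure_def using w1
    by (simp only:) (rule PP.emeasure_PiM_Collect, auto simp: sets_weight)
  also have "\<dots> = (\<Prod>i\<in>{1..<1 + n}. ennreal (p (w i)))"
    using w1 by (intro prod.cong refl emeasure_weight_singleton)
  also have "\<dots> = ennreal (word_prob w 1 n)"
    unfolding word_prob_def using w1 p_nonneg by (intro prod_ennreal) auto
  finally show ?thesis .
qed

lemma cylinder_measurable [measurable]: "cylinder w n \<in> sets \<nu>"
proof -
  have "cylinder w n = {x \<in> space \<nu>. \<forall>i\<in>{1..<1 + n}. (\<lambda>j. j = w i) (x i)}"
    by (simp add: cylinder_def)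
  also have "\<dots> \<in> sets \<nu>"
    by (intro sets.sets_Collect_finite_All coord_set_measurable) auto
  finally show ?thesis .
qed

text \<open>Words are lists so that all cylinders can be enumerated by \<open>list_decode\<close>;
  the offset converts list positions from 0 to digit positions from 1.\<close>

definition word_fun :: "nat list \<Rightarrow> nat \<Rightarrow> nat" where
  "word_fun w i = w ! (i - 1)"

lemma pos_digits_word_fun: "set w \<subseteq> {1..} \<Longrightarrow> pos_digits (word_fun w) 1 (length w)"
  by (auto simp: pos_digits_def word_fun_def subset_iff)

lemma word_fun_map: "i \<in> {1..<1 + n} \<Longrightarrow> word_fun (map x [1..<1 + n]) i = x i"
  by (auto simp: word_fun_def nth_map_upt simp del: upt_Suc)

text \<open>Distinct words of equal length have disjoint cylinders.\<close>

lemma sum_word_prob_le_1: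
  "(\<integral>\<^sup>+w. ennreal (word_prob (word_fun w) 1 n) \<partial>count_space {w. length w = n \<and> set w \<subseteq> {1..}}) \<le> 1"
proof -
  define L where "L = {w :: nat list. length w = n \<and> set w \<subseteq> {1..}}"
  have disj: "disjoint_family_on (\<lambda>w. cylinder (word_fun w) n) L"
    unfolding disjoint_family_on_def
  proof (intro ballI impI)
    fix v w
    assume vw: "v \<in> L" "w \<in> L" "v \<noteq> w"
    then obtain j where j: "j < n" "v ! j \<noteq> w ! j"
      unfolding L_def by (auto simp: list_eq_iff_nth_eq)
    have "x (Suc j) = v ! j" if "x \<in> cylinder (word_fun v) n" for x
      using that j by (auto simp: cylinder_def word_fun_def)
    moreover have "x (Suc j) = w ! j" if "x \<in> cylinder (word_fun w) n" for x
      using that j by (auto simp: cylinder_def word_fun_def)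
    ultimately show "cylinder (word_fun v) n \<inter> cylinder (word_fun w) n = {}"
      using j by force
  qed
  have "(\<integral>\<^sup>+w. ennreal (word_prob (word_fun w) 1 n) \<partial>count_space L)
      = (\<integral>\<^sup>+w. emeasure \<nu> (cylinder (word_fun w) n) \<partial>count_space L)"
    using pos_digits_word_fun by (intro nn_integral_cong) (auto simp: L_def emeasure_cylinder)
  also have "\<dots> = emeasure \<nu> (\<Union>w\<in>L. cylinder (word_fun w) n)"
    by (intro emeasure_UN_countable[symmetric] disj) auto
  also have "\<dots> \<le> 1"
    by (rule emeasure_le_1)
  finally show ?thesis
    by (simp add: L_def)
qed

section \<open>The upper bound for the dimension\<close>

text \<open>A good word of N blocks has gauge at most a constant times \<theta>^N times its
  probability. The probabilities of the words of one length add up to at most 1, so covering by all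
  good words of at least N0 blocks costs a geometric remainder.\<close>

lemma measure_dim_le_if_opt_dim_less:
  assumes s: "opt_dim < s"
  shows "measure_dim (cf_measure p) \<le> s"
proof -
  have s0: "0 < s"
    using opt_dim_gt_half s by simp
  obtain m \<theta> where m: "1 \<le> m" and \<theta>: "0 < \<theta>" "\<theta> < 1"
    and decay: "AE x in \<nu>. \<forall>\<^sub>F N in sequentially. cover_ratio s x (N * m) \<le> \<theta> ^ N"
    using cover_ratio_decay[OF s] by blast
  define Q where "Q w = cf_den (word_fun w) 1 (length w) 0" for w
  \<comment> \<open>By \<open>cf_convergent_approx\<close> this ball about the convergent contains
    every point whose expansion starts with the word.\<close>
  define J where "J w = cball (cf_convergent (word_fun w) 1 (length w)) (1 / (Q w)\<^sup>2) \<inter> {0..<1}" for w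
  \<comment> \<open>The condition is cover ratio \<le> \<theta>^N for a word of N blocks, with the
    division by the word probability cleared.\<close>
  define G where "G = {w. set w \<subseteq> {1..} \<and> m dvd length w \<and>
    Q w powr - (2 * s) \<le> \<theta> ^ (length w div m) * word_prob (word_fun w) 1 (length w)}"
  define H where "H N0 w = (if w \<in> G \<and> N0 * m \<le> length w then J w else {})" for N0 w
  define U where "U N0 i = H N0 (list_decode i)" for N0 i
  \<comment> \<open>A limsup set: almost every point has arbitrarily long good prefixes, and each
    \<open>U N0\<close> covers it.\<close>
  define B where "B = (\<Inter>N0. \<Union>i. U N0 i)"
  have Q_ge: "1 \<le> Q w" if "set w \<subseteq> {1..}" for w
    unfolding Q_def by (intro cf_den_ge_1 pos_digits_word_fun that) simp
  have J_sets: "J w \<in> sets (restrict_space borel {0..<1})" for w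
    unfolding J_def sets_restrict_space
    by (rule image_eqI[where x = "cball (cf_convergent (word_fun w) 1 (length w)) (1 / (Q w)\<^sup>2)"]) auto
  have U_sets: "U N0 i \<in> sets (restrict_space borel {0..<1})" for N0 i
    using J_sets by (simp add: U_def H_def)
  have B_sets: "B \<in> sets (cf_measure p)"
    unfolding sets_cf_measure B_def using U_sets
    by (intro sets.countable_INT image_subsetI sets.countable_UN) auto
  have "AE x in \<nu>. cf_map x \<in> B"
    using decay AE_digit_weights_pos AE_space
  proof eventually_elim
    case (elim x)
    have d: "digits x"
      using elim(3) by (rule digits_bernoulli)
    have unit: "cf_map x \<in> {0..<1}"
      using measurable_space[OF cf_map_measurable elim(3)] by (simp add: space_restrict_space)
    from elim(1) obtain N1 where N1: "\<And>N. N1 \<le> N \<Longrightarrow> cover_ratio s x (N * m) \<le> \<theta> ^ N"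
      by (auto simp: eventually_sequentially)
    have "\<exists>i. cf_map x \<in> U N0 i" for N0
    proof -
      define N where "N = max N0 N1"
      define n where "n = N * m"
      define w where "w = map x [1..<1 + n]"
      have len: "length w = n"
        by (simp add: w_def)
      have eq: "word_fun w i = x i" if "i \<in> {1..<1 + n}" for i
        unfolding w_def by (rule word_fun_map[OF that])
      have Qx: "Q w = cf_den x 1 n 0"
        unfolding Q_def len by (intro cf_den_cong eq)
      have px: "word_prob (word_fun w) 1 n = word_prob x 1 n"
        by (intro word_prob_cong eq)
      have cx: "cf_convergent (word_fun w) 1 n = cf_convergent x 1 n"
        unfolding cf_convergent_eq_branch by (intro cf_branch_cong eq)
      have sw: "set w \<subseteq> {1..}"
        using d by (auto simp: w_def digits_def)
      have pos: "0 < word_prob x 1 n"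
        using elim(2) by (intro word_prob_pos) auto
      have "cover_ratio s x n \<le> \<theta> ^ N"
        unfolding n_def by (rule N1) (simp add: N_def)
      then have "Q w powr - (2 * s) \<le> \<theta> ^ N * word_prob x 1 n"
        using pos Q_ge[OF sw] by (simp add: cover_ratio_def Qx divide_le_eq)
      moreover have "n div m = N"
        using m by (simp add: n_def)
      ultimately have "w \<in> G"
        using sw unfolding G_def mem_Collect_eq len px by (simp add: n_def)
      moreover have "N0 * m \<le> length w"
        unfolding len n_def N_def by (intro mult_le_mono) auto
      moreover have "cf_map x \<in> J w"
        using cf_convergent_approx[OF d order_refl, of n] unit
        unfolding J_def len cx Qx cf_map_eq_tail by (simp add: dist_real_def)
      ultimately have "cf_map x \<in> U N0 (list_encode w)"
        by (simp add: U_def H_def)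
      then show ?thesis ..
    qed
    then show ?case
      by (auto simp: B_def)
  qed
  then have "emeasure \<nu> (cf_map -` B \<inter> space \<nu>) = 1"
    using measurable_sets[OF cf_map_measurable B_sets[unfolded sets_cf_measure]]
    by (subst emeasure_eq_1_AE) (auto elim: eventually_mono)
  then have B1: "emeasure (cf_measure p) B = 1"
    using emeasure_cf_measure[OF B_sets] by simp
  define c where "c = 2 powr s"
  have J_diam: "bounded (J w)" "diameter (J w) \<le> 2 / (Q w)\<^sup>2" for w
  proof -
    show "bounded (J w)"
      unfolding J_def by (intro bounded_Int) simp
    have "diameter (J w) \<le> diameter (cball (cf_convergent (word_fun w) 1 (length w)) (1 / (Q w)\<^sup>2))"
      unfolding J_def by (intro diameter_subset) auto
    then show "diameter (J w) \<le> 2 / (Q w)\<^sup>2"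
      by simp
  qed
  have gauge_J: "hausdorff_gauge s (J w) \<le> c * \<theta> ^ (length w div m) * word_prob (word_fun w) 1 (length w)"
    if "w \<in> G" for w
  proof (cases "J w = {}")
    case True
    then show ?thesis
      using that \<theta> p_nonneg by (auto simp: hausdorff_gauge_def c_def word_prob_def G_def word_fun_def subset_iff
          intro!: mult_nonneg_nonneg prod_nonneg)
  next
    case False
    have Q1: "1 \<le> Q w"
      using that by (intro Q_ge) (simp add: G_def)
    have "hausdorff_gauge s (J w) = diameter (J w) powr s"
      using False s0 by (simp add: hausdorff_gauge_def)
    also have "\<dots> \<le> (2 / (Q w)\<^sup>2) powr s"
      using J_diam s0 by (intro powr_mono2) (auto simp: diameter_ge_0)
    also have "\<dots> = c * Q w powr - (2 * s)"
      using Q1 by (simp add: c_def powr_divide powr_minus_divide powr_powr[symmetric] powr_numeral)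
    also have "\<dots> \<le> c * (\<theta> ^ (length w div m) * word_prob (word_fun w) 1 (length w))"
      using that by (intro mult_left_mono) (auto simp: G_def c_def)
    finally show ?thesis
      by (simp add: mult.assoc)
  qed
  have total: "(\<Sum>i. ennreal (hausdorff_gauge s (U N0 i))) \<le> ennreal (c * \<theta> ^ N0 / (1 - \<theta>))" for N0
  proof -
    \<comment> \<open>A word of N blocks contributes only to the class M with N = N0 + M, so the sum
      over the cover can be rearranged by word length.\<close>
    define L where "L M = {w :: nat list. length w = (N0 + M) * m \<and> set w \<subseteq> {1..}}" for M
    define h where "h M w = ennreal (c * \<theta> ^ (N0 + M)) *
      (ennreal (word_prob (word_fun w) 1 ((N0 + M) * m)) * indicator (L M) w)" for M w
    have le: "ennreal (hausdorff_gauge s (H N0 w)) \<le> (\<Sum>M. h M w)" for w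
    proof (cases "w \<in> G \<and> N0 * m \<le> length w")
      case True
      then obtain N where N: "length w = N * m"
        unfolding G_def by (metis (no_types, lifting) dvd_def mem_Collect_eq mult.commute)
      have "N0 \<le> N"
        using True N m by auto
      then obtain M where M: "N = N0 + M"
        using le_Suc_ex by blast
      have "w \<in> L M"
        using True N M by (simp add: L_def G_def)
      then have "ennreal (hausdorff_gauge s (H N0 w)) \<le> h M w"
        using True gauge_J[of w] N M m \<theta>
        by (simp add: H_def h_def c_def ennreal_leI flip: ennreal_mult')
      also have "\<dots> \<le> (\<Sum>M. h M w)"
        using sum_le_suminf[of "\<lambda>M. h M w" "{M}"] by simp
      finally show ?thesis .
    qed (auto simp: H_def hausdorff_gauge_def)
    have "(\<Sum>i. ennreal (hausdorff_gauge s (U N0 i)))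
        = (\<integral>\<^sup>+i. ennreal (hausdorff_gauge s (H N0 (list_decode i))) \<partial>count_space UNIV)"
      by (simp add: nn_integral_count_space_nat U_def)
    also have "\<dots> = (\<integral>\<^sup>+w. ennreal (hausdorff_gauge s (H N0 w)) \<partial>count_space UNIV)"
      by (rule nn_integral_bij_count_space) (rule bij_list_decode)
    also have "\<dots> \<le> (\<integral>\<^sup>+w. (\<Sum>M. h M w) \<partial>count_space UNIV)"
      by (intro nn_integral_mono le)
    also have "\<dots> = (\<Sum>M. \<integral>\<^sup>+w. h M w \<partial>count_space UNIV)"
      by (intro nn_integral_suminf) simp
    also have "\<dots> \<le> (\<Sum>M. ennreal (c * \<theta> ^ (N0 + M)))"
    proof (intro suminf_le summableI)
      fix M
      have "(\<integral>\<^sup>+w. h M w \<partial>count_space UNIV) = ennreal (c * \<theta> ^ (N0 + M)) *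
          (\<integral>\<^sup>+w. ennreal (word_prob (word_fun w) 1 ((N0 + M) * m)) * indicator (L M) w \<partial>count_space UNIV)"
        unfolding h_def by (rule nn_integral_cmult) simp
      also have "(\<integral>\<^sup>+w. ennreal (word_prob (word_fun w) 1 ((N0 + M) * m)) * indicator (L M) w \<partial>count_space UNIV)
          = (\<integral>\<^sup>+w. ennreal (word_prob (word_fun w) 1 ((N0 + M) * m)) \<partial>count_space (L M))"
        by (simp add: nn_integral_count_space_indicator)
      also have "ennreal (c * \<theta> ^ (N0 + M)) * \<dots> \<le> ennreal (c * \<theta> ^ (N0 + M)) * 1"
        unfolding L_def by (intro mult_left_mono sum_word_prob_le_1) simp
      finally show "(\<integral>\<^sup>+w. h M w \<partial>count_space UNIV) \<le> ennreal (c * \<theta> ^ (N0 + M))"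
        by simp
    qed
    also have "\<dots> = ennreal (c * \<theta> ^ N0 / (1 - \<theta>))"
    proof (rule suminf_ennreal_eq)
      have "(\<lambda>M. \<theta> ^ M) sums (1 / (1 - \<theta>))"
        using \<theta> by (intro geometric_sums) auto
      from sums_mult[OF this, of "c * \<theta> ^ N0"]
      show "(\<lambda>M. c * \<theta> ^ (N0 + M)) sums (c * \<theta> ^ N0 / (1 - \<theta>))"
        by (simp add: power_add mult.assoc)
    qed (use \<theta> in \<open>simp add: c_def\<close>)
    finally show ?thesis .
  qed
  have "hausdorff_measure s B = 0"
  proof (rule hausdorff_measure_zeroI)
    fix \<delta> \<epsilon> :: real
    assume \<delta>: "0 < \<delta>" and \<epsilon>: "0 < \<epsilon>"
    have "(\<lambda>N0. c * \<theta> ^ N0 / (1 - \<theta>)) \<longlonglongrightarrow> c * 0 / (1 - \<theta>)"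
      using \<theta> by (intro tendsto_intros LIMSEQ_realpow_zero) auto
    then have "\<forall>\<^sub>F N0 in sequentially. c * \<theta> ^ N0 / (1 - \<theta>) < \<epsilon>"
      using \<epsilon> by (intro order_tendstoD(2)) auto
    then obtain N1 where N1: "\<And>N0. N1 \<le> N0 \<Longrightarrow> c * \<theta> ^ N0 / (1 - \<theta>) < \<epsilon>"
      by (auto simp: eventually_sequentially)
    obtain j where j: "(1 / 2 :: real) ^ j < \<delta> / 2"
      using real_arch_pow_inv[of "\<delta> / 2" "1 / 2"] \<delta> by auto
    \<comment> \<open>N1 controls the gauge sum, while words with at least 2 j digits have
      denominators of at least 2^j and hence diameters of at most \<delta>.\<close>
    define N0 where "N0 = max N1 (2 * j)"
    have diam: "diameter (H N0 w) \<le> \<delta>" for w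
    proof (cases "w \<in> G \<and> N0 * m \<le> length w")
      case True
      then have sw: "set w \<subseteq> {1..}"
        by (simp add: G_def)
      have "2 * j * 1 \<le> N0 * m"
        using m by (intro mult_le_mono) (auto simp: N0_def)
      then have "j \<le> length w div 2"
        using True by linarith
      then have "(2::real) ^ j \<le> 2 ^ (length w div 2)"
        by (intro power_increasing) auto
      also have "\<dots> \<le> Q w"
        unfolding Q_def by (intro power2_le_cf_den pos_digits_word_fun sw) simp
      also have "\<dots> \<le> (Q w)\<^sup>2"
        using Q_ge[OF sw] by (simp add: power2_eq_square)
      finally have "2 / (Q w)\<^sup>2 \<le> 2 / 2 ^ j"
        by (intro frac_le) auto
      also have "\<dots> \<le> \<delta>"
        using j by (simp add: power_one_over)
      finally show ?thesis
        using True J_diam(2)[of w] by (simp add: H_def)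
    qed (use \<delta> in \<open>auto simp: H_def\<close>)
    show "\<exists>U. B \<subseteq> (\<Union>i. U i) \<and> (\<forall>i::nat. bounded (U i) \<and> diameter (U i) \<le> \<delta>) \<and>
        (\<Sum>i. ennreal (hausdorff_gauge s (U i))) \<le> ennreal \<epsilon>"
    proof (intro exI[of _ "U N0"] conjI allI)
      show "B \<subseteq> (\<Union>i. U N0 i)"
        by (auto simp: B_def)
      show "bounded (U N0 i)" "diameter (U N0 i) \<le> \<delta>" for i
        using diam J_diam by (auto simp: U_def H_def)
      have "c * \<theta> ^ N0 / (1 - \<theta>) \<le> \<epsilon>"
        using N1[of N0] by (simp add: N0_def)
      then show "(\<Sum>i. ennreal (hausdorff_gauge s (U N0 i))) \<le> ennreal \<epsilon>"
        by (rule order_trans[OF total ennreal_leI])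
    qed
  qed
  then have "hausdorff_dim B \<le> s"
    using s0 by (intro hausdorff_dim_le) auto
  then show ?thesis
    using measure_dim_le[OF B_sets B1] by simp
qed

lemma measure_dim_le_opt_dim: "measure_dim (cf_measure p) \<le> opt_dim"
  by (rule dense_ge) (rule measure_dim_le_if_opt_dim_less)

end

section \<open>The lower bound for the dimension\<close>

lemma eventually_le_imp_bounded:
  fixes f :: "nat \<Rightarrow> real"
  assumes "\<forall>\<^sub>F n in sequentially. f n \<le> c"
  shows "\<exists>K::nat. \<forall>n. f n \<le> real K"
proof -
  obtain N where N: "\<And>n. N \<le> n \<Longrightarrow> f n \<le> c"
    using assms by (auto simp: eventually_sequentially)
  obtain K :: nat where K: "\<bar>c\<bar> + (\<Sum>i<N. \<bar>f i\<bar>) \<le> real K"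
    using real_arch_simple by blast
  have "f n \<le> real K" for n
  proof (cases "n < N")
    case True
    then have "\<bar>f n\<bar> \<le> (\<Sum>i<N. \<bar>f i\<bar>)"
      by (intro member_le_sum) auto
    then show ?thesis
      using K by linarith
  next
    case False
    moreover have "0 \<le> (\<Sum>i<N. \<bar>f i\<bar>)"
      by (intro sum_nonneg) simp
    ultimately show ?thesis
      using N[of n] K by linarith
  qed
  then show ?thesis
    by blast
qed

locale optimal_bernoulli = bernoulli +
  fixes c :: real
  assumes log_vector: "p \<in> log_vectors"
    and optimal: "weight_entropy p = opt_dim * lyapunov p"
    and weight_bound: "\<And>k. 1 \<le> k \<Longrightarrow> p k \<le> c / real k powr (2 * opt_dim)"
    and c_pos: "0 < c"
begin

text \<open>Up to constants the measure of a cylinder divided by the s-th power of its length.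
  Length 0 is set to 1 because a leading factor 4 powr s would violate the normalisation of
  \<open>submult_functional\<close>.\<close>

definition mass_ratio :: "real \<Rightarrow> (nat \<Rightarrow> nat) \<Rightarrow> nat \<Rightarrow> real" where
  "mass_ratio s x n = (if n = 0 then 1 else 4 powr s * \<bar>cf_den x 1 n 0\<bar> powr (2 * s) * \<bar>word_prob x 1 n\<bar>)"

text \<open>The factor \<open>4 powr s\<close> absorbs the constant in \<open>cf_den_quasi_mult\<close>.\<close>

lemma submult_mass_ratio:
  assumes s: "0 \<le> s"
  shows "submult_functional (mass_ratio s)"
  unfolding submult_functional_def
proof (intro conjI allI ballI impI)
  show "(\<lambda>x. mass_ratio s x n) \<in> borel_measurable \<nu>" for n
    unfolding mass_ratio_def by (cases "n = 0"; simp)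
  show "0 \<le> mass_ratio s x n" for x n
    by (simp add: mass_ratio_def)
  show "mass_ratio s x n = mass_ratio s y n" if "\<forall>i\<in>{1..n}. x i = y i" for x y n
    using that cf_den_cong[of 1 n x y] word_prob_cong[of 1 n x y] by (simp add: mass_ratio_def)
  show "mass_ratio s x 0 \<le> 1" for x
    by (simp add: mass_ratio_def)
  fix x n k
  assume x: "x \<in> space \<nu>"
  show "mass_ratio s x (n + k) \<le> mass_ratio s x n * mass_ratio s (shift n x) k"
  proof (cases "n = 0 \<or> k = 0")
    case True
    have "mass_ratio s (shift 0 x) k = mass_ratio s x k"
      by (simp add: mass_ratio_def cf_den_shift_n word_prob_shift)
    then show ?thesis
      using True by (auto simp: mass_ratio_def)
  next
    case False
    define a b d where "a = cf_den x 1 n 0" and "b = cf_den x (1 + n) k 0" and "d = cf_den x 1 (n + k) 0"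
    have ge: "1 \<le> a" "1 \<le> b" "1 \<le> d"
      unfolding a_def b_def d_def using psi_pos_digits[OF x] by (auto intro!: cf_den_ge_1)
    have "d powr (2 * s) \<le> (2 * (a * b)) powr (2 * s)"
      using cf_den_quasi_mult(2)[OF psi_pos_digits[OF x], of 1 n k] ge s
      by (intro powr_mono2) (auto simp: a_def b_def d_def)
    also have "\<dots> = 4 powr s * a powr (2 * s) * b powr (2 * s)"
      using ge by (simp add: powr_mult powr_powr[symmetric] powr_numeral)
    finally have "4 powr s * \<bar>d\<bar> powr (2 * s) * (\<bar>word_prob x 1 n\<bar> * \<bar>word_prob x (1 + n) k\<bar>)
        \<le> 4 powr s * (4 powr s * a powr (2 * s) * b powr (2 * s)) * (\<bar>word_prob x 1 n\<bar> * \<bar>word_prob x (1 + n) k\<bar>)"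
      using ge by (intro mult_right_mono mult_left_mono) auto
    then show ?thesis
      using False ge unfolding mass_ratio_def a_def b_def d_def
      by (simp add: cf_den_shift_n word_prob_shift word_prob_add abs_mult mult_ac)
  qed
qed

text \<open>The upper bound for the weights cancels the digit powers from the denominator: k^(2s)
  times the weight of k is at most c for s \<le> \<open>opt_dim\<close>. Boundedness on each fixed
  block length supplies the exponential moment for Chernoff's bound.\<close>

lemma mass_ratio_bounded:
  assumes s: "0 \<le> s" "s \<le> opt_dim" and x: "x \<in> space \<nu>"
  shows "mass_ratio s x n \<le> 1 + 4 powr s * (c * 4 powr s) ^ n"
proof (cases "n = 0")
  case False
  have p: "pos_digits x 1 n"
    by (rule psi_pos_digits[OF x]) simp
  have x1: "1 \<le> x i" if "i \<in> {1..<1 + n}" for i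
    using p that by (simp add: pos_digits_def)
  have Q1: "1 \<le> cf_den x 1 n 0"
    by (intro cf_den_ge_1 p) simp
  have wp: "0 \<le> word_prob x 1 n"
    unfolding word_prob_def using x1 p_nonneg by (intro prod_nonneg) auto
  have "cf_den x 1 n 0 powr (2 * s) \<le> (\<Prod>i\<in>{1..<1 + n}. 2 * real (x i)) powr (2 * s)"
    using cf_den_le_prod[OF p, of 0] Q1 s by (intro powr_mono2) auto
  also have "\<dots> = (\<Prod>i\<in>{1..<1 + n}. (2 * real (x i)) powr (2 * s))"
    by (rule prod_powr_distrib)
  finally have "cf_den x 1 n 0 powr (2 * s) * word_prob x 1 n
      \<le> (\<Prod>i\<in>{1..<1 + n}. (2 * real (x i)) powr (2 * s)) * word_prob x 1 n"
    using wp by (intro mult_right_mono)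
  also have "\<dots> = (\<Prod>i\<in>{1..<1 + n}. (2 * real (x i)) powr (2 * s) * p (x i))"
    by (simp add: word_prob_def prod.distrib del: prod.op_ivl_Suc)
  also have "\<dots> \<le> (\<Prod>i\<in>{1..<1 + n}. c * 4 powr s)"
  proof (rule prod_mono)
    fix i
    assume i: "i \<in> {1..<1 + n}"
    define k where "k = x i"
    have k: "1 \<le> k"
      using x1[OF i] by (simp add: k_def)
    have "real k powr (2 * s) \<le> real k powr (2 * opt_dim)"
      using k s by (intro powr_mono) auto
    then have *: "real k powr (2 * s) / real k powr (2 * opt_dim) \<le> 1"
      using k by (simp add: divide_le_eq)
    have "(2 * real k) powr (2 * s) * p k \<le> (4 powr s * real k powr (2 * s)) * (c / real k powr (2 * opt_dim))"
    proof -
      have "(2 * real k) powr (2 * s) = 4 powr s * real k powr (2 * s)"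
        using powr_powr[of 2 2 s] by (simp add: powr_mult)
      then show ?thesis
        using weight_bound[OF k] by (intro mult_mono) (auto simp: p_nonneg[OF k])
    qed
    also have "\<dots> = c * 4 powr s * (real k powr (2 * s) / real k powr (2 * opt_dim))"
      by simp
    also have "\<dots> \<le> c * 4 powr s * 1"
      using * c_pos by (intro mult_left_mono) auto
    finally show "0 \<le> (2 * real (x i)) powr (2 * s) * p (x i) \<and> (2 * real (x i)) powr (2 * s) * p (x i) \<le> c * 4 powr s"
      using p_nonneg[OF k] by (simp add: k_def)
  qed
  also have "\<dots> = (c * 4 powr s) ^ n"
    by simp
  finally have "4 powr s * (cf_den x 1 n 0 powr (2 * s) * word_prob x 1 n) \<le> 4 powr s * (c * 4 powr s) ^ n"
    by (intro mult_left_mono) auto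
  moreover have "mass_ratio s x n = 4 powr s * (cf_den x 1 n 0 powr (2 * s) * word_prob x 1 n)"
    using False Q1 wp by (simp add: mass_ratio_def mult.assoc)
  ultimately show ?thesis
    by linarith
qed (use c_pos in \<open>simp add: mass_ratio_def\<close>)

text \<open>The block argument of \<open>cover_moment_finite_log\<close> with the sign reversed. The
  drift now needs entropy to be large, which is where the equality for the maximiser enters, and the
  error 2 s ln 2 is the logarithm of the factor 4 powr s.\<close>

lemma mass_ratio_decay:
  assumes s: "0 < s" "s < opt_dim"
  shows "\<exists>m\<ge>1. AE x in \<nu>. \<forall>\<^sub>F N in sequentially. mass_ratio s x (N * m) \<le> 1"
proof -
  have fl: "finite_log_moment p"
    using log_vector by (simp add: log_vectors_def)
  define d where "d = (opt_dim - s) * lyapunov p"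
  have d: "0 < d"
    using s lyapunov_pos[OF log_vector] by (simp add: d_def)
  obtain m :: nat where m: "2 * s * ln 2 / d < real m"
    using reals_Archimedean2 by blast
  have "0 < 2 * s * ln 2 / d"
    using s d by simp
  then have m1: "1 \<le> m"
    using m by (cases m) auto
  define Y where "Y x = 2 * s * ln (cf_den x 1 m 0) - (- ln (word_prob x 1 m)) + 2 * s * ln 2" for x
  have int: "integrable \<nu> Y"
    unfolding Y_def[abs_def]
    by (intro Bochner_Integration.integrable_add Bochner_Integration.integrable_diff neg_ln_word_prob_integral(1)
        fl integrable_mult_right log_den_integral(1)) simp
  have "integral\<^sup>L \<nu> Y = s * (2 * (\<integral>x. ln (cf_den x 1 m 0) \<partial>\<nu>)) - real m * weight_entropy p + 2 * s * ln 2"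
    unfolding Y_def[abs_def] using neg_ln_word_prob_integral[OF fl, of m] log_den_integral(1)[OF fl, of m]
    by (simp add: prob_space)
  also have "\<dots> \<le> s * (real m * lyapunov p) - real m * (opt_dim * lyapunov p) + 2 * s * ln 2"
    using log_den_integral(2)[OF fl, of m] optimal s
    by (intro add_mono diff_mono mult_left_mono) auto
  also have "\<dots> = 2 * s * ln 2 - real m * d"
    by (simp add: d_def algebra_simps)
  also have "\<dots> < 0"
    using m d by (simp add: divide_less_eq)
  finally have neg: "integral\<^sup>L \<nu> Y < 0" .
  have eq: "AE x in \<nu>. mass_ratio s x m powr t = exp (t * Y x)" for t
    using AE_digit_weights_pos AE_space
  proof eventually_elim
    case (elim x)
    have "1 \<le> cf_den x 1 m 0" "0 < word_prob x 1 m"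
      using cf_den_ge_1[OF psi_pos_digits[OF elim(2)]] word_prob_pos[OF elim(1)] by auto
    moreover have "ln 4 = 2 * ln (2::real)"
      using ln_realpow[of "2::real" 2] by simp
    ultimately show ?case
      using m1 by (simp add: mass_ratio_def Y_def powr_def ln_mult algebra_simps)
  qed
  define C where "C = 1 + 4 powr s * (c * 4 powr s) ^ m"
  have ebound: "AE x in \<nu>. norm (exp (Y x)) \<le> C"
    using eq[of 1] AE_space
  proof eventually_elim
    case (elim x)
    have "0 \<le> mass_ratio s x m"
      by (simp add: mass_ratio_def)
    then have "exp (Y x) = mass_ratio s x m"
      using elim(1) by (simp add: powr_one)
    then show ?case
      using mass_ratio_bounded[OF _ _ elim(2), of s m] s \<open>0 \<le> mass_ratio s x m\<close> by (simp add: C_def)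
  qed
  have "integrable \<nu> (\<lambda>x. exp (Y x))"
    using int by (intro integrable_const_bound[OF ebound]) simp
  from exp_moment_less_1[OF int neg this] obtain t
    where t: "0 < t" "(\<integral>\<^sup>+x. ennreal (exp (t * Y x)) \<partial>\<nu>) < 1"
    by blast
  have "(\<integral>\<^sup>+x. ennreal (mass_ratio s x m powr t) \<partial>\<nu>) = (\<integral>\<^sup>+x. ennreal (exp (t * Y x)) \<partial>\<nu>)"
    using eq[of t] by (intro nn_integral_cong_AE) (auto elim: eventually_mono)
  then have "(\<integral>\<^sup>+x. ennreal (mass_ratio s x m powr t) \<partial>\<nu>) < 1"
    using t by simp
  from submult_decay[OF submult_mass_ratio t(1) this] s
  obtain \<theta> where \<theta>: "0 < \<theta>" "\<theta> < 1"
    and ae: "AE x in \<nu>. \<forall>\<^sub>F N in sequentially. mass_ratio s x (N * m) \<le> \<theta> ^ N"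
    by auto
  have "AE x in \<nu>. \<forall>\<^sub>F N in sequentially. mass_ratio s x (N * m) \<le> 1"
    using ae
  proof eventually_elim
    case (elim x)
    then show ?case
    proof eventually_elim
      case (elim N)
      have "\<theta> ^ N \<le> 1"
        using \<theta> by (intro power_le_one) auto
      with elim show ?case
        by linarith
    qed
  qed
  then show ?thesis
    using m1 by blast
qed

section \<open>Regular points and mass distribution\<close>

lemma digit_growth:
  assumes e: "0 < e"
  shows "AE x in \<nu>. \<forall>\<^sub>F n in sequentially. real (x (Suc n)) \<le> exp (e * real n)"
proof -
  \<comment> \<open>With this order the moment is dominated by the series of
    k^(-(\<open>opt_dim\<close> + 1/2)), whose exponent is above 1 in absolute value.\<close>
  define u where "u = opt_dim - 1 / 2"
  have u: "0 < u"
    using opt_dim_gt_half by (simp add: u_def)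
  have "(\<integral>\<^sup>+k. ennreal (real k powr u) \<partial>W) \<le> (\<integral>\<^sup>+k. ennreal (c * real k powr - (opt_dim + 1 / 2)) \<partial>CN)"
    unfolding nn_integral_weight
  proof (intro nn_integral_mono)
    fix k
    assume "k \<in> space CN"
    then have k: "1 \<le> k"
      by simp
    have "p k * real k powr u \<le> c / real k powr (2 * opt_dim) * real k powr u"
      using weight_bound[OF k] by (intro mult_right_mono) auto
    also have "\<dots> = c * real k powr (u - 2 * opt_dim)"
      using k by (simp add: powr_diff)
    finally show "ennreal (p k) * ennreal (real k powr u) \<le> ennreal (c * real k powr - (opt_dim + 1 / 2))"
      using p_nonneg[OF k] by (simp add: u_def ennreal_leI algebra_simps flip: ennreal_mult)
  qed
  also have "\<dots> < \<infinity>"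
    using integrable_CN_powr[of "opt_dim + 1 / 2"] opt_dim_gt_half c_pos
    by (subst nn_integral_eq_integral) auto
  finally obtain M where M: "0 \<le> M" "(\<integral>\<^sup>+k. ennreal (real k powr u) \<partial>W) = ennreal M"
    by (cases "\<integral>\<^sup>+k. ennreal (real k powr u) \<partial>W") auto
  show ?thesis
  proof (rule AE_eventually_le_if_moment_bound[where X = "\<lambda>n x. real (x (Suc n))"])
    show "(\<lambda>x. real (x (Suc n))) \<in> borel_measurable \<nu>" for n
      by (rule measurable_coord_comp) simp
    show "(\<integral>\<^sup>+x. ennreal (real (x (Suc n)) powr u) \<partial>\<nu>) \<le> ennreal (M * 1 ^ n)" for n
      using nn_integral_coord[of "Suc n" "\<lambda>k. ennreal (real k powr u)"] M by simp
    show "exp (e * real n) powr u = exp (e * u) ^ n" for n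
      by (simp add: powr_def exp_of_nat_mult[symmetric] mult_ac)
  qed (use e u M in auto)
qed

text \<open>Points at which the almost sure estimates hold with one constant at all scales. Taking K
  in the natural numbers makes the exhaustion countable.\<close>

definition regular_set :: "real \<Rightarrow> nat \<Rightarrow> real \<Rightarrow> nat \<Rightarrow> (nat \<Rightarrow> nat) set" where
  "regular_set s m e K = {x \<in> space \<nu>.
     (\<forall>N. cf_den x 1 (N * m) 0 powr (2 * s) * word_prob x 1 (N * m) \<le> real K) \<and>
     (\<forall>n. real (x (Suc n)) \<le> real K * exp (e * real n))}"

lemma regular_set_measurable [measurable]: "regular_set s m e K \<in> sets \<nu>"
proof -
  have "{x \<in> space \<nu>. \<forall>n. real (x (Suc n)) \<le> real K * exp (e * real n)} \<in> sets \<nu>"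
    by (intro sets.sets_Collect_countable_All coord_set_measurable) simp
  moreover have "{x \<in> space \<nu>. \<forall>N. cf_den x 1 (N * m) 0 powr (2 * s) * word_prob x 1 (N * m) \<le> real K} \<in> sets \<nu>"
    by measurable
  moreover have "regular_set s m e K = {x \<in> space \<nu>. \<forall>N. cf_den x 1 (N * m) 0 powr (2 * s) * word_prob x 1 (N * m) \<le> real K}
      \<inter> {x \<in> space \<nu>. \<forall>n. real (x (Suc n)) \<le> real K * exp (e * real n)}"
    by (auto simp: regular_set_def)
  ultimately show ?thesis
    by auto
qed

text \<open>The block length is fixed before e because \<open>regular_set_mass\<close> chooses e in
  terms of m. Bounds that hold eventually become bounds at all indices once K is enlarged.\<close>

lemma regular_set_exhausts:
  assumes s: "0 < s" "s < opt_dim"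
  shows "\<exists>m\<ge>1. \<forall>e>0. AE x in \<nu>. \<exists>K\<ge>1. x \<in> regular_set s m e K"
proof -
  obtain m where m: "1 \<le> m" and ae: "AE x in \<nu>. \<forall>\<^sub>F N in sequentially. mass_ratio s x (N * m) \<le> 1"
    using mass_ratio_decay[OF s] by blast
  have "AE x in \<nu>. \<exists>K\<ge>1. x \<in> regular_set s m e K" if e: "0 < e" for e
    using ae digit_growth[OF e] AE_space
  proof eventually_elim
    case (elim x)
    obtain K1 where K1: "\<And>N. mass_ratio s x (N * m) \<le> real K1"
      using eventually_le_imp_bounded[OF elim(1)] by blast
    have "\<forall>\<^sub>F n in sequentially. real (x (Suc n)) / exp (e * real n) \<le> 1"
      using elim(2) by (rule eventually_mono) simp
    then obtain K2 :: nat where K2: "\<And>n. real (x (Suc n)) / exp (e * real n) \<le> real K2"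
      using eventually_le_imp_bounded[of "\<lambda>n. real (x (Suc n)) / exp (e * real n)" 1] by blast
    define K where "K = max 1 (max K1 K2)"
    have "cf_den x 1 (N * m) 0 powr (2 * s) * word_prob x 1 (N * m) \<le> real K" for N
    proof (cases "N = 0")
      case True
      then show ?thesis
        by (simp add: word_prob_def K_def)
    next
      case False
      define Z where "Z = cf_den x 1 (N * m) 0 powr (2 * s) * word_prob x 1 (N * m)"
      have 4: "1 \<le> 4 powr s"
        using s by (intro ge_one_powr_ge_zero) auto
      have "1 \<le> cf_den x 1 (N * m) 0"
        using psi_pos_digits[OF elim(3)] by (intro cf_den_ge_1) auto
      moreover have "0 \<le> word_prob x 1 (N * m)"
        unfolding word_prob_def
      proof (rule prod_nonneg)
        fix i
        assume "i \<in> {1..<1 + N * m}"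
        then show "0 \<le> p (x i)"
          using digits_bernoulli[OF elim(3)] by (intro p_nonneg) (simp add: digits_def)
      qed
      ultimately have "4 powr s * Z = mass_ratio s x (N * m)" "0 \<le> Z"
        using False m by (auto simp: mass_ratio_def Z_def mult.assoc)
      moreover have "1 * Z \<le> 4 powr s * Z"
        using 4 \<open>0 \<le> Z\<close> by (intro mult_right_mono) auto
      ultimately have "Z \<le> real K1"
        using K1[of N] by linarith
      then show ?thesis
        by (simp add: Z_def K_def)
    qed
    moreover have "real (x (Suc n)) \<le> real K * exp (e * real n)" for n
    proof -
      have "real (x (Suc n)) \<le> real K2 * exp (e * real n)"
        using K2[of n] by (simp add: divide_le_eq)
      also have "\<dots> \<le> real K * exp (e * real n)"
        by (intro mult_right_mono) (auto simp: K_def)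
      finally show ?thesis .
    qed
    ultimately have "x \<in> regular_set s m e K"
      using elim(3) by (simp add: regular_set_def)
    then show ?case
      by (intro exI[of _ K]) (auto simp: K_def)
  qed
  then show ?thesis
    using m by blast
qed

text \<open>The core of the mass distribution principle: the points of a regular set in \<open>U\<close> share a
  longest common prefix, and \<open>U\<close> must be wide enough to separate two different continuations.\<close>

lemma regular_set_gap:
  assumes m: "1 \<le> m" and e: "0 < e" and K: "1 \<le> K"
    and x: "x \<in> regular_set s m e K" and y: "y \<in> regular_set s m e K"
    and agree: "\<And>i. i \<in> {1..n} \<Longrightarrow> x i = y i" and differ: "x (Suc n) < y (Suc n)"
  defines "n' \<equiv> n div m * m"
  shows "ln (exp (- (e * real ((2 * m + 3) * (m + 2)))) / (16 * (2 * real K) ^ (2 * m + 3)))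
      - 2 * ln (cf_den x 1 n' 0) - e * real ((2 * m + 3) * n') \<le> ln \<bar>cf_map x - cf_map y\<bar>"
    and "cf_map x \<noteq> cf_map y"
proof -
  have sp: "x \<in> space \<nu>" "y \<in> space \<nu>"
    using x y by (auto simp: regular_set_def)
  then have d: "digits x" "digits y"
    by (auto intro: digits_bernoulli)
  \<comment> \<open>One bound for all digits up to index n + 2; its factor 2 absorbs both the + 1 of
    the separation estimate and the 2 of \<open>cf_den_le_prod\<close>.\<close>
  define E where "E = 2 * real K * exp (e * real (n + 2))"
  have digit_le: "real (z i) + 1 \<le> E" "2 * real (z i) \<le> E"
    if z: "z \<in> regular_set s m e K" and i: "1 \<le> i" "i \<le> n + 2" for z i
  proof -
    have zi: "1 \<le> z i"
      using z i digits_bernoulli[of z] by (auto simp: regular_set_def digits_def)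
    obtain j where j: "i = Suc j"
      using i by (cases i) auto
    have "real (z i) \<le> real K * exp (e * real j)"
      using z by (simp add: regular_set_def j)
    also have "\<dots> \<le> real K * exp (e * real (n + 2))"
      using i e by (intro mult_left_mono) (auto simp: j)
    finally have "2 * real (z i) \<le> E"
      by (simp add: E_def)
    then show "2 * real (z i) \<le> E" "real (z i) + 1 \<le> E"
      using zi by auto
  qed
  have E1: "1 \<le> E"
  proof -
    have "1 \<le> x 1"
      using d(1) by (simp add: digits_def)
    then show ?thesis
      using digit_le(2)[OF x, of 1] by linarith
  qed
  \<comment> \<open>Mass bounds are available at multiples of m only, so n is rounded down to n',
    and the fewer than m digits in between are estimated crudely.\<close>
  define q where "q = cf_den x 1 n' 0"
  have n': "n' \<le> n" "n - n' < m"
    using m by (auto simp: n'_def minus_div_mult_eq_mod)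
  then have nn: "n = n' + (n - n')"
    by simp
  have p: "pos_digits x 1 n" "pos_digits x 1 n'" "pos_digits x (1 + n') (n - n')"
    by (auto intro!: psi_pos_digits sp)
  have q1: "1 \<le> q"
    unfolding q_def by (intro cf_den_ge_1 p) simp
  have "cf_den x (1 + n') (n - n') 0 \<le> (\<Prod>i\<in>{1 + n'..<1 + n' + (n - n')}. 2 * real (x i))"
    by (rule cf_den_le_prod[OF p(3)]) auto
  also have "\<dots> \<le> (\<Prod>i\<in>{1 + n'..<1 + n' + (n - n')}. E)"
    using n' by (intro prod_mono conjI digit_le(2)[OF x]) auto
  also have "\<dots> = E ^ (n - n')"
    by simp
  also have "\<dots> \<le> E ^ m"
    using n' E1 by (intro power_increasing) auto
  finally have rest: "cf_den x (1 + n') (n - n') 0 \<le> E ^ m" .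
  have "cf_den x 1 n 0 \<le> 2 * (q * cf_den x (1 + n') (n - n') 0)"
    using cf_den_quasi_mult(2)[of x 1 n' "n - n'"] p(1) nn by (simp add: q_def)
  also have "\<dots> \<le> 2 * (q * E ^ m)"
    using rest q1 by (intro mult_left_mono) auto
  finally have den: "cf_den x 1 n 0 \<le> 2 * (q * E ^ m)" .
  have den1: "1 \<le> cf_den x 1 n 0"
    by (intro cf_den_ge_1 p) simp
  define P where "P = 4 * (cf_den x 1 n 0)\<^sup>2 *
      ((real (x (Suc n)) + 1) * (real (y (Suc n)) + 1) * (real (y (n + 2)) + 1))"
  have P0: "0 < P"
    unfolding P_def using den1 by (intro mult_pos_pos) auto
  \<comment> \<open>The exponent 2 m + 3 arises here: E^m squared for the digits after the last full
    block, and three more factors for the digits at the splitting position.\<close>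
  have "P \<le> 4 * (2 * (q * E ^ m))\<^sup>2 * (E * E * E)"
    unfolding P_def using den den1 digit_le(1)[OF x, of "Suc n"] digit_le(1)[OF y, of "Suc n"]
      digit_le(1)[OF y, of "n + 2"] E1
    by (intro mult_mono power_mono) auto
  also have "\<dots> = 16 * q\<^sup>2 * E ^ (2 * m + 3)"
  proof -
    have "2 * m + 3 = m + m + 3"
      by simp
    then have "E ^ (2 * m + 3) = E ^ m * E ^ m * (E * E * E)"
      by (simp only: power_add power3_eq_cube)
    moreover have "4 * (2 * (q * F))\<^sup>2 * G = 16 * q\<^sup>2 * (F * F * G)" for F G
      by (simp add: power_mult_distrib power2_eq_square)
    ultimately show ?thesis
      by (simp only:)
  qed
  finally have P_le: "P \<le> 16 * q\<^sup>2 * E ^ (2 * m + 3)" .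
  have gap: "1 / P \<le> \<bar>cf_map x - cf_map y\<bar>"
    unfolding P_def by (rule cf_map_separation[OF d agree differ])
  moreover have "0 < 1 / P"
    using P0 by simp
  ultimately show "cf_map x \<noteq> cf_map y"
    by auto
  have lnE: "ln E = ln (2 * real K) + e * real (n + 2)"
    using K unfolding E_def by (subst ln_mult_pos) auto
  have "ln P \<le> ln (16 * q\<^sup>2 * E ^ (2 * m + 3))"
    using P_le P0 by (intro ln_mono) auto
  also have "\<dots> = ln 16 + 2 * ln q + real (2 * m + 3) * ln E"
    using q1 E1 by (simp add: ln_mult_pos ln_realpow)
  also have "\<dots> \<le> ln 16 + 2 * ln q + real (2 * m + 3) * (ln (2 * real K) + e * real (n' + m + 2))"
    using n' e unfolding lnE by (intro add_left_mono mult_left_mono) auto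
  finally have "ln P \<le> ln 16 + 2 * ln q + real (2 * m + 3) * (ln (2 * real K) + e * real (n' + m + 2))" .
  moreover have "- ln P = ln (1 / P)"
    using P0 by (simp add: ln_div)
  moreover have "ln (1 / P) \<le> ln \<bar>cf_map x - cf_map y\<bar>"
    using gap P0 by (intro ln_mono) auto
  moreover have "ln (exp (- (e * real ((2 * m + 3) * (m + 2)))) / (16 * (2 * real K) ^ (2 * m + 3)))
      = - (e * real ((2 * m + 3) * (m + 2))) - (ln 16 + real (2 * m + 3) * ln (2 * real K))"
  proof -
    have "ln (16 * (2 * real K) ^ (2 * m + 3)) = ln 16 + real (2 * m + 3) * ln (2 * real K)"
    proof -
      have "ln ((2 * real K) ^ (2 * m + 3)) = real (2 * m + 3) * ln (2 * real K)"
        by (rule ln_realpow)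
      then show ?thesis
        using K by (subst ln_mult_pos) auto
    qed
    then show ?thesis
      using K by (subst ln_divide_pos) auto
  qed
  moreover have "real (2 * m + 3) * (ln (2 * real K) + e * real (n' + m + 2))
      = real (2 * m + 3) * ln (2 * real K) + e * real ((2 * m + 3) * (m + 2)) + e * real ((2 * m + 3) * n')"
    by (simp add: algebra_simps)
  ultimately show "ln (exp (- (e * real ((2 * m + 3) * (m + 2)))) / (16 * (2 * real K) ^ (2 * m + 3)))
      - 2 * ln (cf_den x 1 n' 0) - e * real ((2 * m + 3) * n') \<le> ln \<bar>cf_map x - cf_map y\<bar>"
    unfolding q_def by linarith
qed

text \<open>The covering sets are arbitrary, so a measurable V is provided in place of the preimage
  of U. The value of e makes the exponential loss in the gap, raised to the power s', exactly (s -
  s') N m ln 2 on the logarithmic scale. This is paid for by the spare power q^(2 (s - s')), because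
  q grows at least like 2^(N m / 2).\<close>

lemma regular_set_mass:
  assumes m: "1 \<le> m" and K: "1 \<le> K" and s': "0 < s'" "s' < s"
  defines "e \<equiv> (s - s') * ln 2 / (s' * real (2 * m + 3))"
  shows "\<exists>C>0. \<forall>U. bounded U \<longrightarrow> (\<exists>V \<in> sets \<nu>. {x \<in> regular_set s m e K. cf_map x \<in> U} \<subseteq> V \<and>
    emeasure \<nu> V \<le> ennreal (C * hausdorff_gauge s' U))"
proof -
  have e: "0 < e"
    using s' by (simp add: e_def)
  define R where "R = regular_set s m e K"
  define \<kappa> where "\<kappa> = exp (- (e * real ((2 * m + 3) * (m + 2)))) / (16 * (2 * real K) ^ (2 * m + 3))"
  have \<kappa>: "0 < \<kappa>"
    using K by (simp add: \<kappa>_def)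
  define C where "C = exp (ln (real K) + (s - s') * ln 2 - s' * ln \<kappa>)"
  have C: "0 < C"
    by (simp add: C_def)
  have R_space: "x \<in> space \<nu>" if "x \<in> R" for x
    using that by (simp add: R_def regular_set_def)
  have cyl: "emeasure \<nu> (cylinder x (N * m)) \<le> ennreal (real K * cf_den x 1 (N * m) 0 powr - (2 * s))"
    "1 \<le> cf_den x 1 (N * m) 0" if x: "x \<in> R" for x N
  proof -
    have p: "pos_digits x 1 (N * m)"
      by (intro psi_pos_digits R_space x) simp
    then show Q: "1 \<le> cf_den x 1 (N * m) 0"
      by (intro cf_den_ge_1) auto
    have "cf_den x 1 (N * m) 0 powr (2 * s) * word_prob x 1 (N * m) \<le> real K"
      using x by (simp add: R_def regular_set_def)
    then have "word_prob x 1 (N * m) \<le> real K * cf_den x 1 (N * m) 0 powr - (2 * s)"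
      using Q by (simp add: powr_minus_divide le_divide_eq mult.commute)
    then show "emeasure \<nu> (cylinder x (N * m)) \<le> ennreal (real K * cf_den x 1 (N * m) 0 powr - (2 * s))"
      by (simp add: emeasure_cylinder[OF p] ennreal_leI)
  qed
  have "\<exists>V \<in> sets \<nu>. {x \<in> R. cf_map x \<in> U} \<subseteq> V \<and> emeasure \<nu> V \<le> ennreal (C * hausdorff_gauge s' U)"
    if U: "bounded U" for U
  proof -
    define X where "X = {x \<in> R. cf_map x \<in> U}"
    consider "X = {}" | x where "X = {x}" | x y where "x \<in> X" "y \<in> X" "x \<noteq> y"
      by blast
    then have "\<exists>V \<in> sets \<nu>. X \<subseteq> V \<and> emeasure \<nu> V \<le> ennreal (C * hausdorff_gauge s' U)"
    proof cases
      case 1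
      then show ?thesis
        by (intro bexI[of _ "{}"]) auto
    next
      case (2 x)
      then have x: "x \<in> R"
        by (auto simp: X_def)
      \<comment> \<open>U may have diameter 0, so the bound has to hold with 0 on the right: the
        cylinders around a single regular point shrink to a null set.\<close>
      define V where "V = (\<Inter>N. cylinder x (N * m))"
      have V: "V \<in> sets \<nu>"
        unfolding V_def by (intro sets.countable_INT) auto
      have le: "emeasure \<nu> V \<le> ennreal (real K * (2 powr - (2 * s)) ^ j)" for j
      proof -
        have "j \<le> 2 * j * m div 2"
          using m by simp
        then have "(2::real) ^ j \<le> 2 ^ (2 * j * m div 2)"
          by (intro power_increasing) auto
        also have "\<dots> \<le> cf_den x 1 (2 * j * m) 0"
          by (intro power2_le_cf_den psi_pos_digits R_space x) auto
        finally have "cf_den x 1 (2 * j * m) 0 powr - (2 * s) \<le> (2 ^ j) powr - (2 * s)"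
          using s' by (intro powr_mono2') auto
        also have "\<dots> = (2 powr - (2 * s)) ^ j"
          by (simp add: powr_realpow[symmetric] powr_powr mult.commute)
        finally have "real K * cf_den x 1 (2 * j * m) 0 powr - (2 * s) \<le> real K * (2 powr - (2 * s)) ^ j"
          by (intro mult_left_mono) auto
        moreover have "emeasure \<nu> V \<le> emeasure \<nu> (cylinder x (2 * j * m))"
          by (intro emeasure_mono) (auto simp: V_def)
        ultimately show ?thesis
          using cyl(1)[OF x, of "2 * j"] by (meson ennreal_leI order_trans)
      qed
      have "2 powr - (2 * s) < (2::real) powr 0"
        using s' by (intro powr_less_mono) auto
      then have "(\<lambda>j. real K * (2 powr - (2 * s)) ^ j) \<longlonglongrightarrow> real K * 0"
        by (intro tendsto_intros LIMSEQ_realpow_zero) auto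
      then have "(\<lambda>j. ennreal (real K * (2 powr - (2 * s)) ^ j)) \<longlonglongrightarrow> ennreal 0"
        by (intro tendsto_ennrealI) simp
      then have "emeasure \<nu> V \<le> ennreal 0"
        using le by (intro LIMSEQ_le_const) auto
      moreover have "X \<subseteq> V"
        using 2 R_space[OF x] by (auto simp: V_def cylinder_def)
      ultimately show ?thesis
        using V by (intro bexI[of _ V]) auto
    next
      case (3 x0 y0)
      have "\<exists>n. \<exists>x\<in>X. \<exists>y\<in>X. x (Suc n) \<noteq> y (Suc n)"
      proof (rule ccontr)
        assume no: "\<nexists>n. \<exists>x\<in>X. \<exists>y\<in>X. x (Suc n) \<noteq> y (Suc n)"
        have "x0 i = y0 i" for i
        proof (cases i)
          case 0
          have "x0 \<in> extensional {1..}" "y0 \<in> extensional {1..}"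
            using 3 R_space[of x0] R_space[of y0] by (auto simp: X_def space_bernoulli PiE_iff)
          then show ?thesis
            using 0 by (simp add: extensional_def)
        qed (use no 3 in auto)
        then show False
          using 3 by auto
      qed
      then have ex: "\<exists>n. \<exists>x\<in>X. \<exists>y\<in>X. x (Suc n) \<noteq> y (Suc n)" .
      \<comment> \<open>Minimality places all of X in one cylinder of length n, while two of its
        points already split at the next digit.\<close>
      define n where "n = (LEAST n. \<exists>x\<in>X. \<exists>y\<in>X. x (Suc n) \<noteq> y (Suc n))"
      have "\<exists>x\<in>X. \<exists>y\<in>X. x (Suc n) \<noteq> y (Suc n)"
        unfolding n_def by (rule LeastI_ex[OF ex])
      then obtain x y where xy: "x \<in> X" "y \<in> X" "x (Suc n) < y (Suc n)"
        by (metis linorder_neqE_nat)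
      have agree: "u i = v i" if "u \<in> X" "v \<in> X" "i \<in> {1..n}" for u v i
      proof -
        have "i - 1 < n"
          using that by auto
        from not_less_Least[OF this[unfolded n_def]] show ?thesis
          using that by auto
      qed
      define N where "N = n div m"
      define q where "q = cf_den x 1 (N * m) 0"
      define r where "r = \<bar>cf_map x - cf_map y\<bar>"
      have xR: "x \<in> R" "y \<in> R" "cf_map x \<in> U" "cf_map y \<in> U"
        using xy by (auto simp: X_def)
      have gap: "ln \<kappa> - 2 * ln q - e * real ((2 * m + 3) * (N * m)) \<le> ln r" "0 < r"
        using regular_set_gap[OF m e K xR(1,2)[unfolded R_def] agree[OF xy(1,2)] xy(3)]
        by (auto simp: \<kappa>_def q_def r_def N_def)
      have q1: "1 \<le> q"
        unfolding q_def by (rule cyl(2)[OF xR(1)])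
      \<comment> \<open>The loss of 1 accounts for an odd N m; it reappears as the summand (s - s')
        ln 2 in the logarithm of C.\<close>
      have "real (N * m) - 1 \<le> 2 * real (N * m div 2)"
        by linarith
      then have "(real (N * m) - 1) * ln 2 \<le> 2 * real (N * m div 2) * ln 2"
        by (intro mult_right_mono) auto
      also have "\<dots> = 2 * ln (2 ^ (N * m div 2))"
        by (simp add: ln_realpow)
      also have "\<dots> \<le> 2 * ln q"
        unfolding q_def by (intro mult_left_mono ln_mono power2_le_cf_den psi_pos_digits R_space xR) auto
      finally have "(real (N * m) - 1) * ln 2 \<le> 2 * ln q" .
      then have "(s - s') * ((real (N * m) - 1) * ln 2) \<le> (s - s') * (2 * ln q)"
        using s' by (intro mult_left_mono) auto
      moreover have "s' * (e * real ((2 * m + 3) * (N * m))) = (s - s') * (real (N * m) * ln 2)"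
        using s' by (simp add: e_def)
      moreover have "s' * (ln \<kappa> - 2 * ln q - e * real ((2 * m + 3) * (N * m))) \<le> s' * ln r"
        using gap(1) s' by (intro mult_left_mono) auto
      ultimately have "ln (real K) - 2 * s * ln q
          \<le> (ln (real K) + (s - s') * ln 2 - s' * ln \<kappa>) + s' * ln r"
        by (simp add: algebra_simps)
      then have "exp (ln (real K) - 2 * s * ln q)
          \<le> exp (ln (real K) + (s - s') * ln 2 - s' * ln \<kappa>) * exp (s' * ln r)"
        by (simp flip: exp_add)
      moreover have "exp (ln (real K) - 2 * s * ln q) = real K * q powr - (2 * s)"
        using K q1 by (simp add: exp_diff exp_minus divide_inverse powr_def)
      moreover have "exp (s' * ln r) = r powr s'"
        using gap(2) by (simp add: powr_def)
      ultimately have "real K * q powr - (2 * s) \<le> C * r powr s'"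
        by (simp add: C_def)
      also have "\<dots> \<le> C * hausdorff_gauge s' U"
      proof -
        have "r \<le> diameter U"
          using diameter_bounded_bound[OF U xR(3,4)] by (simp add: r_def dist_real_def)
        then have "r powr s' \<le> diameter U powr s'"
          using s' gap(2) by (intro powr_mono2) auto
        also have "\<dots> = hausdorff_gauge s' U"
          using xR(3) s' by (auto simp: hausdorff_gauge_def)
        finally show ?thesis
          using C by (intro mult_left_mono) auto
      qed
      finally have "ennreal (real K * q powr - (2 * s)) \<le> ennreal (C * hausdorff_gauge s' U)"
        by (rule ennreal_leI)
      then have "emeasure \<nu> (cylinder x (N * m)) \<le> ennreal (C * hausdorff_gauge s' U)"
        using cyl(1)[OF xR(1), of N] unfolding q_def by (rule order_trans[rotated])
      moreover have "X \<subseteq> cylinder x (N * m)"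
      proof
        fix z
        assume z: "z \<in> X"
        have "N * m \<le> n"
          by (simp add: N_def)
        then have "z i = x i" if "i \<in> {1..<1 + N * m}" for i
          using that by (intro agree z xy) auto
        then show "z \<in> cylinder x (N * m)"
          using z R_space by (auto simp: cylinder_def X_def)
      qed
      ultimately show ?thesis
        by (intro bexI[of _ "cylinder x (N * m)"]) auto
    qed
    then show ?thesis
      by (simp add: X_def)
  qed
  then show ?thesis
    using C unfolding R_def by blast
qed

text \<open>Some regular set meets the preimage of B in positive measure, since countably many of
  them exhaust the space up to a null set. A cover of B with small gauge sum would cover this part
  by sets of smaller total measure.\<close>

lemma hausdorff_measure_nonzero:
  assumes B: "B \<in> sets (cf_measure p)" "emeasure (cf_measure p) B = 1" and s': "0 < s'" "s' < opt_dim"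
  shows "hausdorff_measure s' B \<noteq> 0"
proof
  assume zero: "hausdorff_measure s' B = 0"
  obtain s where s: "s' < s" "s < opt_dim"
    using s' dense by blast
  then have "0 < s"
    using s' by simp
  then obtain m where m: "1 \<le> m" and ae: "\<And>e. 0 < e \<Longrightarrow> AE x in \<nu>. \<exists>K\<ge>1. x \<in> regular_set s m e K"
    using regular_set_exhausts[OF _ s(2)] by blast
  define e where "e = (s - s') * ln 2 / (s' * real (2 * m + 3))"
  have e: "0 < e"
    using s s' by (simp add: e_def)
  define A where "A = cf_map -` B \<inter> space \<nu>"
  have A [measurable]: "A \<in> sets \<nu>"
    unfolding A_def using B(1) by (intro measurable_sets[OF cf_map_measurable]) (simp add: sets_cf_measure)
  have A1: "emeasure \<nu> A = 1"
    using B emeasure_cf_measure by (simp add: A_def)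
  have "\<exists>K\<ge>1. emeasure \<nu> (regular_set s m e K \<inter> A) \<noteq> 0"
  proof (rule ccontr)
    assume no: "\<nexists>K. K \<ge> 1 \<and> emeasure \<nu> (regular_set s m e K \<inter> A) \<noteq> 0"
    have "AE x in \<nu>. x \<notin> regular_set s m e K \<inter> A" if "1 \<le> K" for K
      using no that by (intro AE_not_in) (auto simp: null_sets_def)
    then have "AE x in \<nu>. \<forall>K. 1 \<le> K \<longrightarrow> x \<notin> regular_set s m e K \<inter> A"
      by (subst AE_all_countable) auto
    then have "AE x in \<nu>. x \<notin> A"
      using ae[OF e] by eventually_elim auto
    then have "emeasure \<nu> A = 0"
      using A by (subst (asm) AE_iff_null_sets[symmetric, OF A]) auto
    then show False
      using A1 by simp
  qed
  then obtain K where K: "1 \<le> K" and nz: "emeasure \<nu> (regular_set s m e K \<inter> A) \<noteq> 0"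
    by blast
  from regular_set_mass[OF m K s'(1) s(1), folded e_def] obtain C where C: "0 < C"
    and V: "\<And>U. bounded U \<Longrightarrow> \<exists>V \<in> sets \<nu>. {x \<in> regular_set s m e K. cf_map x \<in> U} \<subseteq> V \<and>
      emeasure \<nu> V \<le> ennreal (C * hausdorff_gauge s' U)"
    by blast
  define \<mu> where "\<mu> = measure \<nu> (regular_set s m e K \<inter> A)"
  have \<mu>: "0 < \<mu>" "emeasure \<nu> (regular_set s m e K \<inter> A) = ennreal \<mu>"
    using nz by (auto simp: \<mu>_def emeasure_eq_measure zero_less_measure_iff measure_nonneg less_le)
  have "hausdorff_premeasure 1 s' B \<le> hausdorff_measure s' B"
    unfolding hausdorff_measure_def by (rule SUP_upper) simp
  \<comment> \<open>The threshold is such that multiplication by C leaves only half of the mass to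
    be covered.\<close>
  then have "hausdorff_premeasure 1 s' B < ennreal (\<mu> / (2 * C))"
    using zero \<mu> C by simp
  then obtain U where U: "B \<subseteq> (\<Union>i::nat. U i)" "\<And>i. bounded (U i)"
    "(\<Sum>i. ennreal (hausdorff_gauge s' (U i))) < ennreal (\<mu> / (2 * C))"
    unfolding hausdorff_premeasure_def by (auto simp: INF_less_iff)
  define Y where "Y i = (SOME V. V \<in> sets \<nu> \<and> {x \<in> regular_set s m e K. cf_map x \<in> U i} \<subseteq> V \<and>
      emeasure \<nu> V \<le> ennreal (C * hausdorff_gauge s' (U i)))" for i
  have "Y i \<in> sets \<nu> \<and> {x \<in> regular_set s m e K. cf_map x \<in> U i} \<subseteq> Y i \<and>
      emeasure \<nu> (Y i) \<le> ennreal (C * hausdorff_gauge s' (U i))" for i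
    unfolding Y_def by (rule someI_ex) (use V[OF U(2)] in blast)
  then have Y: "\<And>i. Y i \<in> sets \<nu>" "\<And>i. {x \<in> regular_set s m e K. cf_map x \<in> U i} \<subseteq> Y i"
    "\<And>i. emeasure \<nu> (Y i) \<le> ennreal (C * hausdorff_gauge s' (U i))"
    by blast+
  have "regular_set s m e K \<inter> A \<subseteq> (\<Union>i. Y i)"
    using U(1) Y(2) unfolding A_def by blast
  then have "ennreal \<mu> \<le> emeasure \<nu> (\<Union>i. Y i)"
    unfolding \<mu>(2)[symmetric] using Y(1) by (intro emeasure_mono) auto
  also have "\<dots> \<le> (\<Sum>i. emeasure \<nu> (Y i))"
    using Y(1) by (intro emeasure_subadditive_countably) auto
  also have "\<dots> \<le> (\<Sum>i. ennreal C * ennreal (hausdorff_gauge s' (U i)))"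
  proof (intro suminf_le summableI)
    fix i
    have "0 \<le> hausdorff_gauge s' (U i)"
      by (simp add: hausdorff_gauge_def)
    then show "emeasure \<nu> (Y i) \<le> ennreal C * ennreal (hausdorff_gauge s' (U i))"
      using Y(3)[of i] C by (simp add: ennreal_mult)
  qed
  also have "\<dots> = ennreal C * (\<Sum>i. ennreal (hausdorff_gauge s' (U i)))"
    by (rule ennreal_suminf_cmult)
  also have "\<dots> \<le> ennreal C * ennreal (\<mu> / (2 * C))"
    using U(3) by (intro mult_left_mono) auto
  also have "\<dots> = ennreal (\<mu> / 2)"
    using C \<mu> by (simp flip: ennreal_mult)
  finally show False
    using \<mu> by simp
qed

lemma measure_dim_optimal: "measure_dim (cf_measure p) = opt_dim"
proof (rule antisym[OF measure_dim_le_opt_dim measure_dim_ge])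
  fix B
  assume B: "B \<in> sets (cf_measure p)" "emeasure (cf_measure p) B = 1"
  show "opt_dim \<le> hausdorff_dim B"
  proof (rule hausdorff_dim_ge)
    show "B \<subseteq> {0..<1}"
      using B(1) by (rule sets_cf_measure_subset)
    fix s :: real
    assume s: "0 \<le> s" "s < opt_dim"
    have "B \<noteq> {}"
      using B(2) by auto
    then show "hausdorff_measure s B \<noteq> 0"
      using hausdorff_measure_nonzero[OF B _ s(2)] hausdorff_measure_0_nonempty[of B] s(1)
      by (cases "s = 0") auto
  qed
qed

end

theorem theorem1p1:
  fixes D :: real
  assumes D_def: "D = (SUP p \<in> prob_vectors. measure_dim (cf_measure p))"
  shows "\<exists>p \<in> prob_vectors.
           measure_dim (cf_measure p) = D \<and>
           (\<exists>c>1. \<forall>k::nat. k \<ge> 1 \<longrightarrow>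
              1 / (c * real k powr (2 * D)) \<le> p k \<and> p k \<le> c / real k powr (2 * D)) \<and>
           ergodic (cf_measure p) gauss_map"
proof -
  obtain p where p: "p \<in> log_vectors" "weight_entropy p = opt_dim * lyapunov p"
    using exists_maximizer by blast
  obtain c where c: "1 < c" "\<forall>k\<ge>1. 1 / (c * real k powr (2 * opt_dim)) \<le> p k \<and> p k \<le> c / real k powr (2 * opt_dim)"
    using maximizer_weights[OF p] by blast
  interpret optimal_bernoulli p c
    using p c by unfold_locales (auto simp: log_vectors_def)
  have "D = opt_dim"
    unfolding D_def
  proof (rule cSup_eq_maximum)
    show "opt_dim \<in> (\<lambda>p. measure_dim (cf_measure p)) ` prob_vectors"
      using measure_dim_optimal prob_vector by (auto intro!: image_eqI[of _ _ p])
    show "d \<le> opt_dim" if "d \<in> (\<lambda>p. measure_dim (cf_measure p)) ` prob_vectors" for d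
      using that bernoulli.measure_dim_le_opt_dim by (auto simp: bernoulli_def)
  qed
  then show ?thesis
    using prob_vector measure_dim_optimal c ergodic_cf_measure by blast
qed

end
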